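(* Let $\Gamma$ be a non-elementary word hyperbolic group whose Gromov boundary $\partial\Gamma$ has Ahlfors-regular conformal dimension strictly less than $2$, let $\mu\in M_2$, and let $\omega$ be a finite measure on $\Gamma$ with full support. Let $(Y_t)$ be the time-changed (killed) random walk on $\Gamma$ with speed measure $\omega$ and $(W_t)$ the reflecting random walk on $\Gamma\cup\partial\Gamma$, as defined in the context. Then (for the same starting point in $\Gamma$) $$(Y_t\,;\,0\le t<\sigma_Y(\Gamma))\overset{(d)}{=}(W_t\,;\,0\le t<\sigma_W(\Gamma)).$$
   Context: Group and walks. $\Gamma$ is equipped with the word metric $|\cdot-\cdot|_\Gamma$ of a fixed finite symmetric generating set; $id$ is the neutral element; $\partial\Gamma$ is the Gromov boundary and $\Gamma\cup\partial\Gamma$ the Gromov compactification. Probability measures $\mu$ on $\Gamma$ are symmetric ($\mu(x)=\mu(x^{-1})$) and admissible (the support generates $\Gamma$); $M_k$ is the set of such $\mu$ with $\sum_x |id-x|_\Gamma^k\mu(x)<\infty$. $(R_n)$ is the discrete-time random walk with transition probabilities $p(x,y)=\mu(x^{-1}y)$; for $\mu\in M_1$ it converges a.s. in $\Gamma\cup\partial\Gamma$ to a random point $R_\infty\in\partial\Gamma$; $\nu$ is the law of $R_\infty$ when $R_0=id$. The process $Y$. Let $(X_t)$ be the constant speed random walk $X_t=R_{N_t}$, with $(N_t)$ an independent rate-1 Poisson process. $(Y_t)$ is the time change of $(X_t)$ by the right-continuous inverse of $t\mapsto\int_0^t\omega(X_s)ds$; thus at $x\in\Gamma$ its holding time is exponential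 with mean $\omega(x)$, and it dies (is sent to a cemetery point outside $\Gamma$) at the a.s. finite time $\int_0^\infty\omega(X_s)ds$. It corresponds to the regular Dirichlet form $(\mathcal{E}^\mu,\ell_2(\Gamma))$ on $L^2(\Gamma,\omega)$, where $\mathcal{E}^\mu(f,g)=\frac12\sum_{x,y\in\Gamma}\mu(x^{-1}y)(f(x)-f(y))(g(x)-g(y))$. The process $W$. Let $\mathcal{F}^\mu=\{f:\Gamma\to\mathbb{R}:\mathcal{E}^\mu(f,f)<\infty\}$. Each $f\in\mathcal{F}^\mu$ has a boundary value ($\nu$-a.e. defined) on $\partial\Gamma$ determined by $\lim_n f(R_n)=f(R_\infty)$ a.s. $\tilde{\mathcal{F}}^\mu$ is the set of functions on $\Gamma\cup\partial\Gamma$ extending functions of $\mathcal{F}^\mu$ by their boundary values; $\tilde{\mathcal{F}}^\mu(\omega)=\{f\in\tilde{\mathcal{F}}^\mu:f|_\Gamma\in L^2(\Gamma,\omega)\}$; $\tilde{\mathcal{E}}^\mu(f,f)=\mathcal{E}^\mu(f|_\Gamma,f|_\Gamma)$. Viewing $\omega$ as a measure on $\Gamma\cup\partial\Gamma$ with $\omega(\partial\Gamma)=0$, under the dimension assumption $(\tilde{\mathcal{E}}^\mu,\tilde{\mathcal{F}}^\mu(\omega))$ is a regular Dirichlet form on $L^2(\Gamma\cup\partial\Gamma,\omega)$, with extended Dirichlet space $(\tilde{\mathcal{F}}^\mu,\tilde{\mathcal{E}}^\mu)$; $(W_t)$ is the associated $\omega$-symmetric Hunt process on $\Gamma\cup\partial\Gamma$.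 For a process $(S_t)$, $\sigma_S(\Gamma)=\inf\{t>0:S_t\notin\Gamma\}$. Ahlfors-regular conformal dimension. A visual metric on $\partial\Gamma$ is a metric comparable, up to multiplicative constants, to $e^{-a(\xi|\eta)_{id}}$ for some $a>0$, with $(\cdot|\cdot)_{id}$ the Gromov product; fix one, $\rho_\Gamma$. Metrics $d,d'$ are quasi-symmetric if there is an increasing homeomorphism $\alpha:[0,\infty)\to[0,\infty)$ with $\frac{d(\xi,\eta)}{d(\xi,\zeta)}\le\alpha\left(\frac{d'(\xi,\eta)}{d'(\xi,\zeta)}\right)$ for all distinct triples. A metric $d$ of Hausdorff dimension $q$ is Ahlfors-regular if its Hausdorff measure $\mathcal{H}_d$ satisfies $Cr^q\le\mathcal{H}_d(B_d(\xi,r))\le C'r^q$ for all $\xi$ and $0<r<\mathrm{diam}$. The Ahlfors-regular conformal dimension of $\partial\Gamma$ is the infimum of the Hausdorff dimensions of Ahlfors-regular metrics quasi-symmetric to $\rho_\Gamma$. *)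

theory Defs
  imports
    "HOL-Algebra.Generated_Groups"
    "HOL-Algebra.Coset"
    "HOL-Probability.Probability"
begin

section \<open>Word hyperbolic groups\<close>

definition finite_symmetric_generators :: "('a, 'b) monoid_scheme \<Rightarrow> 'a set \<Rightarrow> bool" where
  "finite_symmetric_generators G S \<longleftrightarrow>
     finite S \<and> S \<subseteq> carrier G \<and> (\<forall>s\<in>S. inv\<^bsub>G\<^esub> s \<in> S) \<and> generate G S = carrier G"

definition word_length :: "('a, 'b) monoid_scheme \<Rightarrow> 'a set \<Rightarrow> 'a \<Rightarrow> nat" where
  "word_length G S x =
     (LEAST n. \<exists>ws. set ws \<subseteq> S \<and> length ws = n \<and> foldr (\<otimes>\<^bsub>G\<^esub>) ws \<one>\<^bsub>G\<^esub> = x)"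

definition word_dist :: "('a, 'b) monoid_scheme \<Rightarrow> 'a set \<Rightarrow> 'a \<Rightarrow> 'a \<Rightarrow> real" where
  "word_dist G S x y = real (word_length G S (inv\<^bsub>G\<^esub> x \<otimes>\<^bsub>G\<^esub> y))"

definition gromov_product ::
  "('a, 'b) monoid_scheme \<Rightarrow> 'a set \<Rightarrow> 'a \<Rightarrow> 'a \<Rightarrow> 'a \<Rightarrow> real" where
  "gromov_product G S w x y = (word_dist G S w x + word_dist G S w y - word_dist G S x y) / 2"

definition word_hyperbolic :: "('a, 'b) monoid_scheme \<Rightarrow> 'a set \<Rightarrow> bool" where
  "word_hyperbolic G S \<longleftrightarrow>
     (\<exists>\<delta>\<ge>0. \<forall>w\<in>carrier G. \<forall>x\<in>carrier G. \<forall>y\<in>carrier G. \<forall>z\<in>carrier G.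
        gromov_product G S w x z
          \<ge> min (gromov_product G S w x y) (gromov_product G S w y z) - \<delta>)"

text \<open>Non-elementary: not virtually cyclic. Finite groups have the trivial cyclic subgroup of
  finite index, so they are elementary too.\<close>

definition non_elementary :: "('a, 'b) monoid_scheme \<Rightarrow> bool" where
  "non_elementary G \<longleftrightarrow> \<not> (\<exists>g\<in>carrier G. finite (rcosets\<^bsub>G\<^esub> (generate G {g})))"


section \<open>Gromov boundary and Gromov compactification\<close>

definition gromov_sequence :: "('a, 'b) monoid_scheme \<Rightarrow> 'a set \<Rightarrow> (nat \<Rightarrow> 'a) \<Rightarrow> bool" where
  "gromov_sequence G S u \<longleftrightarrow> (\<forall>i. u i \<in> carrier G) \<and>
     filterlim (\<lambda>(i, j). gromov_product G S \<one>\<^bsub>G\<^esub> (u i) (u j)) at_top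
       (sequentially \<times>\<^sub>F sequentially)"

definition gromov_rel ::
  "('a, 'b) monoid_scheme \<Rightarrow> 'a set \<Rightarrow> ((nat \<Rightarrow> 'a) \<times> (nat \<Rightarrow> 'a)) set" where
  "gromov_rel G S = {(u, v). gromov_sequence G S u \<and> gromov_sequence G S v \<and>
     filterlim (\<lambda>(i, j). gromov_product G S \<one>\<^bsub>G\<^esub> (u i) (v j)) at_top
       (sequentially \<times>\<^sub>F sequentially)}"

definition gromov_boundary :: "('a, 'b) monoid_scheme \<Rightarrow> 'a set \<Rightarrow> (nat \<Rightarrow> 'a) set set" where
  "gromov_boundary G S = Collect (gromov_sequence G S) // gromov_rel G S"

datatype 'a point = Inner 'a | Boundary "(nat \<Rightarrow> 'a) set"

definition compact_points :: "('a, 'b) monoid_scheme \<Rightarrow> 'a set \<Rightarrow> 'a point set" where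
  "compact_points G S = Inner ` carrier G \<union> Boundary ` gromov_boundary G S"

fun representatives :: "'a point \<Rightarrow> (nat \<Rightarrow> 'a) set" where
  "representatives (Inner x) = {\<lambda>_. x}"
| "representatives (Boundary \<xi>) = \<xi>"

definition gromov_product_ext ::
  "('a, 'b) monoid_scheme \<Rightarrow> 'a set \<Rightarrow> 'a point \<Rightarrow> 'a point \<Rightarrow> ereal" where
  "gromov_product_ext G S p q =
     (SUP (u, v) \<in> representatives p \<times> representatives q.
        Liminf (sequentially \<times>\<^sub>F sequentially)
          (\<lambda>(i, j). ereal (gromov_product G S \<one>\<^bsub>G\<^esub> (u i) (v j))))"

text \<open>Points of the group are isolated; the sets of all \<open>z\<close> with \<open>(\<xi>|z) > r\<close> form a neighbourhood
  base at a boundary point \<open>\<xi>\<close> (they need not be open themselves).\<close>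

definition compactification_open ::
  "('a, 'b) monoid_scheme \<Rightarrow> 'a set \<Rightarrow> 'a point set \<Rightarrow> bool" where
  "compactification_open G S U \<longleftrightarrow> U \<subseteq> compact_points G S \<and>
     (\<forall>\<xi>. Boundary \<xi> \<in> U \<longrightarrow>
        (\<exists>r::real. \<forall>z\<in>compact_points G S.
           gromov_product_ext G S (Boundary \<xi>) z > ereal r \<longrightarrow> z \<in> U))"

definition gromov_compactification :: "('a, 'b) monoid_scheme \<Rightarrow> 'a set \<Rightarrow> 'a point topology" where
  "gromov_compactification G S = topology (compactification_open G S)"

lemma istopology_compactification_open: "istopology (compactification_open G S)"
  unfolding istopology_def
proof (intro conjI allI impI)
  fix U V assume U: "compactification_open G S U" and V: "compactification_open G S V"
  show "compactification_open G S (U \<inter> V)"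
    unfolding compactification_open_def
  proof (intro conjI allI impI)
    show "U \<inter> V \<subseteq> compact_points G S"
      using U by (auto simp: compactification_open_def)
    fix \<xi> assume \<xi>: "Boundary \<xi> \<in> U \<inter> V"
    obtain r1 where r1: "\<And>z. z \<in> compact_points G S \<Longrightarrow>
        gromov_product_ext G S (Boundary \<xi>) z > ereal r1 \<Longrightarrow> z \<in> U"
      using U \<xi> unfolding compactification_open_def by blast
    obtain r2 where r2: "\<And>z. z \<in> compact_points G S \<Longrightarrow>
        gromov_product_ext G S (Boundary \<xi>) z > ereal r2 \<Longrightarrow> z \<in> V"
      using V \<xi> unfolding compactification_open_def by blast
    show "\<exists>r::real. \<forall>z\<in>compact_points G S.
        gromov_product_ext G S (Boundary \<xi>) z > ereal r \<longrightarrow> z \<in> U \<inter> V"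
    proof (intro exI ballI impI IntI)
      fix z assume z: "z \<in> compact_points G S"
        and gt: "gromov_product_ext G S (Boundary \<xi>) z > ereal (max r1 r2)"
      have "gromov_product_ext G S (Boundary \<xi>) z > ereal r1"
           "gromov_product_ext G S (Boundary \<xi>) z > ereal r2"
        using gt by (auto intro: le_less_trans[rotated])
      then show "z \<in> U" "z \<in> V" using r1[OF z] r2[OF z] by auto
    qed
  qed
next
  fix \<K> assume *: "\<forall>K\<in>\<K>. compactification_open G S K"
  show "compactification_open G S (\<Union>\<K>)"
    using * unfolding compactification_open_def
    by (meson UnionE UnionI Union_least)
qed

lemma openin_gromov_compactification:
  "openin (gromov_compactification G S) U \<longleftrightarrow> compactification_open G S U"
  by (simp add: gromov_compactification_def istopology_compactification_open topology_inverse')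

lemma topspace_gromov_compactification [simp]:
  "topspace (gromov_compactification G S) = compact_points G S"
proof -
  have "openin (gromov_compactification G S) (compact_points G S)"
    by (auto simp: openin_gromov_compactification compactification_open_def)
  moreover have "U \<subseteq> compact_points G S" if "openin (gromov_compactification G S) U" for U
    using that by (auto simp: openin_gromov_compactification compactification_open_def)
  ultimately show ?thesis
    by (simp add: openin_subset openin_topspace subset_antisym)
qed


section \<open>Ahlfors-regular conformal dimension\<close>

definition visual_metric ::
  "('a, 'b) monoid_scheme \<Rightarrow> 'a set \<Rightarrow> ((nat \<Rightarrow> 'a) set \<Rightarrow> (nat \<Rightarrow> 'a) set \<Rightarrow> real) \<Rightarrow> bool" where
  "visual_metric G S \<rho> \<longleftrightarrow> Metric_space (gromov_boundary G S) \<rho> \<and>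
     (\<exists>a>0. \<exists>C>0. \<forall>\<xi>\<in>gromov_boundary G S. \<forall>\<eta>\<in>gromov_boundary G S. \<xi> \<noteq> \<eta> \<longrightarrow>
        (let e = exp (- a * real_of_ereal (gromov_product_ext G S (Boundary \<xi>) (Boundary \<eta>)))
         in e / C \<le> \<rho> \<xi> \<eta> \<and> \<rho> \<xi> \<eta> \<le> C * e))"

definition quasi_symmetric :: "'c set \<Rightarrow> ('c \<Rightarrow> 'c \<Rightarrow> real) \<Rightarrow> ('c \<Rightarrow> 'c \<Rightarrow> real) \<Rightarrow> bool" where
  "quasi_symmetric Z d d' \<longleftrightarrow>
     (\<exists>\<alpha> \<beta>. homeomorphism {0::real..} {0::real..} \<alpha> \<beta> \<and> strict_mono_on {0..} \<alpha> \<and>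
        (\<forall>\<xi>\<in>Z. \<forall>\<eta>\<in>Z. \<forall>\<zeta>\<in>Z. \<xi> \<noteq> \<eta> \<and> \<xi> \<noteq> \<zeta> \<and> \<eta> \<noteq> \<zeta> \<longrightarrow>
           d \<xi> \<eta> / d \<xi> \<zeta> \<le> \<alpha> (d' \<xi> \<eta> / d' \<xi> \<zeta>)))"

definition metric_diam :: "('c \<Rightarrow> 'c \<Rightarrow> real) \<Rightarrow> 'c set \<Rightarrow> ennreal" where
  "metric_diam d U = (SUP x\<in>U. SUP y\<in>U. ennreal (d x y))"

text \<open>\<open>diam(U)\<^sup>s\<close>, with \<open>diam(U)\<^sup>0 = 1\<close> for every nonempty \<open>U\<close> (note \<open>0 powr 0 = 0\<close>). It is only
  used for sets of finite diameter.\<close>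

definition hausdorff_gauge :: "('c \<Rightarrow> 'c \<Rightarrow> real) \<Rightarrow> real \<Rightarrow> 'c set \<Rightarrow> ennreal" where
  "hausdorff_gauge d s U =
     (if U = {} then 0 else if s = 0 then 1 else ennreal (enn2real (metric_diam d U) powr s))"

definition hausdorff_content ::
  "'c set \<Rightarrow> ('c \<Rightarrow> 'c \<Rightarrow> real) \<Rightarrow> real \<Rightarrow> real \<Rightarrow> 'c set \<Rightarrow> ennreal" where
  "hausdorff_content Z d s \<delta> A =
     (INF U \<in> {U :: nat \<Rightarrow> 'c set. A \<subseteq> (\<Union>i. U i) \<and>
                 (\<forall>i. U i \<subseteq> Z \<and> metric_diam d (U i) \<le> ennreal \<delta>)}.
        \<Sum>i. hausdorff_gauge d s (U i))"

definition hausdorff_measure ::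
  "'c set \<Rightarrow> ('c \<Rightarrow> 'c \<Rightarrow> real) \<Rightarrow> real \<Rightarrow> 'c set \<Rightarrow> ennreal" where
  "hausdorff_measure Z d s A = (SUP \<delta>\<in>{0<..}. hausdorff_content Z d s \<delta> A)"

definition hausdorff_dim :: "'c set \<Rightarrow> ('c \<Rightarrow> 'c \<Rightarrow> real) \<Rightarrow> ereal" where
  "hausdorff_dim Z d = (INF s\<in>{s. 0 \<le> s \<and> hausdorff_measure Z d s Z = 0}. ereal s)"

definition ahlfors_regular :: "'c set \<Rightarrow> ('c \<Rightarrow> 'c \<Rightarrow> real) \<Rightarrow> bool" where
  "ahlfors_regular Z d \<longleftrightarrow>
     (\<exists>q C C'. hausdorff_dim Z d = ereal q \<and> 0 < C \<and> 0 < C' \<and>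
        (\<forall>\<xi>\<in>Z. \<forall>r>0. ennreal r < metric_diam d Z \<longrightarrow>
           ennreal (C * r powr q) \<le> hausdorff_measure Z d q (Metric_space.mball Z d \<xi> r) \<and>
           hausdorff_measure Z d q (Metric_space.mball Z d \<xi> r) \<le> ennreal (C' * r powr q)))"

definition ahlfors_regular_conformal_dim :: "'c set \<Rightarrow> ('c \<Rightarrow> 'c \<Rightarrow> real) \<Rightarrow> ereal" where
  "ahlfors_regular_conformal_dim Z \<rho> =
     (INF d\<in>{d. Metric_space Z d \<and> ahlfors_regular Z d \<and> quasi_symmetric Z d \<rho>}. hausdorff_dim Z d)"


section \<open>Random walks\<close>

definition step_distributions ::
  "('a, 'b) monoid_scheme \<Rightarrow> 'a set \<Rightarrow> nat \<Rightarrow> 'a pmf set" where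
  "step_distributions G S k =
     {\<mu>. set_pmf \<mu> \<subseteq> carrier G \<and> (\<forall>x\<in>carrier G. pmf \<mu> (inv\<^bsub>G\<^esub> x) = pmf \<mu> x) \<and>
         generate G (set_pmf \<mu>) = carrier G \<and>
         (\<lambda>x. word_dist G S \<one>\<^bsub>G\<^esub> x ^ k * pmf \<mu> x) summable_on carrier G}"

definition random_walk ::
  "('a, 'b) monoid_scheme \<Rightarrow> 'a pmf \<Rightarrow> 'a \<Rightarrow> 'p measure \<Rightarrow> (nat \<Rightarrow> 'p \<Rightarrow> 'a) \<Rightarrow> bool" where
  "random_walk G \<mu> x P R \<longleftrightarrow>
     (\<forall>n. R n \<in> P \<rightarrow>\<^sub>M count_space (carrier G)) \<and>
     (\<forall>n y. (\<forall>i\<le>n. y i \<in> carrier G) \<longrightarrow>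
        measure P {w \<in> space P. \<forall>i\<le>n. R i w = y i} =
          (if y 0 = x then \<Prod>i<n. pmf \<mu> (inv\<^bsub>G\<^esub> (y i) \<otimes>\<^bsub>G\<^esub> y (Suc i)) else 0))"

definition poisson_process :: "'p measure \<Rightarrow> (real \<Rightarrow> 'p \<Rightarrow> nat) \<Rightarrow> bool" where
  "poisson_process P N \<longleftrightarrow>
     (\<forall>t\<ge>0. N t \<in> P \<rightarrow>\<^sub>M count_space UNIV) \<and>
     (AE w in P. N 0 w = 0 \<and> mono_on {0..} (\<lambda>t. N t w) \<and>
        (\<forall>t\<ge>0. ((\<lambda>s. N s w) \<longlongrightarrow> N t w) (at_right t))) \<and>
     (\<forall>s t. 0 \<le> s \<and> s < t \<longrightarrow>
        distr P (count_space UNIV) (\<lambda>w. N t w - N s w) = measure_pmf (poisson_pmf (t - s))) \<and>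
     (\<forall>(t :: nat \<Rightarrow> real) n. 0 \<le> t 0 \<and> strict_mono t \<longrightarrow>
        prob_space.indep_vars P (\<lambda>_. count_space UNIV)
          (\<lambda>i w. N (t (Suc i)) w - N (t i) w) {..<n})"

definition independent_processes ::
  "('a, 'b) monoid_scheme \<Rightarrow> 'p measure \<Rightarrow> (nat \<Rightarrow> 'p \<Rightarrow> 'a) \<Rightarrow> (real \<Rightarrow> 'p \<Rightarrow> nat) \<Rightarrow> bool" where
  "independent_processes G P R N \<longleftrightarrow>
     prob_space.indep_set P
       (sets (vimage_algebra (space P) (\<lambda>w n. R n w) (\<Pi>\<^sub>M n\<in>UNIV. count_space (carrier G))))
       (sets (vimage_algebra (space P) (\<lambda>w. \<lambda>t\<in>{0..}. N t w) (\<Pi>\<^sub>M t\<in>{0..}. count_space UNIV)))"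


section \<open>The killed time-changed walk\<close>

definition constant_speed_walk ::
  "(nat \<Rightarrow> 'p \<Rightarrow> 'a) \<Rightarrow> (real \<Rightarrow> 'p \<Rightarrow> nat) \<Rightarrow> real \<Rightarrow> 'p \<Rightarrow> 'a" where
  "constant_speed_walk R N t w = R (N t w) w"

definition walk_clock :: "'a measure \<Rightarrow> (real \<Rightarrow> 'p \<Rightarrow> 'a) \<Rightarrow> real set \<Rightarrow> 'p \<Rightarrow> ennreal" where
  "walk_clock \<omega> X I w = (\<integral>\<^sup>+ s\<in>I. emeasure \<omega> {X s w} \<partial>lborel)"

text \<open>All processes are indexed by times in \<open>[0, \<infinity>]\<close> and have an \<open>option\<close> type as state space, the
  cemetery being \<open>None\<close>. Here the lifetime is the total clock \<open>\<integral>\<^sub>0\<^sup>\<infinity> \<omega>(X\<^sub>s) ds\<close>.\<close>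

definition time_changed_walk ::
  "'a measure \<Rightarrow> (real \<Rightarrow> 'p \<Rightarrow> 'a) \<Rightarrow> ennreal \<Rightarrow> 'p \<Rightarrow> 'a point option" where
  "time_changed_walk \<omega> X t w =
     (if t < walk_clock \<omega> X {0..} w
      then Some (Inner (X (Inf {s. 0 \<le> s \<and> t < walk_clock \<omega> X {0..s} w}) w))
      else None)"


section \<open>Hunt processes and their Dirichlet forms\<close>

definition borel_of :: "'c topology \<Rightarrow> 'c measure" where
  "borel_of T = sigma (topspace T) {U. openin T U}"

text \<open>The state space \<open>T\<close> with the cemetery \<open>None\<close> adjoined as point at infinity is
  \<^term>\<open>Alexandroff_compactification T\<close> (in which \<open>None\<close> is isolated if \<open>T\<close> is compact). The law
  with initial distribution \<open>\<pi>\<close> is \<open>bind \<pi> P\<close>. By convention \<open>X\<close> is in the cemetery at time \<open>\<infinity>\<close>,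
  so that the strong Markov property needs no restriction to finite stopping times.\<close>

locale hunt_process = filtration "space M" F
  for T :: "'c topology"
    and M :: "'w measure"
    and F :: "ennreal \<Rightarrow> 'w measure"
    and X :: "ennreal \<Rightarrow> 'w \<Rightarrow> 'c option"
    and P :: "'c option \<Rightarrow> 'w measure" +
  assumes sets_filtration: "sets (F t) \<subseteq> sets M"
    and filtration_right_continuous: "t < \<infinity> \<Longrightarrow> sets (F t) = (\<Inter>s\<in>{t<..}. sets (F s))"
    and adapted: "X t \<in> F t \<rightarrow>\<^sub>M borel_of (Alexandroff_compactification T)"
    and kernel: "P \<in> borel_of (Alexandroff_compactification T) \<rightarrow>\<^sub>M prob_algebra M"
    and normal: "x \<in> topspace (Alexandroff_compactification T) \<Longrightarrow> AE w in P x. X 0 w = x"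
    and cemetery_at_infinity: "w \<in> space M \<Longrightarrow> X \<infinity> w = None"
    and cemetery_absorbing: "w \<in> space M \<Longrightarrow> s \<le> t \<Longrightarrow> X s w = None \<Longrightarrow> X t w = None"
    and right_continuous: "w \<in> space M \<Longrightarrow> t < \<infinity> \<Longrightarrow>
      limitin (Alexandroff_compactification T) (\<lambda>s. X s w) (X t w) (at_right t)"
    and left_limits: "w \<in> space M \<Longrightarrow> 0 < t \<Longrightarrow> t < \<infinity> \<Longrightarrow>
      \<exists>l. limitin (Alexandroff_compactification T) (\<lambda>s. X s w) l (at_left t)"
    and strong_markov: "prob_space \<pi> \<Longrightarrow>
      sets \<pi> = sets (borel_of (Alexandroff_compactification T)) \<Longrightarrow>
      stopping_time F \<tau> \<Longrightarrow> A \<in> sets (pre_sigma \<tau>) \<Longrightarrow>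
      B \<in> sets (borel_of (Alexandroff_compactification T)) \<Longrightarrow>
      emeasure (Giry_Monad.bind \<pi> P) {w \<in> A. X (\<tau> w + t) w \<in> B} =
        (\<integral>\<^sup>+ w\<in>A. emeasure (P (X (\<tau> w) w)) {v \<in> space M. X t v \<in> B} \<partial>Giry_Monad.bind \<pi> P)"
    and quasi_left_continuous: "prob_space \<pi> \<Longrightarrow>
      sets \<pi> = sets (borel_of (Alexandroff_compactification T)) \<Longrightarrow>
      (\<And>n. stopping_time F (\<sigma> n)) \<Longrightarrow> (\<And>w. w \<in> space M \<Longrightarrow> incseq (\<lambda>n. \<sigma> n w)) \<Longrightarrow>
      AE w in Giry_Monad.bind \<pi> P. (SUP n. \<sigma> n w) < \<infinity> \<longrightarrow>
        limitin (Alexandroff_compactification T)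
          (\<lambda>n. X (\<sigma> n w) w) (X (SUP n. \<sigma> n w) w) sequentially"

definition transition_operator ::
  "('c option \<Rightarrow> 'w measure) \<Rightarrow> (ennreal \<Rightarrow> 'w \<Rightarrow> 'c option) \<Rightarrow> ennreal \<Rightarrow> ('c \<Rightarrow> real) \<Rightarrow> 'c \<Rightarrow> real"
  where
  "transition_operator P X t f x =
     (\<integral> w. (case X t w of None \<Rightarrow> 0 | Some y \<Rightarrow> f y) \<partial>P (Some x))"

definition transition_operator_nn ::
  "('c option \<Rightarrow> 'w measure) \<Rightarrow> (ennreal \<Rightarrow> 'w \<Rightarrow> 'c option) \<Rightarrow> ennreal \<Rightarrow> ('c \<Rightarrow> ennreal) \<Rightarrow> 'c \<Rightarrow> ennreal"
  where
  "transition_operator_nn P X t f x =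
     (\<integral>\<^sup>+ w. (case X t w of None \<Rightarrow> 0 | Some y \<Rightarrow> f y) \<partial>P (Some x))"

definition symmetric_process ::
  "'c measure \<Rightarrow> ('c option \<Rightarrow> 'w measure) \<Rightarrow> (ennreal \<Rightarrow> 'w \<Rightarrow> 'c option) \<Rightarrow> bool" where
  "symmetric_process m P X \<longleftrightarrow>
     (\<forall>t<\<infinity>. \<forall>f\<in>borel_measurable m. \<forall>g\<in>borel_measurable m.
        (\<integral>\<^sup>+ x. f x * transition_operator_nn P X t g x \<partial>m) =
        (\<integral>\<^sup>+ x. transition_operator_nn P X t f x * g x \<partial>m))"

definition square_integrable :: "'c measure \<Rightarrow> ('c \<Rightarrow> real) set" where
  "square_integrable m = {f \<in> borel_measurable m. integrable m (\<lambda>x. (f x)\<^sup>2)}"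

definition approximating_form ::
  "'c measure \<Rightarrow> ('c option \<Rightarrow> 'w measure) \<Rightarrow> (ennreal \<Rightarrow> 'w \<Rightarrow> 'c option) \<Rightarrow>
     real \<Rightarrow> ('c \<Rightarrow> real) \<Rightarrow> ('c \<Rightarrow> real) \<Rightarrow> real" where
  "approximating_form m P X t f g =
     (1 / t) * (\<integral> x. (f x - transition_operator P X (ennreal t) f x) * g x \<partial>m)"

text \<open>The Dirichlet form of an \<open>m\<close>-symmetric process with transition semigroup \<open>(T\<^sub>t)\<close> has as
  domain the \<open>f \<in> L\<^sup>2(m)\<close> for which \<open>t\<^sup>-\<^sup>1(f - T\<^sub>t f, f)\<close> converges to a finite limit as \<open>t \<down> 0\<close>, and
  its value at \<open>f, g\<close> is the limit of \<open>t\<^sup>-\<^sup>1(f - T\<^sub>t f, g)\<close>. The given domain \<open>D\<close> is a set of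
  functions, so it is compared with the domain of the process up to \<open>m\<close>-null sets.\<close>

definition has_dirichlet_form ::
  "'c measure \<Rightarrow> ('c option \<Rightarrow> 'w measure) \<Rightarrow> (ennreal \<Rightarrow> 'w \<Rightarrow> 'c option) \<Rightarrow>
     ('c \<Rightarrow> real) set \<Rightarrow> (('c \<Rightarrow> real) \<Rightarrow> ('c \<Rightarrow> real) \<Rightarrow> real) \<Rightarrow> bool" where
  "has_dirichlet_form m P X D E \<longleftrightarrow>
     symmetric_process m P X \<and>
     {f \<in> square_integrable m. \<exists>l. ((\<lambda>t. approximating_form m P X t f f) \<longlongrightarrow> l) (at_right 0)} =
       {f \<in> square_integrable m. \<exists>g\<in>D. AE x in m. f x = g x} \<and>
     (\<forall>f\<in>D. \<forall>g\<in>D. ((\<lambda>t. approximating_form m P X t f g) \<longlongrightarrow> E f g) (at_right 0))"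


section \<open>The reflected Dirichlet form on the compactification\<close>

definition dirichlet_energy ::
  "('a, 'b) monoid_scheme \<Rightarrow> 'a pmf \<Rightarrow> ('a \<Rightarrow> real) \<Rightarrow> ('a \<Rightarrow> real) \<Rightarrow> real" where
  "dirichlet_energy G \<mu> f g =
     (1 / 2) * (\<Sum>\<^sub>\<infinity>(x, y)\<in>carrier G \<times> carrier G.
        pmf \<mu> (inv\<^bsub>G\<^esub> x \<otimes>\<^bsub>G\<^esub> y) * (f x - f y) * (g x - g y))"

definition finite_energy :: "('a, 'b) monoid_scheme \<Rightarrow> 'a pmf \<Rightarrow> ('a \<Rightarrow> real) set" where
  "finite_energy G \<mu> =
     {f. (\<lambda>(x, y). pmf \<mu> (inv\<^bsub>G\<^esub> x \<otimes>\<^bsub>G\<^esub> y) * (f x - f y)\<^sup>2) summable_on (carrier G \<times> carrier G)}"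

text \<open>Canonical random walk started at the neutral element, driven by its sequence \<open>g\<close> of
  increments; these are i.i.d. with law \<open>\<mu>\<close> below.\<close>

primrec walk_path :: "('a, 'b) monoid_scheme \<Rightarrow> (nat \<Rightarrow> 'a) \<Rightarrow> nat \<Rightarrow> 'a" where
  "walk_path G g 0 = \<one>\<^bsub>G\<^esub>"
| "walk_path G g (Suc n) = walk_path G g n \<otimes>\<^bsub>G\<^esub> g n"

definition has_boundary_values ::
  "('a, 'b) monoid_scheme \<Rightarrow> 'a set \<Rightarrow> 'a pmf \<Rightarrow> ('a point \<Rightarrow> real) \<Rightarrow> bool" where
  "has_boundary_values G S \<mu> f \<longleftrightarrow>
     (AE g in (\<Pi>\<^sub>M n\<in>(UNIV :: nat set). measure_pmf \<mu>).
        \<exists>\<xi>\<in>gromov_boundary G S.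
          limitin (gromov_compactification G S) (\<lambda>n. Inner (walk_path G g n)) (Boundary \<xi>) sequentially \<and>
          (\<lambda>n. f (Inner (walk_path G g n))) \<longlonglongrightarrow> f (Boundary \<xi>))"

definition extended_domain ::
  "('a, 'b) monoid_scheme \<Rightarrow> 'a set \<Rightarrow> 'a pmf \<Rightarrow> ('a point \<Rightarrow> real) set" where
  "extended_domain G S \<mu> =
     {f \<in> borel_measurable (borel_of (gromov_compactification G S)).
        (\<lambda>x. f (Inner x)) \<in> finite_energy G \<mu> \<and> has_boundary_values G S \<mu> f}"

definition reflected_domain ::
  "('a, 'b) monoid_scheme \<Rightarrow> 'a set \<Rightarrow> 'a pmf \<Rightarrow> 'a measure \<Rightarrow> ('a point \<Rightarrow> real) set" where
  "reflected_domain G S \<mu> \<omega> =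
     {f \<in> extended_domain G S \<mu>. (\<lambda>x. f (Inner x)) \<in> square_integrable \<omega>}"

definition reflected_form ::
  "('a, 'b) monoid_scheme \<Rightarrow> 'a pmf \<Rightarrow> ('a point \<Rightarrow> real) \<Rightarrow> ('a point \<Rightarrow> real) \<Rightarrow> real" where
  "reflected_form G \<mu> f g = dirichlet_energy G \<mu> (\<lambda>x. f (Inner x)) (\<lambda>x. g (Inner x))"

definition extend_measure_by_zero ::
  "('a, 'b) monoid_scheme \<Rightarrow> 'a set \<Rightarrow> 'a measure \<Rightarrow> 'a point measure" where
  "extend_measure_by_zero G S \<omega> = distr \<omega> (borel_of (gromov_compactification G S)) Inner"

definition full_support_measure :: "('a, 'b) monoid_scheme \<Rightarrow> 'a measure \<Rightarrow> bool" where
  "full_support_measure G \<omega> \<longleftrightarrow> sets \<omega> = Pow (carrier G) \<and> (\<forall>x\<in>carrier G. emeasure \<omega> {x} > 0)"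

text \<open>The reflecting random walk: the Hunt process on the compactification associated with the
  reflected Dirichlet form. It is determined by the form up to equivalence.\<close>

definition reflecting_random_walk ::
  "('a, 'b) monoid_scheme \<Rightarrow> 'a set \<Rightarrow> 'a pmf \<Rightarrow> 'a measure \<Rightarrow> 'w measure \<Rightarrow>
     (ennreal \<Rightarrow> 'w measure) \<Rightarrow> (ennreal \<Rightarrow> 'w \<Rightarrow> 'a point option) \<Rightarrow>
     ('a point option \<Rightarrow> 'w measure) \<Rightarrow> bool" where
  "reflecting_random_walk G S \<mu> \<omega> M F W Q \<longleftrightarrow>
     hunt_process (gromov_compactification G S) M F W Q \<and>
     has_dirichlet_form (extend_measure_by_zero G S \<omega>) Q W
       (reflected_domain G S \<mu> \<omega>) (reflected_form G \<mu>)"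


section \<open>Processes up to the exit time from the group\<close>

definition exit_time ::
  "('a, 'b) monoid_scheme \<Rightarrow> (ennreal \<Rightarrow> 'w \<Rightarrow> 'a point option) \<Rightarrow> 'w \<Rightarrow> ennreal" where
  "exit_time G X w = Inf {t. 0 < t \<and> X t w \<notin> Some ` Inner ` carrier G}"

text \<open>The process \<open>(X\<^sub>t; 0 \<le> t < \<sigma>\<^sub>X(\<Gamma>))\<close>, as a random path which is sent to the cemetery at the exit
  time.\<close>

definition path_before_exit ::
  "('a, 'b) monoid_scheme \<Rightarrow> (ennreal \<Rightarrow> 'w \<Rightarrow> 'a point option) \<Rightarrow> 'w \<Rightarrow> ennreal \<Rightarrow> 'a point option"
  where
  "path_before_exit G X w t = (if t < exit_time G X w then X t w else None)"

definition path_space ::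
  "('a, 'b) monoid_scheme \<Rightarrow> 'a set \<Rightarrow> (ennreal \<Rightarrow> 'a point option) measure" where
  "path_space G S =
     (\<Pi>\<^sub>M t\<in>UNIV. borel_of (Alexandroff_compactification (gromov_compactification G S)))"

text \<open>Exit times are in general measurable only up to null sets, hence the completions.\<close>

definition equal_in_law ::
  "'c measure \<Rightarrow> 'p measure \<Rightarrow> ('p \<Rightarrow> 'c) \<Rightarrow> 'w measure \<Rightarrow> ('w \<Rightarrow> 'c) \<Rightarrow> bool" where
  "equal_in_law B P X Q Z \<longleftrightarrow>
     X \<in> completion P \<rightarrow>\<^sub>M B \<and> Z \<in> completion Q \<rightarrow>\<^sub>M B \<and>
     distr (completion P) B X = distr (completion Q) B Z"

end

(* Both processes move on the countable set Gamma, in which every point is isolated, and are right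
   continuous there. Their transition probabilities p_h(y,z) between points of Gamma have the same
   derivative (mu(y^-1 z) - [y = z]) / omega(y) at h = 0: for Y this is the holding time and jump law,
   for W it is read off from the Dirichlet form evaluated at indicators of points. For a finite set K,
   the probability of following prescribed values along a grid of mesh h without leaving K is a sum of
   products of at most O(1/h) factors p_h, and the corresponding sums for the two processes differ by
   O(1/h) o(h). Letting h tend to 0 along powers of 1/2, both processes have the same finite
   dimensional distributions while they stay in K. Finally K increases to Gamma: Y visits finitely many
   points before a time smaller than its lifetime, and by quasi-left continuity the exit times of W
   from the finite sets K increase to the exit time from Gamma. *)

theory Submission
  imports Defs
begin

section \<open>Comparison of right-continuous processes through their skeletons\<close>

text \<open>\<open>\<omega>\<close> is finite and the group infinite, so the jump rates 1 / omega(y)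
  are unbounded: \<open>Y\<close> may explode, and derivatives at 0 alone do not determine the
  transition probabilities on the whole group. Those of \<open>Y\<close> and \<open>W\<close> may
  indeed differ, as \<open>W\<close> can return from the boundary. Inside a finite set the matrices
  are finite and substochastic, entrywise derivatives become uniform, and an error o(h) per step
  survives O(1/h) steps. Powers of 1/2 make the grids nested, so that a violation at one dyadic time
  is seen by all finer grids. On a grid the Markov property of \<open>W\<close> is an instance of
  the strong one. For \<open>Y\<close> it has to be established, since the Poisson process is given
  only through its increments and the regularity of its paths. Its jump times are recovered as a
  measurable function of its values at dyadic times; the walk together with these values has the
  same joint law as in a model with exponential holding times, where conditioning on the first jump
  yields both the Markov property and the derivative.\<close>

fun path_weight :: "('s \<Rightarrow> 's \<Rightarrow> real) \<Rightarrow> 's \<Rightarrow> 's list \<Rightarrow> real" where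
  "path_weight p x [] = 1"
| "path_weight p x (y # ys) = p x y * path_weight p y ys"

definition words :: "'s set \<Rightarrow> nat \<Rightarrow> 's list set" where
  "words K n = {ys. set ys \<subseteq> K \<and> length ys = n}"

lemma finite_words: "finite K \<Longrightarrow> finite (words K n)"
  by (simp add: words_def finite_lists_length_eq)

lemma words_0: "words K 0 = {[]}"
  by (auto simp: words_def)

lemma sum_words_Suc: "(\<Sum>ys\<in>words K (Suc n). f ys) = (\<Sum>y\<in>K. \<Sum>ys\<in>words K n. f (y # ys))"
proof -
  have "words K (Suc n) = (\<lambda>(y, ys). y # ys) ` (K \<times> words K n)"
    by (force simp: words_def length_Suc_conv image_iff)
  moreover have "inj_on (\<lambda>(y, ys). y # ys) (K \<times> words K n)"
    by (auto simp: inj_on_def)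
  ultimately have "(\<Sum>ys\<in>words K (Suc n). f ys) = (\<Sum>(y, ys)\<in>K \<times> words K n. f (y # ys))"
    by (simp add: sum.reindex case_prod_unfold)
  then show ?thesis
    by (simp add: sum.cartesian_product)
qed

lemma path_weight_nonneg:
  "(\<And>y z. y \<in> K \<Longrightarrow> z \<in> K \<Longrightarrow> 0 \<le> p y z) \<Longrightarrow> x \<in> K \<Longrightarrow> set ys \<subseteq> K \<Longrightarrow> 0 \<le> path_weight p x ys"
  by (induction ys arbitrary: x) auto

lemma sum_path_weight_le_1:
  assumes "\<And>y z. y \<in> K \<Longrightarrow> z \<in> K \<Longrightarrow> 0 \<le> p y z" "\<And>y. y \<in> K \<Longrightarrow> (\<Sum>z\<in>K. p y z) \<le> 1" "x \<in> K"
  shows "(\<Sum>ys\<in>words K n. path_weight p x ys) \<le> 1"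
  using assms(3)
proof (induction n arbitrary: x)
  case (Suc n)
  have "(\<Sum>ys\<in>words K (Suc n). path_weight p x ys) = (\<Sum>y\<in>K. p x y * (\<Sum>ys\<in>words K n. path_weight p y ys))"
    by (simp add: sum_words_Suc sum_distrib_left)
  also have "\<dots> \<le> (\<Sum>y\<in>K. p x y * 1)"
    using Suc assms by (intro sum_mono mult_left_mono) auto
  finally show ?case
    using assms(2)[OF Suc.prems] by simp
qed (simp add: words_0)

text \<open>Steps are exchanged one at a time: after the first step has been peeled off, the rest of
  a \<open>p\<close>-path has total weight at most 1, and so has a row of \<open>q\<close>; hence
  each of the \<open>n\<close> steps costs at most \<open>\<delta>\<close>. The bound is linear in
  \<open>n\<close>, so rows at distance o(h) may be iterated O(1/h) times.\<close>

lemma sum_path_weight_diff_le: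
  assumes p: "\<And>y z. y \<in> K \<Longrightarrow> z \<in> K \<Longrightarrow> 0 \<le> p y z" "\<And>y. y \<in> K \<Longrightarrow> (\<Sum>z\<in>K. p y z) \<le> 1"
    and q: "\<And>y z. y \<in> K \<Longrightarrow> z \<in> K \<Longrightarrow> 0 \<le> q y z" "\<And>y. y \<in> K \<Longrightarrow> (\<Sum>z\<in>K. q y z) \<le> 1"
    and \<delta>: "\<And>y. y \<in> K \<Longrightarrow> (\<Sum>z\<in>K. \<bar>p y z - q y z\<bar>) \<le> \<delta>" and "x \<in> K"
  shows "(\<Sum>ys\<in>words K n. \<bar>path_weight p x ys - path_weight q x ys\<bar>) \<le> real n * \<delta>"
  using \<open>x \<in> K\<close>
proof (induction n arbitrary: x)
  case (Suc n)
  have \<delta>0: "0 \<le> \<delta>"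
    using \<delta>[OF Suc.prems] by (meson abs_ge_zero order_trans sum_nonneg)
  have "(\<Sum>ys\<in>words K (Suc n). \<bar>path_weight p x ys - path_weight q x ys\<bar>) =
    (\<Sum>y\<in>K. \<Sum>ys\<in>words K n. \<bar>p x y * path_weight p y ys - q x y * path_weight q y ys\<bar>)"
    by (simp add: sum_words_Suc)
  also have "\<dots> \<le> (\<Sum>y\<in>K. \<Sum>ys\<in>words K n. \<bar>p x y - q x y\<bar> * path_weight p y ys +
      q x y * \<bar>path_weight p y ys - path_weight q y ys\<bar>)"
  proof (intro sum_mono)
    fix y ys assume y: "y \<in> K" and ys: "ys \<in> words K n"
    have nn: "0 \<le> path_weight p y ys"
      using path_weight_nonneg[of K p y ys] p y ys by (auto simp: words_def)
    have "p x y * path_weight p y ys - q x y * path_weight q y ys =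
      (p x y - q x y) * path_weight p y ys + q x y * (path_weight p y ys - path_weight q y ys)"
      by (simp add: algebra_simps)
    also have "\<bar>\<dots>\<bar> \<le> \<bar>p x y - q x y\<bar> * path_weight p y ys + q x y * \<bar>path_weight p y ys - path_weight q y ys\<bar>"
      using nn q(1)[OF Suc.prems y] by (intro order_trans[OF abs_triangle_ineq]) (simp add: abs_mult)
    finally show "\<bar>p x y * path_weight p y ys - q x y * path_weight q y ys\<bar> \<le> \<dots>" .
  qed
  also have "\<dots> = (\<Sum>y\<in>K. \<bar>p x y - q x y\<bar> * (\<Sum>ys\<in>words K n. path_weight p y ys)) +
      (\<Sum>y\<in>K. q x y * (\<Sum>ys\<in>words K n. \<bar>path_weight p y ys - path_weight q y ys\<bar>))"
    by (simp add: sum.distrib sum_distrib_left)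
  also have "\<dots> \<le> (\<Sum>y\<in>K. \<bar>p x y - q x y\<bar> * 1) + (\<Sum>y\<in>K. q x y * (real n * \<delta>))"
    using Suc q sum_path_weight_le_1[of K p] p
    by (intro add_mono sum_mono mult_left_mono) auto
  also have "\<dots> \<le> \<delta> + 1 * (real n * \<delta>)"
    using \<delta>[OF Suc.prems] q(2)[OF Suc.prems] \<delta>0
    by (simp only: sum_distrib_right[symmetric] mult_1_right) (intro add_mono mult_right_mono, auto)
  finally show ?case
    by (simp add: algebra_simps)
qed (simp add: words_0)

section \<open>Events observed on dyadic grids and their limits\<close>

lemma (in finite_measure) measure_tendsto_of_AE_eventually:
  assumes [measurable]: "\<And>m. B m \<in> sets M" "C \<in> sets M"
    and AE: "AE w in M. \<forall>\<^sub>F m in sequentially. (w \<in> B m) = (w \<in> C)"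
  shows "(\<lambda>m. measure M (B m)) \<longlonglongrightarrow> measure M C"
proof -
  have "(\<lambda>m. \<integral>w. indicator (B m) w \<partial>M) \<longlonglongrightarrow> (\<integral>w. (indicator C w :: real) \<partial>M)"
  proof (rule integral_dominated_convergence[where w="\<lambda>_. 1"])
    show "AE w in M. (\<lambda>m. indicator (B m) w :: real) \<longlonglongrightarrow> indicator C w"
      using AE
    proof eventually_elim
      case (elim w)
      then show ?case
        by (intro tendsto_eventually) (auto elim!: eventually_mono simp: indicator_def)
    qed
  qed (auto simp: indicator_def)
  then show ?thesis
    by simp
qed

text \<open>Rounding goes upwards because the paths are controlled only to the right of a time. The
  result is an index on the grid of mesh \<open>1 / 2 ^ m\<close>.\<close>

definition dyadic_ceiling :: "nat \<Rightarrow> real \<Rightarrow> nat" where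
  "dyadic_ceiling m t = nat \<lceil>t * 2 ^ m\<rceil>"

lemma dyadic_ceiling_bounds:
  assumes "0 \<le> t"
  shows "t \<le> real (dyadic_ceiling m t) / 2 ^ m" "real (dyadic_ceiling m t) / 2 ^ m < t + 1 / 2 ^ m"
proof -
  have eq: "real (dyadic_ceiling m t) = of_int \<lceil>t * 2 ^ m\<rceil>"
    using assms by (simp add: dyadic_ceiling_def)
  show "t \<le> real (dyadic_ceiling m t) / 2 ^ m"
    unfolding eq by (simp add: field_simps)
  have "of_int \<lceil>t * 2 ^ m\<rceil> < t * 2 ^ m + 1"
    by linarith
  then show "real (dyadic_ceiling m t) / 2 ^ m < t + 1 / 2 ^ m"
    unfolding eq by (simp add: field_simps)
qed

lemma dyadic_ceiling_mono: "s \<le> t \<Longrightarrow> dyadic_ceiling m s \<le> dyadic_ceiling m t"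
  unfolding dyadic_ceiling_def by (intro nat_mono ceiling_mono mult_right_mono) auto

lemma tendsto_dyadic_ceiling:
  assumes "0 \<le> t"
  shows "(\<lambda>m. real (dyadic_ceiling m t) / 2 ^ m) \<longlonglongrightarrow> t"
proof (rule tendsto_sandwich[OF _ _ tendsto_const])
  have "(\<lambda>m. t + (1/2) ^ m) \<longlonglongrightarrow> t + 0"
    by (intro tendsto_intros LIMSEQ_power_zero) auto
  then show "(\<lambda>m. t + 1 / 2 ^ m) \<longlonglongrightarrow> t"
    by (simp add: power_one_over)
qed (use dyadic_ceiling_bounds[OF assms] in \<open>auto intro: always_eventually less_imp_le\<close>)

lemma eventually_dyadic_ceiling:
  assumes "0 \<le> t" "\<forall>\<^sub>F s in at_right t. P s" "P t"
  shows "\<forall>\<^sub>F m in sequentially. P (real (dyadic_ceiling m t) / 2 ^ m)"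
proof -
  obtain b where b: "t < b" "\<And>s. t < s \<Longrightarrow> s < b \<Longrightarrow> P s"
    using assms(2) by (auto simp: eventually_at_right_field)
  have "\<forall>\<^sub>F m in sequentially. real (dyadic_ceiling m t) / 2 ^ m < b"
    using order_tendstoD(2)[OF tendsto_dyadic_ceiling[OF assms(1)] b(1)] .
  then show ?thesis
  proof eventually_elim
    case (elim m)
    then show ?case
      using dyadic_ceiling_bounds(1)[OF assms(1), of m] b(2) assms(3)
      by (cases "real (dyadic_ceiling m t) / 2 ^ m = t") auto
  qed
qed

text \<open>Testing dyadic times only makes this a countable condition. For right-constant paths and
  finite \<open>K\<close> it still forbids leaving \<open>K\<close> at any time before
  \<open>T\<close>, because the path then stays outside for an interval, which contains a dyadic
  time.\<close>

definition confined :: "(real \<Rightarrow> 'w \<Rightarrow> 's option) \<Rightarrow> 's set \<Rightarrow> real \<Rightarrow> 'w \<Rightarrow> bool" where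
  "confined X K T w \<longleftrightarrow> (\<forall>j m. real j / 2 ^ m \<le> T \<longrightarrow> X (real j / 2 ^ m) w \<in> Some ` K)"

lemma confined_mono: "confined X K T w \<Longrightarrow> K \<subseteq> K' \<Longrightarrow> T' \<le> T \<Longrightarrow> confined X K' T' w"
  unfolding confined_def by (meson image_mono order_trans subsetD)

text \<open>The data common to the two processes. The Markov property enters only through equally
  spaced times. \<open>right_constant\<close> treats one state at a time: right after a time with
  value \<open>None\<close> each single state is avoided for a while, but not all states together,
  since \<open>W\<close> may re-enter the group from the boundary.\<close>

locale skeleton_process = prob_space M
  for M :: "'w measure" and X :: "real \<Rightarrow> 'w \<Rightarrow> 's option" and S :: "'s set"
    and p :: "real \<Rightarrow> 's \<Rightarrow> 's \<Rightarrow> real" and x :: 's +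
  assumes measurable_state: "\<And>t y. 0 \<le> t \<Longrightarrow> y \<in> S \<Longrightarrow> {w \<in> space M. X t w = Some y} \<in> sets M"
    and state_range: "\<And>t w. w \<in> space M \<Longrightarrow> X t w \<in> insert None (Some ` S)"
    and right_constant: "AE w in M. \<forall>t\<ge>0. \<forall>y\<in>S. \<forall>\<^sub>F s in at_right t. (X s w = Some y) = (X t w = Some y)"
    and skeleton: "\<And>h ys. 0 < h \<Longrightarrow> set ys \<subseteq> S \<Longrightarrow>
      measure M {w \<in> space M. \<forall>j\<le>length ys. X (real j * h) w = Some ((x # ys) ! j)} = path_weight (p h) x ys"
    and transition_nonneg: "\<And>h y z. 0 < h \<Longrightarrow> y \<in> S \<Longrightarrow> z \<in> S \<Longrightarrow> 0 \<le> p h y z"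
    and transition_sum_le_1: "\<And>h y K. 0 < h \<Longrightarrow> y \<in> S \<Longrightarrow> K \<subseteq> S \<Longrightarrow> finite K \<Longrightarrow> (\<Sum>z\<in>K. p h y z) \<le> 1"
    and start_in_S: "x \<in> S"
begin

lemma measurable_in:
  assumes "0 \<le> t" "finite K" "K \<subseteq> S"
  shows "{w \<in> space M. X t w \<in> Some ` K} \<in> sets M"
proof -
  have "{w \<in> space M. X t w \<in> Some ` K} = (\<Union>y\<in>K. {w \<in> space M. X t w = Some y})"
    by auto
  then show ?thesis
    using assms measurable_state by (auto intro!: sets.finite_UN)
qed

lemma AE_start: "AE w in M. X 0 w = Some x"
proof -
  have "measure M {w \<in> space M. X 0 w = Some x} = 1"
    using skeleton[of 1 "[]"] by simp
  then show ?thesis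
    using AE_prob_1 by force
qed

definition grid_event :: "'s set \<Rightarrow> real set \<Rightarrow> (real \<Rightarrow> 's) \<Rightarrow> real \<Rightarrow> nat \<Rightarrow> 'w set" where
  "grid_event K J y T m = {w \<in> space M.
     (\<forall>t\<in>J. X (real (dyadic_ceiling m t) / 2 ^ m) w = Some (y t)) \<and>
     (\<forall>j\<le>dyadic_ceiling m T. X (real j / 2 ^ m) w \<in> Some ` K)}"

definition confined_event :: "'s set \<Rightarrow> real set \<Rightarrow> (real \<Rightarrow> 's) \<Rightarrow> real \<Rightarrow> 'w set" where
  "confined_event K J y T = {w \<in> space M. (\<forall>t\<in>J. X t w = Some (y t)) \<and> confined X K T w}"

lemma measurable_confined:
  assumes "finite K" "K \<subseteq> S"
  shows "{w \<in> space M. confined X K T w} \<in> sets M"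
  unfolding confined_def
  by (intro sets.sets_Collect_countable_All sets.sets_Collect_imp sets.sets_Collect_const
      measurable_in[OF _ assms]) simp

lemma measurable_confined_event:
  assumes K: "finite K" "K \<subseteq> S" and J: "finite J" "J \<subseteq> {0..}" "y ` J \<subseteq> S"
  shows "confined_event K J y T \<in> sets M"
proof -
  have "{w \<in> space M. \<forall>t\<in>J. X t w = Some (y t)} \<in> sets M"
    using J measurable_state by (intro sets.sets_Collect_finite_All) auto
  from sets.Int[OF this measurable_confined[OF K]] show ?thesis
    by (rule back_subst[where P="\<lambda>A. A \<in> sets M"]) (auto simp: confined_event_def)
qed

lemma measurable_grid_event:
  assumes K: "finite K" "K \<subseteq> S" and J: "finite J" "J \<subseteq> {0..}" "y ` J \<subseteq> S"
  shows "grid_event K J y T m \<in> sets M"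
proof -
  have "{w \<in> space M. \<forall>t\<in>J. X (real (dyadic_ceiling m t) / 2 ^ m) w = Some (y t)} \<in> sets M"
    using J measurable_state by (intro sets.sets_Collect_finite_All) auto
  moreover have "{w \<in> space M. \<forall>j\<in>{..dyadic_ceiling m T}. X (real j / 2 ^ m) w \<in> Some ` K} \<in> sets M"
    using measurable_in[OF _ K] by (intro sets.sets_Collect_finite_All) auto
  ultimately have "{w \<in> space M. \<forall>t\<in>J. X (real (dyadic_ceiling m t) / 2 ^ m) w = Some (y t)} \<inter>
    {w \<in> space M. \<forall>j\<in>{..dyadic_ceiling m T}. X (real j / 2 ^ m) w \<in> Some ` K} \<in> sets M"
    by (rule sets.Int)
  then show ?thesis
    by (rule back_subst[where P="\<lambda>A. A \<in> sets M"]) (auto simp: grid_event_def)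
qed

text \<open>The grid events are not monotone in \<open>m\<close>, as the rounded times move, but
  almost every path decides membership eventually. A violation of confinement at a dyadic time of
  level \<open>n\<close> shows on all grids with \<open>m \<ge> n\<close>, and the prescribed values
  are settled by right-constancy. The horizon is a time of \<open>J\<close> because the last grid
  point may lie beyond it, where only the prescribed value keeps the path in
  \<open>K\<close>.\<close>

lemma grid_event_tendsto:
  assumes K: "finite K" "K \<subseteq> S" and J: "finite J" "J \<subseteq> {0..}" "y ` J \<subseteq> K" "J \<noteq> {}"
  shows "(\<lambda>m. measure M (grid_event K J y (Max J) m)) \<longlonglongrightarrow> measure M (confined_event K J y (Max J))"
proof (rule measure_tendsto_of_AE_eventually)
  let ?T = "Max J"
  have T: "?T \<in> J" and T_ub: "t \<le> ?T" if "t \<in> J" for t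
    using J that by auto
  have T0: "0 \<le> ?T" and TJ: "?T \<in> J" using J Max_in by auto
  show "grid_event K J y ?T m \<in> sets M" for m
    using K J by (intro measurable_grid_event) auto
  show "confined_event K J y ?T \<in> sets M"
    using K J by (intro measurable_confined_event) auto
  show "AE w in M. \<forall>\<^sub>F m in sequentially. (w \<in> grid_event K J y ?T m) = (w \<in> confined_event K J y ?T)"
    using right_constant AE_space
  proof eventually_elim
    case (elim w)
    note rc = elim(1)[rule_format] and w = elim(2)
    have ev: "\<forall>\<^sub>F m in sequentially. (X (real (dyadic_ceiling m t) / 2 ^ m) w = Some (y t)) = (X t w = Some (y t))"
      if "t \<in> J" for t
      using that J K rc[of t "y t"] by (intro eventually_dyadic_ceiling) auto
    have evJ: "\<forall>\<^sub>F m in sequentially. \<forall>t\<in>J. (X (real (dyadic_ceiling m t) / 2 ^ m) w = Some (y t)) = (X t w = Some (y t))"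
      using J(1) ev by (simp add: eventually_ball_finite)
    show ?case
    proof (cases "w \<in> confined_event K J y ?T")
      case True
      then have XJ: "\<And>t. t \<in> J \<Longrightarrow> X t w = Some (y t)" and c: "confined X K ?T w"
        by (auto simp: confined_event_def)
      from evJ show ?thesis
      proof eventually_elim
        case (elim m)
        have "X (real j / 2 ^ m) w \<in> Some ` K" if j: "j \<le> dyadic_ceiling m ?T" for j
        proof (cases "j = dyadic_ceiling m ?T")
          case True
          then have "X (real j / 2 ^ m) w = Some (y ?T)"
            using elim TJ XJ[OF TJ] by simp
          then show ?thesis using TJ J(3) by blast
        next
          case False
          \<comment> \<open>All grid points except the last lie before \<open>?T\<close>, so
            \<open>confined\<close> speaks of them.\<close>
          then have "real j \<le> real (dyadic_ceiling m ?T) - 1"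
            using j by linarith
          then have "real j / 2 ^ m \<le> real (dyadic_ceiling m ?T) / 2 ^ m - 1 / 2 ^ m"
            by (simp add: field_simps)
          also have "\<dots> \<le> ?T"
            using dyadic_ceiling_bounds(2)[OF T0, of m] by simp
          finally show ?thesis
            using c by (auto simp: confined_def)
        qed
        then show ?case
          using elim True w XJ by (auto simp: grid_event_def)
      qed
    next
      case False
      then consider t where "t \<in> J" "X t w \<noteq> Some (y t)"
        | j n where "real j / 2 ^ n \<le> ?T" "X (real j / 2 ^ n) w \<notin> Some ` K"
        using w by (auto simp: confined_event_def confined_def)
      then show ?thesis
      proof cases
        case 1
        from evJ show ?thesis
          by eventually_elim (use 1 False in \<open>auto simp: grid_event_def\<close>)
      next
        case 2
        from eventually_ge_at_top[of n] show ?thesis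
        proof eventually_elim
          case (elim m)
          have eq: "real (j * 2 ^ (m - n)) / 2 ^ m = real j / 2 ^ n"
            using elim by (simp add: field_simps flip: power_add)
          have "real j * 2 ^ (m - n) \<le> ?T * 2 ^ m"
            using 2(1) elim by (simp add: field_simps power_diff)
          then have "j * 2 ^ (m - n) \<le> dyadic_ceiling m ?T"
            unfolding dyadic_ceiling_def
            by (metis ceiling_mono ceiling_of_nat nat_int nat_mono of_nat_mult of_nat_numeral of_nat_power)
          then have "w \<notin> grid_event K J y ?T m"
            using 2(2) eq unfolding grid_event_def by (metis (mono_tags, lifting) mem_Collect_eq)
          then show ?case using False by simp
        qed
      qed
    qed
  qed
qed

text \<open>The event is split by the complete word of states seen on the grid; different words give
  disjoint events, each of them an event of the skeleton.\<close>

lemma measure_grid_event: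
  assumes K: "finite K" "K \<subseteq> S" "x \<in> K" and J: "finite J" "J \<subseteq> {0..}" "y ` J \<subseteq> K" "\<And>t. t \<in> J \<Longrightarrow> t \<le> T"
  shows "measure M (grid_event K J y T m) =
    (\<Sum>ys \<in> {ys \<in> words K (dyadic_ceiling m T). \<forall>t\<in>J. (x # ys) ! dyadic_ceiling m t = y t}.
       path_weight (p (1 / 2 ^ m)) x ys)"
proof -
  let ?n = "dyadic_ceiling m T"
  let ?L = "{ys \<in> words K ?n. \<forall>t\<in>J. (x # ys) ! dyadic_ceiling m t = y t}"
  let ?E = "\<lambda>ys. {w \<in> space M. \<forall>j\<le>length ys. X (real j * (1 / 2 ^ m)) w = Some ((x # ys) ! j)}"
  have E_sets: "?E ys \<in> sets M" if "set ys \<subseteq> K" for ys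
  proof -
    have "{w \<in> space M. \<forall>j\<in>{..length ys}. X (real j * (1 / 2 ^ m)) w = Some ((x # ys) ! j)} \<in> sets M"
    proof (intro sets.sets_Collect_finite_All measurable_state)
      fix j assume "j \<in> {..length ys}"
      then have "(x # ys) ! j \<in> set (x # ys)" by (intro nth_mem) auto
      then show "(x # ys) ! j \<in> S" using that K by auto
    qed auto
    then show ?thesis by (rule back_subst[where P="\<lambda>A. A \<in> sets M"]) auto
  qed
  have fin: "finite ?L"
    using finite_words[OF K(1)] by simp
  have "measure M (grid_event K J y T m) = measure M (\<Union>ys\<in>?L. ?E ys)"
  proof (rule finite_measure_eq_AE)
    show "AE w in M. (w \<in> grid_event K J y T m) = (w \<in> (\<Union>ys\<in>?L. ?E ys))"
      using AE_start AE_space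
    proof eventually_elim
      case (elim w)
      show ?case
      proof
        assume w: "w \<in> grid_event K J y T m"
        \<comment> \<open>The word starts at the first positive grid time; time 0 contributes the
          head \<open>x\<close> almost surely. \<open>the\<close> is safe because the grid event
          leaves no \<open>None\<close>.\<close>
        define ys where "ys = map (\<lambda>j. the (X (real (Suc j) / 2 ^ m) w)) [0..<?n]"
        have X: "X (real j / 2 ^ m) w = Some ((x # ys) ! j)" if "j \<le> ?n" for j
        proof (cases j)
          case 0 then show ?thesis using elim by simp
        next
          case (Suc i)
          have "X (real j / 2 ^ m) w \<in> Some ` K"
            using w that by (auto simp: grid_event_def)
          then show ?thesis using Suc that by (auto simp: ys_def)
        qed
        have len: "length ys = ?n" by (simp add: ys_def)
        have "set ys \<subseteq> K"
        proof
          fix z assume "z \<in> set ys"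
          then obtain i where i: "i < ?n" "z = ys ! i"
            using len by (metis in_set_conv_nth)
          have "X (real (Suc i) / 2 ^ m) w \<in> Some ` K"
            using w i Suc_leI[OF i(1)] unfolding grid_event_def by blast
          then show "z \<in> K"
            using X[of "Suc i"] i by auto
        qed
        moreover have "(x # ys) ! dyadic_ceiling m t = y t" if "t \<in> J" for t
          using X[of "dyadic_ceiling m t"] w that J(4) dyadic_ceiling_mono[of t T m] by (auto simp: grid_event_def)
        ultimately have "ys \<in> ?L" using len by (auto simp: words_def)
        moreover have "w \<in> ?E ys" using X len elim by simp
        ultimately show "w \<in> (\<Union>ys\<in>?L. ?E ys)" by blast
      next
        assume "w \<in> (\<Union>ys\<in>?L. ?E ys)"
        then obtain ys where ys: "ys \<in> ?L" "w \<in> ?E ys" by blast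
        then have len: "length ys = ?n" "set ys \<subseteq> K" by (auto simp: words_def)
        have "X (real j / 2 ^ m) w = Some ((x # ys) ! j)" if "j \<le> ?n" for j
          using ys(2) len that by auto
        moreover have "(x # ys) ! j \<in> K" if "j \<le> ?n" for j
          using nth_mem[of j "x # ys"] len K(3) that by (auto simp del: nth_mem)
        ultimately show "w \<in> grid_event K J y T m"
          using ys J(4) dyadic_ceiling_mono[of _ T m] elim unfolding grid_event_def by auto
      qed
    qed
    show "grid_event K J y T m \<in> sets M"
      using K J by (intro measurable_grid_event) auto
    show "(\<Union>ys\<in>?L. ?E ys) \<in> sets M"
      using fin by (intro sets.finite_UN E_sets) (simp_all add: words_def)
  qed
  also have "\<dots> = (\<Sum>ys\<in>?L. measure M (?E ys))"
  proof (rule finite_measure_finite_Union[OF fin])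
    show "?E ` ?L \<subseteq> events" by (intro image_subsetI E_sets) (simp add: words_def)
    show "disjoint_family_on ?E ?L"
      unfolding disjoint_family_on_def
    proof (intro ballI impI)
      fix ys zs assume yz: "ys \<in> ?L" "zs \<in> ?L" "ys \<noteq> zs"
      then have len: "length ys = ?n" "length zs = ?n" by (auto simp: words_def)
      then obtain i where "i < ?n" "ys ! i \<noteq> zs ! i"
        using yz(3) nth_equalityI[of ys zs] by auto
      then show "?E ys \<inter> ?E zs = {}"
        using len by (auto dest!: spec[of _ "Suc i"])
    qed
  qed
  also have "\<dots> = (\<Sum>ys\<in>?L. path_weight (p (1 / 2 ^ m)) x ys)"
    using K by (intro sum.cong refl skeleton) (auto simp: words_def)
  finally show ?thesis .
qed

end

lemma confined_event_measure_eq: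
  assumes X1: "skeleton_process M1 X1 S p1 x" and X2: "skeleton_process M2 X2 S p2 x"
    and deriv: "\<And>y z. y \<in> S \<Longrightarrow> z \<in> S \<Longrightarrow> ((\<lambda>h. (p1 h y z - p2 h y z) / h) \<longlongrightarrow> 0) (at_right 0)"
    and K: "finite K" "K \<subseteq> S" and J: "finite J" "J \<subseteq> {0..}" "y ` J \<subseteq> K" "J \<noteq> {}"
  shows "measure M1 (skeleton_process.confined_event M1 X1 K J y (Max J)) =
    measure M2 (skeleton_process.confined_event M2 X2 K J y (Max J))"
proof -
  interpret X1: skeleton_process M1 X1 S p1 x by fact
  interpret X2: skeleton_process M2 X2 S p2 x by fact
  let ?T = "Max J"
  have T0: "0 \<le> ?T" using J Max_in by auto
  show ?thesis
  proof (cases "x \<in> K")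
    \<comment> \<open>Confinement tests time 0, where both processes are at \<open>x\<close>, so
      both measures vanish.\<close>
    case False
    have *: "measure M (skeleton_process.confined_event M X K J y ?T) = 0"
      if "skeleton_process M X S p x" for M :: "'z measure" and X p
    proof -
      interpret skeleton_process M X S p x by fact
      have "AE w in M. w \<notin> confined_event K J y ?T"
        using AE_start
      proof eventually_elim
        case (elim w)
        have "real 0 / 2 ^ 0 \<le> ?T" using T0 by simp
        then show ?case using elim False unfolding confined_event_def confined_def
          by (auto dest!: spec[of _ 0])
      qed
      then show ?thesis
        using prob_eq_0[OF measurable_confined_event[OF K J(1,2)], of y] J K by auto
    qed
    show ?thesis using *[OF X1] *[OF X2] by simp
  next
    case True
    \<comment> \<open>The sum over all rows dominates each single row and, \<open>K\<close> being
      finite, is still o(h).\<close>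
    define \<delta> where "\<delta> h = (\<Sum>y\<in>K. \<Sum>z\<in>K. \<bar>p1 h y z - p2 h y z\<bar>)" for h
    have "((\<lambda>h. \<Sum>y\<in>K. \<Sum>z\<in>K. \<bar>(p1 h y z - p2 h y z) / h\<bar>) \<longlongrightarrow> (\<Sum>y\<in>K. \<Sum>z\<in>K. \<bar>0\<bar>)) (at_right 0)"
      using K by (intro tendsto_sum tendsto_rabs deriv) auto
    moreover have "\<forall>\<^sub>F h in at_right 0. (\<Sum>y\<in>K. \<Sum>z\<in>K. \<bar>(p1 h y z - p2 h y z) / h\<bar>) = \<delta> h / h"
      using eventually_at_right_less[of "0::real"]
      by eventually_elim (simp add: \<delta>_def sum_divide_distrib abs_divide)
    ultimately have \<delta>0: "((\<lambda>h. \<delta> h / h) \<longlongrightarrow> 0) (at_right 0)"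
      using tendsto_cong by force
    have "filterlim (\<lambda>m. (1/2::real) ^ m) (at_right 0) sequentially"
      by (intro filterlim_at_withinI LIMSEQ_power_zero) (auto simp: eventually_sequentially)
    from filterlim_compose[OF \<delta>0 this]
    have lim: "(\<lambda>m. \<delta> (1 / 2 ^ m) / (1 / 2 ^ m)) \<longlonglongrightarrow> 0"
      by (simp add: power_one_over)
    \<comment> \<open>The horizon is rounded up by less than one mesh, so the number of steps times
      the mesh is at most \<open>?T + 1\<close>.\<close>
    have bound: "\<bar>measure M1 (X1.grid_event K J y ?T m) - measure M2 (X2.grid_event K J y ?T m)\<bar>
      \<le> (?T + 1) * (\<delta> (1 / 2 ^ m) / (1 / 2 ^ m))" for m
    proof -
      let ?h = "1 / 2 ^ m :: real" and ?n = "dyadic_ceiling m ?T"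
      let ?L = "{ys \<in> words K ?n. \<forall>t\<in>J. (x # ys) ! dyadic_ceiling m t = y t}"
      have le_T: "\<And>t. t \<in> J \<Longrightarrow> t \<le> ?T" using J by auto
      have "\<bar>measure M1 (X1.grid_event K J y ?T m) - measure M2 (X2.grid_event K J y ?T m)\<bar> =
        \<bar>\<Sum>ys\<in>?L. path_weight (p1 ?h) x ys - path_weight (p2 ?h) x ys\<bar>"
        by (subst X1.measure_grid_event[OF K True J(1,2,3) le_T], simp,
            subst X2.measure_grid_event[OF K True J(1,2,3) le_T], simp, simp add: sum_subtractf)
      also have "\<dots> \<le> (\<Sum>ys\<in>?L. \<bar>path_weight (p1 ?h) x ys - path_weight (p2 ?h) x ys\<bar>)"
        by (rule sum_abs)
      also have "\<dots> \<le> (\<Sum>ys\<in>words K ?n. \<bar>path_weight (p1 ?h) x ys - path_weight (p2 ?h) x ys\<bar>)"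
        using finite_words[OF K(1)] by (intro sum_mono2) auto
      also have "\<dots> \<le> real ?n * \<delta> ?h"
      proof (rule sum_path_weight_diff_le)
        fix u assume u: "u \<in> K"
        show "(\<Sum>z\<in>K. \<bar>p1 ?h u z - p2 ?h u z\<bar>) \<le> \<delta> ?h"
          unfolding \<delta>_def using u K by (intro member_le_sum sum_nonneg) auto
      qed (use K True X1.transition_nonneg X2.transition_nonneg X1.transition_sum_le_1
            X2.transition_sum_le_1 in \<open>auto simp: subset_iff\<close>)
      also have "\<dots> = (real ?n / 2 ^ m) * (\<delta> ?h / ?h)"
        by simp
      also have "\<dots> \<le> (?T + 1) * (\<delta> ?h / ?h)"
      proof (rule mult_right_mono)
        have "1 / 2 ^ m \<le> (1::real)" by simp
        then show "real ?n / 2 ^ m \<le> ?T + 1"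
          using dyadic_ceiling_bounds(2)[OF T0, of m] by linarith
        show "0 \<le> \<delta> ?h / ?h"
          unfolding \<delta>_def by (intro divide_nonneg_nonneg sum_nonneg) auto
      qed
      finally show ?thesis .
    qed
    have "(\<lambda>m. measure M1 (X1.grid_event K J y ?T m) - measure M2 (X2.grid_event K J y ?T m)) \<longlonglongrightarrow> 0"
      by (rule Lim_null_comparison[OF _ tendsto_mult_right_zero[OF lim, of "?T + 1"]])
        (use bound in \<open>auto intro: always_eventually\<close>)
    moreover have "(\<lambda>m. measure M1 (X1.grid_event K J y ?T m) - measure M2 (X2.grid_event K J y ?T m)) \<longlonglongrightarrow>
      measure M1 (X1.confined_event K J y ?T) - measure M2 (X2.confined_event K J y ?T)"
      by (intro tendsto_diff X1.grid_event_tendsto X2.grid_event_tendsto K J)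
    ultimately show ?thesis
      using LIMSEQ_unique by fastforce
  qed
qed

text \<open>A single finite set must serve up to time \<open>t\<close>: a path that has left every
  \<open>K n\<close> before \<open>t\<close>, by explosion or through the boundary, stays killed. At
  time infinity the value is \<open>None\<close>, in agreement with the convention for the
  processes.\<close>

definition killed :: "(nat \<Rightarrow> 's set) \<Rightarrow> (real \<Rightarrow> 'w \<Rightarrow> 's option) \<Rightarrow> ennreal \<Rightarrow> 'w \<Rightarrow> 's option" where
  "killed K X t w =
     (if t < \<infinity> \<and> (\<exists>n. confined X (K n) (enn2real t) w) then X (enn2real t) w else None)"

lemma killed_eq_Some_iff:
  "killed K X t w = Some y \<longleftrightarrow> t < \<infinity> \<and> (\<exists>n. confined X (K n) (enn2real t) w) \<and> X (enn2real t) w = Some y"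
  by (simp add: killed_def)

text \<open>Events that prescribe \<open>None\<close> have no path formula, so only values
  \<open>Some y\<close> are prescribed. They suffice because \<open>None\<close> is the complement
  of countably many such values. Two cylinders either merge into one or contradict each other,
  whence the empty set in the generator.\<close>

lemma measure_eq_of_option_cylinders:
  fixes M1 M2 :: "('i \<Rightarrow> 's option) measure"
  assumes S: "countable S"
    and M: "prob_space M1" "prob_space M2"
    and sets: "sets M1 = sets (\<Pi>\<^sub>M t\<in>(UNIV :: 'i set). count_space (insert None (Some ` S)))"
              "sets M2 = sets (\<Pi>\<^sub>M t\<in>(UNIV :: 'i set). count_space (insert None (Some ` S)))"
    and eq: "\<And>J y. finite J \<Longrightarrow> y ` J \<subseteq> S \<Longrightarrow>
      emeasure M1 {v \<in> space M1. \<forall>t\<in>J. v t = Some (y t)} = emeasure M2 {v \<in> space M2. \<forall>t\<in>J. v t = Some (y t)}"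
  shows "M1 = M2"
proof -
  let ?O = "insert None (Some ` S)"
  let ?\<Omega> = "\<Pi>\<^sub>E t\<in>(UNIV :: 'i set). ?O"
  let ?P = "\<Pi>\<^sub>M t\<in>(UNIV :: 'i set). count_space ?O"
  define cyl where "cyl J y = {v \<in> ?\<Omega>. \<forall>t\<in>J. v t = Some (y t)}" for J :: "'i set" and y :: "'i \<Rightarrow> 's"
  define E where "E = insert {} {cyl J y | J y. finite J \<and> y ` J \<subseteq> S}"
  have space: "space M1 = ?\<Omega>" "space M2 = ?\<Omega>" "space ?P = ?\<Omega>"
    using sets[THEN sets_eq_imp_space_eq] by (simp_all add: space_PiM)
  have E_sub: "E \<subseteq> Pow ?\<Omega>"
    by (auto simp: E_def cyl_def)
  have Int: "Int_stable E"
  proof (rule Int_stableI)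
    fix a b assume ab: "a \<in> E" "b \<in> E"
    show "a \<inter> b \<in> E"
    proof (cases "a \<inter> b = {}")
      case False
      then have "a \<noteq> {}" "b \<noteq> {}" by auto
      then obtain J y J' y' where a: "a = cyl J y" "finite J" "y ` J \<subseteq> S"
        and b: "b = cyl J' y'" "finite J'" "y' ` J' \<subseteq> S"
        using ab by (auto simp: E_def)
      define z where "z t = (if t \<in> J then y t else y' t)" for t
      obtain v where v: "v \<in> a \<inter> b" using False by auto
      have agree: "y t = y' t" if "t \<in> J" "t \<in> J'" for t
        using v that a(1) b(1) by (auto simp: cyl_def)
      have "a \<inter> b = cyl (J \<union> J') z"
        unfolding a(1) b(1) cyl_def z_def using agree by (auto split: if_splits)
      moreover have "z ` (J \<union> J') \<subseteq> S"
        using a b by (auto simp: z_def)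
      ultimately show ?thesis
        using a b by (auto simp: E_def)
    qed (simp add: E_def)
  qed
  have cyl_sets: "cyl J y \<in> sets ?P" if "finite J" "y ` J \<subseteq> S" for J y
  proof -
    have "{v \<in> space ?P. \<forall>t\<in>J. v t = Some (y t)} \<in> sets ?P"
    proof (intro sets.sets_Collect_finite_All)
      fix t assume "t \<in> J"
      have "(\<lambda>v. v t) \<in> ?P \<rightarrow>\<^sub>M count_space ?O"
        by (rule measurable_component_singleton) simp
      from measurable_sets[OF this, of "{Some (y t)}"] show "{v \<in> space ?P. v t = Some (y t)} \<in> sets ?P"
        using that \<open>t \<in> J\<close> by (auto simp: vimage_def Int_def conj_commute)
    qed fact
    then show ?thesis by (simp add: cyl_def space_PiM)
  qed
  have sub1: "sigma_sets ?\<Omega> E \<subseteq> sets ?P"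
    using cyl_sets sets.sigma_sets_subset[of E ?P] space(3) by (auto simp: E_def)
  have sub2: "sets ?P \<subseteq> sigma_sets ?\<Omega> E"
  proof -
    let ?\<Sigma> = "sigma ?\<Omega> E"
    have id: "(\<lambda>v t. v t) \<in> ?\<Sigma> \<rightarrow>\<^sub>M ?P"
    proof (rule measurable_PiM_single')
      show "(\<lambda>v t. v t) \<in> space ?\<Sigma> \<rightarrow> (\<Pi>\<^sub>E t\<in>UNIV. space (count_space ?O))"
        using E_sub by (simp add: space_measure_of_conv)
      fix t :: 'i
      have single: "{v \<in> ?\<Omega>. v t = Some s} \<in> sets ?\<Sigma>" if "s \<in> S" for s
      proof -
        have "{v \<in> ?\<Omega>. v t = Some s} = cyl {t} (\<lambda>_. s)" by (simp add: cyl_def)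
        also have "\<dots> \<in> E" using that by (auto simp: E_def)
        finally show ?thesis using E_sub by (simp add: sets_measure_of sigma_sets.Basic)
      qed
      show "(\<lambda>v. v t) \<in> ?\<Sigma> \<rightarrow>\<^sub>M count_space ?O"
      proof (rule measurable_count_space_eq_countable[THEN iffD2])
        show "countable ?O" using S by auto
        show "(\<lambda>v. v t) \<in> space ?\<Sigma> \<rightarrow> ?O \<and> (\<forall>a\<in>?O. (\<lambda>v. v t) -` {a} \<inter> space ?\<Sigma> \<in> sets ?\<Sigma>)"
        proof (intro conjI ballI)
          show "(\<lambda>v. v t) \<in> space ?\<Sigma> \<rightarrow> ?O"
            using E_sub by (auto simp: space_measure_of_conv)
          fix a assume a: "a \<in> ?O"
          show "(\<lambda>v. v t) -` {a} \<inter> space ?\<Sigma> \<in> sets ?\<Sigma>"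
          proof (cases a)
            case (Some s)
            have "(\<lambda>v. v t) -` {a} \<inter> space ?\<Sigma> = {v \<in> ?\<Omega>. v t = Some s}"
              using Some E_sub by (auto simp: space_measure_of_conv)
            then show ?thesis using single[of s] a Some by auto
          next
            case None
            have "(\<lambda>v. v t) -` {a} \<inter> space ?\<Sigma> = space ?\<Sigma> - (\<Union>s\<in>S. {v \<in> ?\<Omega>. v t = Some s})"
            proof (intro Set.set_eqI iffI)
              fix v assume v: "v \<in> space ?\<Sigma> - (\<Union>s\<in>S. {v \<in> ?\<Omega>. v t = Some s})"
              then have "v t \<in> ?O" by (auto simp: space_measure_of_conv)
              with v show "v \<in> (\<lambda>v. v t) -` {a} \<inter> space ?\<Sigma>"
                using None by (auto simp: space_measure_of_conv)
            qed (use None in auto)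
            then show ?thesis using single S by (auto intro!: sets.countable_UN')
          qed
        qed
      qed
    qed
    show ?thesis
    proof (intro subsetI)
      fix A assume A: "A \<in> sets ?P"
      have "(\<lambda>v. v) -` A \<inter> space ?\<Sigma> \<in> sets ?\<Sigma>"
        using measurable_sets[OF id A] by simp
      moreover have "(\<lambda>v. v) -` A \<inter> space ?\<Sigma> = A"
        using sets.sets_into_space[OF A] by (auto simp: space_measure_of_conv space_PiM)
      ultimately show "A \<in> sigma_sets ?\<Omega> E"
        using E_sub by (simp add: sets_measure_of)
    qed
  qed
  have sets_eq: "sets ?P = sigma_sets ?\<Omega> E" using sub1 sub2 by auto
  show ?thesis
  proof (rule measure_eqI_generator_eq[OF Int E_sub, where A="\<lambda>_. ?\<Omega>"])
    show "emeasure M1 X = emeasure M2 X" if "X \<in> E" for X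
      using that eq by (auto simp: E_def cyl_def space)
    have "?\<Omega> = cyl {} (\<lambda>_. undefined)" by (auto simp: cyl_def)
    then show "range (\<lambda>_. ?\<Omega>) \<subseteq> E" by (auto simp: E_def)
    show "emeasure M1 ?\<Omega> \<noteq> \<infinity>"
      using prob_space.emeasure_space_1[OF M(1)] space by simp
  qed (use sets sets_eq E_sub in auto)
qed

context skeleton_process begin

lemma measurable_killed:
  assumes S: "countable S" and K: "\<And>n. finite (K n)" "\<And>n. K n \<subseteq> S"
  shows "killed K X t \<in> M \<rightarrow>\<^sub>M count_space (insert None (Some ` S))"
proof (rule measurable_count_space_eq_countable[THEN iffD2])
  show "countable (insert None (Some ` S))" using S by auto
  have Some: "{w \<in> space M. killed K X t w = Some s} \<in> sets M" if "s \<in> S" for s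
    unfolding killed_eq_Some_iff
    by (intro sets.sets_Collect_conj sets.sets_Collect_countable_Ex measurable_confined K measurable_state that) auto
  show "killed K X t \<in> space M \<rightarrow> insert None (Some ` S) \<and>
    (\<forall>a\<in>insert None (Some ` S). killed K X t -` {a} \<inter> space M \<in> sets M)"
  proof (intro conjI ballI Pi_I)
    show range: "killed K X t w \<in> insert None (Some ` S)" if "w \<in> space M" for w
      using state_range[OF that, of "enn2real t"] by (simp add: killed_def)
    fix a assume a: "a \<in> insert None (Some ` S)"
    show "killed K X t -` {a} \<inter> space M \<in> sets M"
    proof (cases a)
      case (Some s)
      have "killed K X t -` {a} \<inter> space M = {w \<in> space M. killed K X t w = Some s}"
        using Some by auto
      then show ?thesis using \<open>\<And>s. s \<in> S \<Longrightarrow> _\<close>[of s] a Some by auto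
    next
      case None
      have "killed K X t -` {a} \<inter> space M = space M - (\<Union>s\<in>S. {w \<in> space M. killed K X t w = Some s})"
        using None range by fastforce
      then show ?thesis using \<open>\<And>s. s \<in> S \<Longrightarrow> _\<close> S by (auto intro!: sets.countable_UN')
    qed
  qed
qed

lemma measurable_killed_path:
  assumes "countable S" "\<And>n. finite (K n)" "\<And>n. K n \<subseteq> S"
  shows "(\<lambda>w t. killed K X t w) \<in> M \<rightarrow>\<^sub>M (\<Pi>\<^sub>M t\<in>UNIV. count_space (insert None (Some ` S)))"
proof (rule measurable_PiM_single')
  show "(\<lambda>w t. killed K X t w) \<in> space M \<rightarrow> (\<Pi>\<^sub>E t\<in>UNIV. space (count_space (insert None (Some ` S))))"
    using measurable_space[OF measurable_killed[where K=K, OF assms]] by fastforce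
qed (use measurable_killed[where K=K, OF assms] in auto)

text \<open>Confinement up to the largest time of \<open>J\<close> implies it for the smaller ones,
  so one \<open>K n\<close> serves all of \<open>J\<close>, and the events increase to the killed
  one.\<close>

lemma confined_event_tendsto_killed:
  assumes K: "incseq K" "\<And>n. finite (K n)" "\<And>n. K n \<subseteq> S"
    and J: "finite J" "J \<noteq> {}" "\<infinity> \<notin> J" "y ` J \<subseteq> S"
  shows "(\<lambda>n. measure M (confined_event (K n) (enn2real ` J) (y \<circ> ennreal) (Max (enn2real ` J)))) \<longlonglongrightarrow>
    measure M {w \<in> space M. \<forall>t\<in>J. killed K X t w = Some (y t)}"
proof -
  let ?J = "enn2real ` J" and ?y = "y \<circ> ennreal"
  let ?E = "\<lambda>n. confined_event (K n) ?J ?y (Max ?J)"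
  have fin: "t < \<infinity>" "ennreal (enn2real t) = t" if "t \<in> J" for t
    using that J(3) by (cases t; auto)+
  have meas: "?E n \<in> sets M" for n
    using J fin K by (intro measurable_confined_event) (auto simp: image_subset_iff)
  have "(\<lambda>n. measure M (?E n)) \<longlonglongrightarrow> measure M (\<Union>n. ?E n)"
  proof (rule finite_Lim_measure_incseq)
    show "range ?E \<subseteq> sets M" using meas by auto
    show "incseq ?E"
    proof (intro incseq_SucI subsetI)
      fix n w assume "w \<in> ?E n"
      then show "w \<in> ?E (Suc n)"
        using confined_mono[of X "K n" "Max ?J" w "K (Suc n)"] incseq_SucD[OF K(1), of n]
        by (simp add: confined_event_def)
    qed
  qed
  moreover have "(\<Union>n. ?E n) = {w \<in> space M. \<forall>t\<in>J. killed K X t w = Some (y t)}"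
  proof (intro Set.set_eqI iffI)
    fix w assume "w \<in> (\<Union>n. ?E n)"
    then obtain n where w: "w \<in> space M" "\<And>t. t \<in> ?J \<Longrightarrow> X t w = Some (?y t)" "confined X (K n) (Max ?J) w"
      by (auto simp: confined_event_def)
    have "killed K X t w = Some (y t)" if t: "t \<in> J" for t
    proof -
      have "enn2real t \<le> Max ?J" using J t by auto
      then have "confined X (K n) (enn2real t) w" using confined_mono[OF w(3) order_refl] by blast
      then show ?thesis using fin[OF t] w(2)[of "enn2real t"] t by (auto simp: killed_eq_Some_iff)
    qed
    then show "w \<in> {w \<in> space M. \<forall>t\<in>J. killed K X t w = Some (y t)}" using w by auto
  next
    fix w assume "w \<in> {w \<in> space M. \<forall>t\<in>J. killed K X t w = Some (y t)}"
    then have w: "w \<in> space M" "\<And>t. t \<in> J \<Longrightarrow> killed K X t w = Some (y t)" by auto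
    have "Max ?J \<in> ?J" using J by (intro Max_in) auto
    then obtain t where t: "t \<in> J" "Max ?J = enn2real t" by auto
    obtain n where "confined X (K n) (Max ?J) w" using w(2)[OF t(1)] t(2) by (auto simp: killed_eq_Some_iff)
    then have "w \<in> ?E n" using w fin by (auto simp: confined_event_def killed_eq_Some_iff)
    then show "w \<in> (\<Union>n. ?E n)" by auto
  qed
  ultimately show ?thesis by simp
qed

end

theorem killed_law_eq:
  assumes X1: "skeleton_process M1 X1 S p1 x" and X2: "skeleton_process M2 X2 S p2 x"
    and deriv: "\<And>y z. y \<in> S \<Longrightarrow> z \<in> S \<Longrightarrow> ((\<lambda>h. (p1 h y z - p2 h y z) / h) \<longlongrightarrow> 0) (at_right 0)"
    and S: "countable S"
    and K: "incseq K" "\<And>n. finite (K n)" "(\<Union>n. K n) = S"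
  shows "distr M1 (\<Pi>\<^sub>M t\<in>UNIV. count_space (insert None (Some ` S))) (\<lambda>w t. killed K X1 t w) =
    distr M2 (\<Pi>\<^sub>M t\<in>UNIV. count_space (insert None (Some ` S))) (\<lambda>w t. killed K X2 t w)"
    (is "distr M1 ?P ?k1 = distr M2 ?P ?k2")
proof -
  interpret X1: skeleton_process M1 X1 S p1 x by fact
  interpret X2: skeleton_process M2 X2 S p2 x by fact
  have KS: "\<And>n. K n \<subseteq> S" using K(3) by auto
  note k1 = X1.measurable_killed_path[OF S K(2) KS] and k2 = X2.measurable_killed_path[OF S K(2) KS]
  show ?thesis
  proof (rule measure_eq_of_option_cylinders[OF S])
    show "prob_space (distr M1 ?P ?k1)" using k1 by (rule X1.prob_space_distr)
    show "prob_space (distr M2 ?P ?k2)" using k2 by (rule X2.prob_space_distr)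
    fix J y assume J: "finite (J :: ennreal set)" "y ` J \<subseteq> S"
    have cyl: "{v \<in> space ?P. \<forall>t\<in>J. v t = Some (y t)} \<in> sets ?P"
    proof (intro sets.sets_Collect_finite_All)
      fix t assume "t \<in> J"
      have "(\<lambda>v. v t) \<in> ?P \<rightarrow>\<^sub>M count_space (insert None (Some ` S))"
        by (rule measurable_component_singleton) simp
      from measurable_sets[OF this, of "{Some (y t)}"] show "{v \<in> space ?P. v t = Some (y t)} \<in> sets ?P"
        using J(2) \<open>t \<in> J\<close> by (auto simp: vimage_def Int_def conj_commute)
    qed fact
    have e1: "emeasure (distr M1 ?P ?k1) {v \<in> space (distr M1 ?P ?k1). \<forall>t\<in>J. v t = Some (y t)} =
        emeasure M1 {w \<in> space M1. \<forall>t\<in>J. killed K X1 t w = Some (y t)}"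
      using measurable_space[OF k1] by (simp, subst emeasure_distr[OF k1 cyl]) (auto intro!: arg_cong[where f="emeasure M1"])
    have e2: "emeasure (distr M2 ?P ?k2) {v \<in> space (distr M2 ?P ?k2). \<forall>t\<in>J. v t = Some (y t)} =
        emeasure M2 {w \<in> space M2. \<forall>t\<in>J. killed K X2 t w = Some (y t)}"
      using measurable_space[OF k2] by (simp, subst emeasure_distr[OF k2 cyl]) (auto intro!: arg_cong[where f="emeasure M2"])
    have "measure M1 {w \<in> space M1. \<forall>t\<in>J. killed K X1 t w = Some (y t)} =
        measure M2 {w \<in> space M2. \<forall>t\<in>J. killed K X2 t w = Some (y t)}"
    proof -
      consider "J = {}" | "\<infinity> \<in> J" | "J \<noteq> {}" "\<infinity> \<notin> J" by auto
      then show ?thesis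
      proof cases
        case 1
        then show ?thesis by (simp add: X1.prob_space X2.prob_space)
      next
        case 2
        have "killed K X1 \<infinity> w \<noteq> Some (y \<infinity>)" "killed K X2 \<infinity> w' \<noteq> Some (y \<infinity>)" for w w'
          by (simp_all add: killed_def)
        with 2 have "{w \<in> space M1. \<forall>t\<in>J. killed K X1 t w = Some (y t)} = {}"
          "{w \<in> space M2. \<forall>t\<in>J. killed K X2 t w = Some (y t)} = {}"
          by blast+
        then show ?thesis by (simp only: measure_empty)
      next
        \<comment> \<open>The comparison inside \<open>K n\<close> asks that the prescribed states
          lie in \<open>K n\<close>. This holds from some \<open>n\<close> on, which is enough for
          the limit.\<close>
        case 3
        let ?J = "enn2real ` J" and ?y = "y \<circ> ennreal"
        have yJ: "?y ` ?J = y ` J"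
          unfolding image_image
        proof (rule image_cong[OF refl])
          fix t assume "t \<in> J"
          then show "?y (enn2real t) = y t" using 3 by (cases t) auto
        qed
        have "\<forall>\<^sub>F n in sequentially. y ` J \<subseteq> K n"
        proof -
          have "\<forall>\<^sub>F n in sequentially. \<forall>s\<in>y ` J. s \<in> K n"
          proof (intro eventually_ball_finite ballI)
            fix s assume "s \<in> y ` J"
            then obtain N where "s \<in> K N" using J K(3) by blast
            then show "\<forall>\<^sub>F n in sequentially. s \<in> K n"
              using incseqD[OF K(1)] by (intro eventually_sequentiallyI[of N]) blast
          qed (use J in auto)
          then show ?thesis by (rule eventually_mono) blast
        qed
        then have "\<forall>\<^sub>F n in sequentially. measure M1 (X1.confined_event (K n) ?J ?y (Max ?J)) =
          measure M2 (X2.confined_event (K n) ?J ?y (Max ?J))"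
        proof eventually_elim
          case (elim n)
          show ?case
            using J 3 K KS elim yJ by (intro confined_event_measure_eq[OF X1 X2 deriv]) auto
        qed
        from tendsto_cong[OF this] X1.confined_event_tendsto_killed[OF K(1,2) KS J(1) 3 J(2)]
          X2.confined_event_tendsto_killed[OF K(1,2) KS J(1) 3 J(2)]
        show ?thesis by (intro LIMSEQ_unique[of _ _ "measure M2 _"]) auto
      qed
    qed
    then show "emeasure (distr M1 ?P ?k1) {v \<in> space (distr M1 ?P ?k1). \<forall>t\<in>J. v t = Some (y t)} =
        emeasure (distr M2 ?P ?k2) {v \<in> space (distr M2 ?P ?k2). \<forall>t\<in>J. v t = Some (y t)}"
      unfolding e1 e2 by (simp add: X1.emeasure_eq_measure X2.emeasure_eq_measure)
  qed simp_all
qed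

section \<open>Jump processes built from exponential holding times\<close>

abbreviation unit_exponential :: "real measure" where
  "unit_exponential \<equiv> density lborel (\<lambda>x. ennreal (exponential_density 1 x))"

lemma prob_space_unit_exponential: "prob_space unit_exponential"
  by (rule prob_space_exponential_density) simp

lemma nn_integral_unit_exponential:
  "f \<in> borel_measurable borel \<Longrightarrow>
    (\<integral>\<^sup>+e. f e \<partial>unit_exponential) = (\<integral>\<^sup>+e. ennreal (exponential_density 1 e) * f e \<partial>lborel)"
  by (subst nn_integral_density) auto

lemma nn_integral_unit_exponential_memoryless:
  assumes [measurable]: "f \<in> borel_measurable borel" and a: "0 \<le> a"
  shows "(\<integral>\<^sup>+e. indicator {a<..} e * f e \<partial>unit_exponential) =
    ennreal (exp (- a)) * (\<integral>\<^sup>+e. f (a + e) \<partial>unit_exponential)"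
proof -
  have "(\<integral>\<^sup>+e. indicator {a<..} e * f e \<partial>unit_exponential) =
      (\<integral>\<^sup>+e. ennreal (exponential_density 1 e) * (indicator {a<..} e * f e) \<partial>lborel)"
    by (subst nn_integral_unit_exponential) auto
  also have "\<dots> = (\<integral>\<^sup>+e. ennreal (exponential_density 1 (a + e)) * (indicator {a<..} (a + e) * f (a + e)) \<partial>lborel)"
    by (subst nn_integral_real_affine[where c=1 and t=a]) auto
  \<comment> \<open>At \<open>e = 0\<close> the integrands may differ: the density is 1 there, while
    the indicator of the open half-line vanishes. Hence equality only almost everywhere.\<close>
  also have "\<dots> = (\<integral>\<^sup>+e. ennreal (exp (- a)) * (ennreal (exponential_density 1 e) * f (a + e)) \<partial>lborel)"
  proof (rule nn_integral_cong_AE, use AE_lborel_singleton[of 0] in eventually_elim)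
    fix e :: real assume "e \<noteq> 0"
    then show "ennreal (exponential_density 1 (a + e)) * (indicator {a<..} (a + e) * f (a + e)) =
      ennreal (exp (- a)) * (ennreal (exponential_density 1 e) * f (a + e))"
      using a by (cases "0 < e")
        (auto simp: exponential_density_def mult.assoc[symmetric] ennreal_mult[symmetric] exp_add[symmetric])
  qed
  also have "\<dots> = ennreal (exp (- a)) * (\<integral>\<^sup>+e. f (a + e) \<partial>unit_exponential)"
    by (subst nn_integral_cmult) (auto simp: nn_integral_unit_exponential)
  finally show ?thesis .
qed

lemma emeasure_unit_exponential_greaterThan:
  assumes "0 \<le> a" shows "emeasure unit_exponential {a<..} = ennreal (exp (- a))"
proof -
  interpret prob_space unit_exponential by (rule prob_space_unit_exponential)
  have "emeasure unit_exponential {a<..} = (\<integral>\<^sup>+e. indicator {a<..} e * 1 \<partial>unit_exponential)"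
    by simp
  then show ?thesis
    using nn_integral_unit_exponential_memoryless[of "\<lambda>_. 1" a] assms emeasure_space_1 by simp
qed

lemma emeasure_unit_exponential_atMost:
  assumes "0 \<le> a" shows "emeasure unit_exponential {..a} = ennreal (1 - exp (- a))"
proof -
  interpret prob_space unit_exponential by (rule prob_space_unit_exponential)
  have "{..a} = space unit_exponential - {a<..}" by auto
  then have "measure unit_exponential {..a} = 1 - measure unit_exponential {a<..}"
    using prob_compl[of "{a<..}"] by simp
  then show ?thesis
    using emeasure_unit_exponential_greaterThan[OF assms] by (simp add: emeasure_eq_measure)
qed

text \<open>The observation times as they appear after a restart of the process at time
  \<open>s\<close>.\<close>

definition shift_times :: "real \<Rightarrow> (real \<times> 'x) list \<Rightarrow> (real \<times> 'x) list" where
  "shift_times s L = map (\<lambda>(t, y). (t - s, y)) L"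

lemma shift_times_shift_times: "shift_times r (shift_times s L) = shift_times (s + r) L"
  by (simp add: shift_times_def case_prod_unfold comp_def algebra_simps)

lemma set_shift_times: "set (shift_times s L) = (\<lambda>(t, y). (t - s, y)) ` set L"
  by (simp add: shift_times_def)

primrec time_grid :: "real \<Rightarrow> real \<Rightarrow> 'x list \<Rightarrow> (real \<times> 'x) list" where
  "time_grid h t [] = []"
| "time_grid h t (y # ys) = (t, y) # time_grid h (t + h) ys"

lemma shift_time_grid: "shift_times s (time_grid h t ys) = time_grid h (t - s) ys"
  by (induction ys arbitrary: t) (simp_all add: shift_times_def algebra_simps)

lemma set_time_grid: "set (time_grid h t ys) = {(t + real j * h, ys ! j) | j. j < length ys}"
proof (induction ys arbitrary: t)
  case (Cons y ys)
  show ?case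
  proof (intro Set.set_eqI iffI)
    fix p assume "p \<in> set (time_grid h t (y # ys))"
    then consider "p = (t, y)" | j where "j < length ys" "p = (t + h + real j * h, ys ! j)"
      using Cons.IH by auto
    then show "p \<in> {(t + real j * h, (y # ys) ! j) | j. j < length (y # ys)}"
    proof cases
      case 1 then show ?thesis by (auto intro!: exI[of _ 0])
    next
      case 2 then show ?thesis by (auto simp: algebra_simps intro!: exI[of _ "Suc j"])
    qed
  next
    fix p assume "p \<in> {(t + real j * h, (y # ys) ! j) | j. j < length (y # ys)}"
    then obtain j where j: "p = (t + real j * h, (y # ys) ! j)" "j < length (y # ys)" by auto
    show "p \<in> set (time_grid h t (y # ys))"
    proof (cases j)
      case 0 then show ?thesis using j by simp
    next
      case (Suc i)
      then have "p = (t + h + real i * h, ys ! i)" "i < length ys" using j by (auto simp: algebra_simps)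
      then show ?thesis using Cons.IH by auto
    qed
  qed
qed simp

text \<open>Jump chain \<open>x, step x n\<^sub>0, step (step x n\<^sub>0) n\<^sub>1, \<dots>\<close> with i.i.d. innovations of law \<open>\<kappa>\<close>;
  the holding time in a state \<open>y\<close> is \<open>c y\<close> times a unit exponential variable.\<close>

locale jump_process =
  fixes c :: "'x \<Rightarrow> real" and step :: "'x \<Rightarrow> nat \<Rightarrow> 'x" and \<kappa> :: "nat pmf"
  assumes c_pos: "0 < c x"
begin

abbreviation E where "E \<equiv> stream_space unit_exponential"
abbreviation I where "I \<equiv> stream_space (measure_pmf \<kappa>)"
abbreviation \<Omega> where "\<Omega> \<equiv> E \<Otimes>\<^sub>M I"

sublocale E: prob_space E
  using prob_space.prob_space_stream_space[OF prob_space_unit_exponential] .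

sublocale I: prob_space I
  using prob_space.prob_space_stream_space[OF measure_pmf.prob_space_axioms] .

sublocale EI: pair_prob_space E I ..

lemma space_\<Omega> [simp]: "space \<Omega> = UNIV"
  by (simp add: space_pair_measure space_stream_space)

abbreviation push :: "real \<Rightarrow> nat \<Rightarrow> real stream \<times> nat stream \<Rightarrow> real stream \<times> nat stream" where
  "push e n z \<equiv> (e ## fst z, n ## snd z)"

lemma measurable_push [measurable]: "push e n \<in> \<Omega> \<rightarrow>\<^sub>M \<Omega>"
  by measurable

text \<open>The holding time is kept as the outer variable: the lack of memory of the exponential
  law is applied to it, with the innovation and the remaining streams inside.\<close>

lemma nn_integral_first_step:
  assumes [measurable]: "f \<in> borel_measurable \<Omega>"
  shows "(\<integral>\<^sup>+z. f z \<partial>\<Omega>) = (\<integral>\<^sup>+e. \<integral>\<^sup>+n. \<integral>\<^sup>+z. f (push e n z) \<partial>\<Omega> \<partial>\<kappa> \<partial>unit_exponential)"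
proof -
  interpret U: prob_space unit_exponential by (rule prob_space_unit_exponential)
  interpret KE: pair_sigma_finite E "measure_pmf \<kappa>" ..
  have "(\<integral>\<^sup>+z. f z \<partial>\<Omega>) = (\<integral>\<^sup>+s. \<integral>\<^sup>+u. f (s, u) \<partial>I \<partial>E)"
    by (rule I.nn_integral_fst[symmetric]) simp
  also have "\<dots> = (\<integral>\<^sup>+e. \<integral>\<^sup>+s. \<integral>\<^sup>+u. f (e ## s, u) \<partial>I \<partial>E \<partial>unit_exponential)"
    by (rule U.nn_integral_stream_space) measurable
  also have "\<dots> = (\<integral>\<^sup>+e. \<integral>\<^sup>+s. \<integral>\<^sup>+n. \<integral>\<^sup>+u. f (e ## s, n ## u) \<partial>I \<partial>\<kappa> \<partial>E \<partial>unit_exponential)"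
    by (intro nn_integral_cong prob_space.nn_integral_stream_space[OF measure_pmf.prob_space_axioms]) measurable
  also have "\<dots> = (\<integral>\<^sup>+e. \<integral>\<^sup>+n. \<integral>\<^sup>+s. \<integral>\<^sup>+u. f (e ## s, n ## u) \<partial>I \<partial>E \<partial>\<kappa> \<partial>unit_exponential)"
    by (intro nn_integral_cong KE.Fubini'[symmetric]) measurable
  also have "\<dots> = (\<integral>\<^sup>+e. \<integral>\<^sup>+n. \<integral>\<^sup>+z. f (push e n z) \<partial>\<Omega> \<partial>\<kappa> \<partial>unit_exponential)"
  proof (intro nn_integral_cong)
    fix e n
    have "(\<lambda>z. f (push e n z)) \<in> borel_measurable \<Omega>"
      by (rule measurable_compose[OF measurable_push assms])
    from I.nn_integral_fst[OF this]
    show "(\<integral>\<^sup>+s. \<integral>\<^sup>+u. f (e ## s, n ## u) \<partial>I \<partial>E) = (\<integral>\<^sup>+z. f (push e n z) \<partial>\<Omega>)"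
      by simp
  qed
  finally show ?thesis .
qed

lemma emeasure_push:
  assumes "Measurable.pred \<Omega> A"
  shows "emeasure \<Omega> {z. A (push e n z)} = (\<integral>\<^sup>+z. indicator {z. A z} (push e n z) \<partial>\<Omega>)"
proof -
  note [measurable] = assms
  have "Measurable.pred \<Omega> (\<lambda>z. A (push e n z))" by measurable
  then have "{z. A (push e n z)} \<in> sets \<Omega>" by (simp add: pred_def)
  moreover have "indicator {z. A z} (push e n z) = (indicator {z. A (push e n z)} z :: ennreal)" for z
    by (simp add: indicator_def)
  ultimately show ?thesis
    by simp
qed

lemma emeasure_first_step:
  assumes "Measurable.pred \<Omega> A"
  shows "emeasure \<Omega> {z. A z} = (\<integral>\<^sup>+e. \<integral>\<^sup>+n. emeasure \<Omega> {z. A (push e n z)} \<partial>\<kappa> \<partial>unit_exponential)"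
proof -
  have A: "{z. A z} \<in> sets \<Omega>"
    using assms by (simp add: pred_def)
  have "emeasure \<Omega> {z. A z} = (\<integral>\<^sup>+z. indicator {z. A z} z \<partial>\<Omega>)"
    using A by simp
  also have "\<dots> = (\<integral>\<^sup>+e. \<integral>\<^sup>+n. \<integral>\<^sup>+z. indicator {z. A z} (push e n z) \<partial>\<Omega> \<partial>\<kappa> \<partial>unit_exponential)"
    using A by (intro nn_integral_first_step) auto
  finally show ?thesis
    by (simp only: emeasure_push[OF assms])
qed

lemma measurable_first_step:
  assumes "Measurable.pred \<Omega> A"
  shows "(\<lambda>e. \<integral>\<^sup>+n. emeasure \<Omega> {z. A (push e n z)} \<partial>\<kappa>) \<in> borel_measurable borel"
proof -
  have [measurable]: "{z. A z} \<in> sets \<Omega>"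
    using assms by (simp add: pred_def)
  show ?thesis
    unfolding emeasure_push[OF assms] by measurable
qed

text \<open>\<open>occ k x t y z\<close> says that the process started at \<open>x\<close> has jumped \<open>k\<close> times by time \<open>t\<close> and is
  then at \<open>y\<close>; the recursion peels off the first jump.\<close>

primrec occ :: "nat \<Rightarrow> 'x \<Rightarrow> real \<Rightarrow> 'x \<Rightarrow> real stream \<times> nat stream \<Rightarrow> bool" where
  "occ 0 x t y z \<longleftrightarrow> 0 \<le> t \<and> t < c x * shd (fst z) \<and> y = x"
| "occ (Suc k) x t y z \<longleftrightarrow> c x * shd (fst z) \<le> t \<and>
     occ k (step x (shd (snd z))) (t - c x * shd (fst z)) y (stl (fst z), stl (snd z))"

text \<open>No state qualifies once \<open>t\<close> has reached the sum of all holding times, so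
  the process is killed at explosion.\<close>

definition state_at :: "'x \<Rightarrow> real \<Rightarrow> 'x \<Rightarrow> real stream \<times> nat stream \<Rightarrow> bool" where
  "state_at x t y z \<longleftrightarrow> (\<exists>k. occ k x t y z)"

lemma occ_push_Suc:
  "occ (Suc k) x t y (push e n z) \<longleftrightarrow> c x * e \<le> t \<and> occ k (step x n) (t - c x * e) y z"
  by simp

lemma state_at_push:
  "state_at x t y (push e n z) \<longleftrightarrow>
     (0 \<le> t \<and> t < c x * e \<and> y = x) \<or> (c x * e \<le> t \<and> state_at (step x n) (t - c x * e) y z)"
proof
  assume "state_at x t y (push e n z)"
  then obtain k where "occ k x t y (push e n z)" by (auto simp: state_at_def)
  then show "(0 \<le> t \<and> t < c x * e \<and> y = x) \<or> (c x * e \<le> t \<and> state_at (step x n) (t - c x * e) y z)"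
    by (cases k) (auto simp: state_at_def)
next
  assume "(0 \<le> t \<and> t < c x * e \<and> y = x) \<or> (c x * e \<le> t \<and> state_at (step x n) (t - c x * e) y z)"
  then show "state_at x t y (push e n z)"
  proof
    assume "0 \<le> t \<and> t < c x * e \<and> y = x"
    then have "occ 0 x t y (push e n z)" by simp
    then show ?thesis unfolding state_at_def by blast
  next
    assume *: "c x * e \<le> t \<and> state_at (step x n) (t - c x * e) y z"
    then obtain k where "occ k (step x n) (t - c x * e) y z" by (auto simp: state_at_def)
    then have "occ (Suc k) x t y (push e n z)" using * by simp
    then show ?thesis unfolding state_at_def by blast
  qed
qed

lemma occ_unique: "occ k x t y z \<Longrightarrow> occ k' x t y' z \<Longrightarrow> k = k' \<and> y = y'"
proof (induction k arbitrary: k' x t z)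
  case 0 then show ?case by (cases k') auto
next
  case (Suc k) then show ?case by (cases k') auto
qed

text \<open>\<open>T\<close> and \<open>Z\<close> are arbitrary measurable maps because the
  recursion replaces both: the time by what is left after the first jump, the streams by their
  tails.\<close>

lemma measurable_occ [measurable]:
  assumes [measurable]: "T \<in> borel_measurable M" "Z \<in> M \<rightarrow>\<^sub>M \<Omega>"
  shows "Measurable.pred M (\<lambda>w. occ k x (T w) y (Z w))"
  using assms
proof (induction k arbitrary: x T Z)
  case 0
  note [measurable] = 0
  have "(\<lambda>w. shd (fst (Z w))) \<in> M \<rightarrow>\<^sub>M unit_exponential" by measurable
  then have [measurable]: "(\<lambda>w. shd (fst (Z w))) \<in> borel_measurable M"
    by (subst measurable_cong_sets[OF refl, of borel unit_exponential]) auto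
  show ?case by simp
next
  case (Suc k)
  note [measurable] = Suc.prems
  have "(\<lambda>w. shd (fst (Z w))) \<in> M \<rightarrow>\<^sub>M unit_exponential" by measurable
  then have [measurable]: "(\<lambda>w. shd (fst (Z w))) \<in> borel_measurable M"
    by (subst measurable_cong_sets[OF refl, of borel unit_exponential]) auto
  have "(\<lambda>w. shd (snd (Z w))) \<in> M \<rightarrow>\<^sub>M measure_pmf \<kappa>" by measurable
  then have n [measurable]: "(\<lambda>w. shd (snd (Z w))) \<in> M \<rightarrow>\<^sub>M count_space UNIV"
    by (subst measurable_cong_sets[OF refl, of "count_space UNIV" "measure_pmf \<kappa>"]) auto
  \<comment> \<open>The state after the jump is random but determined by a natural number, so
    measurability is shown for each fixed innovation and then glued.\<close>
  have "Measurable.pred M (\<lambda>w. occ k (step x n) (T w - c x * shd (fst (Z w))) y (stl (fst (Z w)), stl (snd (Z w))))" for n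
    by (rule Suc.IH) measurable
  from measurable_compose_countable[OF this n]
  have [measurable]: "Measurable.pred M (\<lambda>w. occ k (step x (shd (snd (Z w)))) (T w - c x * shd (fst (Z w))) y
    (stl (fst (Z w)), stl (snd (Z w))))" .
  show ?case unfolding occ.simps by measurable
qed

lemma measurable_state_at [measurable]:
  assumes [measurable]: "T \<in> borel_measurable M" "Z \<in> M \<rightarrow>\<^sub>M \<Omega>"
  shows "Measurable.pred M (\<lambda>w. state_at x (T w) y (Z w))"
  unfolding state_at_def by measurable

definition states_at :: "'x \<Rightarrow> (real \<times> 'x) list \<Rightarrow> real stream \<times> nat stream \<Rightarrow> bool" where
  "states_at x L z \<longleftrightarrow> (\<forall>(t, y)\<in>set L. state_at x t y z)"

lemma states_at_Nil [simp]: "states_at x [] z"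
  by (simp add: states_at_def)

lemma states_at_Cons [simp]: "states_at x ((t, y) # L) z \<longleftrightarrow> state_at x t y z \<and> states_at x L z"
  by (simp add: states_at_def)

lemma measurable_states_at [measurable]:
  assumes [measurable]: "Z \<in> M \<rightarrow>\<^sub>M \<Omega>"
  shows "Measurable.pred M (\<lambda>w. states_at x L (Z w))"
  by (induction L) (auto simp: case_prod_unfold)

lemma states_at_push:
  assumes "\<forall>(t, y)\<in>set L. c x * e \<le> t"
  shows "states_at x L (push e n z) \<longleftrightarrow> states_at (step x n) (shift_times (c x * e) L) z"
  using assms by (fastforce simp: states_at_def set_shift_times state_at_push)

text \<open>When the first holding time is \<open>s + c x * e\<close>, an observer who starts at
  \<open>s\<close> sees the residual time \<open>c x * e\<close>. The argument
  \<open>s / c x + e\<close> is the value of the unit exponential variable that produces this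
  holding time.\<close>

lemma states_at_push_wait:
  assumes "0 \<le> s" "\<forall>(t, y)\<in>set L. s \<le> t"
  shows "states_at x L (push (s / c x + e) n z) \<longleftrightarrow> states_at x (shift_times s L) (push e n z)"
proof -
  have eq: "c x * (s / c x + e) = s + c x * e"
    using c_pos[of x] by (simp add: field_simps)
  have "state_at x t y (push (s / c x + e) n z) \<longleftrightarrow> state_at x (t - s) y (push e n z)" if "s \<le> t" for t y
    using that assms(1) unfolding state_at_push eq by (auto simp: algebra_simps)
  then show ?thesis
    using assms(2) by (fastforce simp: states_at_def set_shift_times)
qed

lemma sets_Collect_\<Omega>: "Measurable.pred \<Omega> A \<Longrightarrow> {z. A z} \<in> sets \<Omega>"
  by (simp add: pred_def)

section \<open>Markov property of the jump process and the law of its skeletons\<close>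

definition law :: "'x \<Rightarrow> (real \<times> 'x) list \<Rightarrow> ennreal" where
  "law x L = emeasure \<Omega> {z. states_at x L z}"

lemma prob_space_\<Omega>: "prob_space \<Omega>"
  by (rule EI.prob_space_axioms)

lemma law_first_step:
  "law x L = (\<integral>\<^sup>+e. \<integral>\<^sup>+n. emeasure \<Omega> {z. states_at x L (push e n z)} \<partial>\<kappa> \<partial>unit_exponential)"
  unfolding law_def by (rule emeasure_first_step) measurable

lemma emeasure_occ_0:
  assumes "0 \<le> t"
  shows "emeasure \<Omega> {z. occ 0 x t x z} = ennreal (exp (- t / c x))"
proof -
  have "emeasure \<Omega> {z. occ 0 x t x z} = (\<integral>\<^sup>+e. \<integral>\<^sup>+n. emeasure \<Omega> {z. occ 0 x t x (push e n z)} \<partial>\<kappa> \<partial>unit_exponential)"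
    by (rule emeasure_first_step) measurable
  also have "\<dots> = (\<integral>\<^sup>+e. indicator {t / c x<..} e \<partial>unit_exponential)"
    using assms c_pos[of x] EI.emeasure_space_1
    by (intro nn_integral_cong) (auto simp: field_simps split: split_indicator)
  also have "\<dots> = ennreal (exp (- t / c x))"
    using emeasure_unit_exponential_greaterThan[of "t / c x"] assms c_pos[of x] by simp
  finally show ?thesis .
qed

text \<open>Induction on the number of jumps before \<open>s\<close>; without a jump, the lack of memory of the
  exponential distribution restarts the process at \<open>s\<close>.\<close>

lemma occ_markov:
  assumes "\<forall>(t, y)\<in>set L. s \<le> t"
  shows "emeasure \<Omega> {z. occ k x s y z \<and> states_at x L z} =
    emeasure \<Omega> {z. occ k x s y z} * law y (shift_times s L)"
  using assms
proof (induction k arbitrary: x s L)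
  case 0
  show ?case
  proof (cases "0 \<le> s \<and> y = x")
    case True
    let ?H = "\<lambda>e. \<integral>\<^sup>+n. emeasure \<Omega> {z. states_at x L (push e n z)} \<partial>\<kappa>"
    have [measurable]: "?H \<in> borel_measurable borel"
      by (rule measurable_first_step) measurable
    have "emeasure \<Omega> {z. occ 0 x s y z \<and> states_at x L z} =
        (\<integral>\<^sup>+e. \<integral>\<^sup>+n. emeasure \<Omega> {z. occ 0 x s y (push e n z) \<and> states_at x L (push e n z)} \<partial>\<kappa> \<partial>unit_exponential)"
      by (rule emeasure_first_step) measurable
    also have "\<dots> = (\<integral>\<^sup>+e. indicator {s / c x<..} e * ?H e \<partial>unit_exponential)"
      using True c_pos[of x] by (intro nn_integral_cong) (auto simp: field_simps split: split_indicator)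
    also have "\<dots> = ennreal (exp (- (s / c x))) * (\<integral>\<^sup>+e. ?H (s / c x + e) \<partial>unit_exponential)"
      using True c_pos[of x] by (intro nn_integral_unit_exponential_memoryless) (auto simp: less_imp_le)
    also have "(\<integral>\<^sup>+e. ?H (s / c x + e) \<partial>unit_exponential) = law x (shift_times s L)"
      unfolding law_first_step using True 0 by (simp add: states_at_push_wait)
    finally show ?thesis
      using True emeasure_occ_0[of s x] by simp
  next
    case False
    then show ?thesis by auto
  qed
next
  case (Suc k)
  let ?N = "\<lambda>e n. emeasure \<Omega> {z. c x * e \<le> s \<and> occ k (step x n) (s - c x * e) y z}"
  have "emeasure \<Omega> {z. occ (Suc k) x s y z \<and> states_at x L z} =
      (\<integral>\<^sup>+e. \<integral>\<^sup>+n. emeasure \<Omega> {z. occ (Suc k) x s y (push e n z) \<and> states_at x L (push e n z)} \<partial>\<kappa> \<partial>unit_exponential)"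
    by (rule emeasure_first_step) measurable
  also have "\<dots> = (\<integral>\<^sup>+e. \<integral>\<^sup>+n. ?N e n * law y (shift_times s L) \<partial>\<kappa> \<partial>unit_exponential)"
  proof (intro nn_integral_cong)
    fix e n
    show "emeasure \<Omega> {z. occ (Suc k) x s y (push e n z) \<and> states_at x L (push e n z)} =
      ?N e n * law y (shift_times s L)"
    proof (cases "c x * e \<le> s")
      case True
      then have le: "\<forall>(t, y)\<in>set L. c x * e \<le> t" using Suc.prems by fastforce
      have le': "\<forall>(t, y)\<in>set (shift_times (c x * e) L). s - c x * e \<le> t"
        using Suc.prems by (auto simp: set_shift_times)
      show ?thesis
        using True Suc.IH[OF le', of "step x n"]
        by (simp add: states_at_push[OF le] shift_times_shift_times)
    qed auto
  qed
  also have "\<dots> = (\<integral>\<^sup>+e. (\<integral>\<^sup>+n. ?N e n \<partial>\<kappa>) * law y (shift_times s L) \<partial>unit_exponential)"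
    by (intro nn_integral_cong nn_integral_multc) simp
  also have "\<dots> = (\<integral>\<^sup>+e. (\<integral>\<^sup>+n. ?N e n \<partial>\<kappa>) \<partial>unit_exponential) * law y (shift_times s L)"
  proof (rule nn_integral_multc)
    have "(\<lambda>e. \<integral>\<^sup>+n. emeasure \<Omega> {z. occ (Suc k) x s y (push e n z)} \<partial>\<kappa>) \<in> borel_measurable borel"
      by (rule measurable_first_step) measurable
    then show "(\<lambda>e. \<integral>\<^sup>+n. ?N e n \<partial>\<kappa>) \<in> borel_measurable unit_exponential"
      by simp
  qed
  also have "(\<integral>\<^sup>+e. (\<integral>\<^sup>+n. ?N e n \<partial>\<kappa>) \<partial>unit_exponential) = emeasure \<Omega> {z. occ (Suc k) x s y z}"
  proof -
    have "Measurable.pred \<Omega> (occ (Suc k) x s y)" by measurable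
    then show ?thesis
      by (simp only: emeasure_first_step occ_push_Suc)
  qed
  finally show ?case .
qed

lemma emeasure_state_at:
  assumes [measurable]: "Measurable.pred \<Omega> B"
  shows "emeasure \<Omega> {z. state_at x t y z \<and> B z} = (\<Sum>k. emeasure \<Omega> {z. occ k x t y z \<and> B z})"
proof -
  have "{z. state_at x t y z \<and> B z} = (\<Union>k. {z. occ k x t y z \<and> B z})"
    by (auto simp: state_at_def)
  moreover have "disjoint_family (\<lambda>k. {z. occ k x t y z \<and> B z})"
    using occ_unique by (fastforce simp: disjoint_family_on_def)
  moreover have "range (\<lambda>k. {z. occ k x t y z \<and> B z}) \<subseteq> sets \<Omega>"
    by (auto intro!: sets_Collect_\<Omega>)
  ultimately show ?thesis
    by (simp add: suminf_emeasure)
qed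

text \<open>The Markov property at time \<open>s\<close>, obtained from \<open>occ_markov\<close> by
  summing over the number of jumps made by then.\<close>

lemma law_Cons:
  assumes "\<forall>(t, y)\<in>set L. s \<le> t"
  shows "law x ((s, y) # L) = law x [(s, y)] * law y (shift_times s L)"
proof -
  have "law x ((s, y) # L) = (\<Sum>k. emeasure \<Omega> {z. occ k x s y z} * law y (shift_times s L))"
    by (simp add: law_def emeasure_state_at occ_markov[OF assms])
  also have "\<dots> = (\<Sum>k. emeasure \<Omega> {z. occ k x s y z}) * law y (shift_times s L)"
    by (rule ennreal_suminf_multc)
  also have "(\<Sum>k. emeasure \<Omega> {z. occ k x s y z}) = law x [(s, y)]"
    using emeasure_state_at[of "\<lambda>_. True" x s y] by (simp add: law_def)
  finally show ?thesis .
qed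

definition transition :: "real \<Rightarrow> 'x \<Rightarrow> 'x \<Rightarrow> real" where
  "transition h x y = measure \<Omega> {z. state_at x h y z}"

lemma law_single: "law x [(h, y)] = ennreal (transition h x y)"
  by (simp add: law_def transition_def EI.emeasure_eq_measure)

lemma transition_nonneg: "0 \<le> transition h x y"
  by (simp add: transition_def)

lemma AE_state_at_0: "AE z in \<Omega>. state_at x 0 x z"
proof -
  have "measure \<Omega> {z. occ 0 x 0 x z} = 1"
    using emeasure_occ_0[of 0 x] by (simp add: EI.emeasure_eq_measure)
  then have "AE z in \<Omega>. occ 0 x 0 x z"
    using EI.AE_prob_1[of "{z. occ 0 x 0 x z}"] by simp
  then show ?thesis
    unfolding state_at_def by eventually_elim blast
qed

lemma law_time_grid: "0 < h \<Longrightarrow> law x (time_grid h h ys) = ennreal (path_weight (transition h) x ys)"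
proof (induction ys arbitrary: x)
  case Nil
  then show ?case using EI.emeasure_space_1 by (simp add: law_def)
next
  case (Cons y ys)
  have "\<forall>(t, u)\<in>set (time_grid h (h + h) ys). h \<le> t"
    using Cons.prems by (auto simp: set_time_grid)
  then show ?case
    using Cons by (simp add: law_Cons shift_time_grid law_single ennreal_mult' transition_nonneg)
qed

lemma measure_skeleton:
  assumes "0 < h"
  shows "measure \<Omega> {z. \<forall>j\<le>length ys. state_at x (real j * h) ((x # ys) ! j) z} = path_weight (transition h) x ys"
proof -
  have "path_weight p x ys \<ge> 0" if "\<And>x y. 0 \<le> p x y" for p x and ys :: "'x list"
    using that by (induction ys arbitrary: x) auto
  note nn = this[of "transition h", OF transition_nonneg]
  have "measure \<Omega> {z. \<forall>j\<le>length ys. state_at x (real j * h) ((x # ys) ! j) z} =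
      measure \<Omega> {z. states_at x (time_grid h h ys) z}"
  proof (rule EI.finite_measure_eq_AE)
    show "AE z in \<Omega>. (z \<in> {z. \<forall>j\<le>length ys. state_at x (real j * h) ((x # ys) ! j) z}) =
        (z \<in> {z. states_at x (time_grid h h ys) z})"
      using AE_state_at_0[of x]
    proof eventually_elim
      case (elim z)
      have "(\<forall>j\<le>length ys. state_at x (real j * h) ((x # ys) ! j) z) \<longleftrightarrow>
          (\<forall>j<length ys. state_at x (h + real j * h) (ys ! j) z)" (is "?L = ?R")
      proof
        assume L: ?L
        show ?R
        proof (intro allI impI)
          fix j assume "j < length ys"
          then show "state_at x (h + real j * h) (ys ! j) z"
            using L[rule_format, of "Suc j"] by (simp add: algebra_simps)
        qed
      next
        assume R: ?R
        show ?L
        proof (intro allI impI)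
          fix j assume "j \<le> length ys"
          then show "state_at x (real j * h) ((x # ys) ! j) z"
            using R elim by (cases j) (auto simp: algebra_simps)
        qed
      qed
      then show ?case
        by (auto simp: states_at_def set_time_grid)
    qed
    show "{z. \<forall>j\<le>length ys. state_at x (real j * h) ((x # ys) ! j) z} \<in> sets \<Omega>"
      by (rule sets_Collect_\<Omega>) measurable
    show "{z. states_at x (time_grid h h ys) z} \<in> sets \<Omega>"
      by (rule sets_Collect_\<Omega>) measurable
  qed
  also have "\<dots> = path_weight (transition h) x ys"
    using law_time_grid[OF assms, of x ys] nn by (simp add: law_def EI.emeasure_eq_measure)
  finally show ?thesis .
qed

lemma state_at_unique: "state_at x t y z \<Longrightarrow> state_at x t y' z \<Longrightarrow> y = y'"
  unfolding state_at_def using occ_unique by blast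

lemma sum_transition_le_1:
  assumes "finite K"
  shows "(\<Sum>y\<in>K. transition h x y) \<le> 1"
proof -
  have "(\<Sum>y\<in>K. transition h x y) = measure \<Omega> (\<Union>y\<in>K. {z. state_at x h y z})"
    unfolding transition_def
    using assms state_at_unique by (intro EI.finite_measure_finite_Union[symmetric])
      (fastforce simp: disjoint_family_on_def intro!: sets_Collect_\<Omega>)+
  also have "\<dots> \<le> 1" by (rule EI.prob_le_1)
  finally show ?thesis .
qed
end

section \<open>Transition probabilities of the jump process for small times\<close>

lemma AE_unit_exponential_pos: "AE e in unit_exponential. 0 < e"
proof -
  have "AE e in lborel. 0 < ennreal (exponential_density 1 e) \<longrightarrow> 0 < e"
    using AE_lborel_singleton[of "0::real"]
    by eventually_elim (auto simp: exponential_density_def split: if_splits)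
  then show ?thesis
    by (simp add: AE_density)
qed

context jump_process begin

lemma AE_fst:
  assumes "AE s in E. A s"
  shows "AE z in \<Omega>. A (fst z)"
proof -
  obtain N where N: "\<And>s. s \<in> space E - N \<Longrightarrow> A s" "N \<in> null_sets E"
    using assms by (rule AE_E3) blast
  have "emeasure \<Omega> (N \<times> space I) = 0"
    using N(2) by (subst I.emeasure_pair_measure_Times) auto
  then have "N \<times> space I \<in> null_sets \<Omega>"
    using N(2) by (auto intro!: null_setsI)
  moreover have "{z \<in> space \<Omega>. \<not> A (fst z)} \<subseteq> N \<times> space I"
  proof
    fix z assume "z \<in> {z \<in> space \<Omega>. \<not> A (fst z)}"
    then show "z \<in> N \<times> space I"
      using N(1)[of "fst z"] by (cases z) (auto simp: space_stream_space)
  qed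
  ultimately show ?thesis
    by (rule AE_I')
qed

lemma AE_positive_holding: "AE z in \<Omega>. \<forall>j. 0 < fst z !! j"
proof -
  have "AE s in E. stream_all (\<lambda>e. 0 < e) s"
    by (rule prob_space.AE_stream_all[OF prob_space_unit_exponential]) (auto simp: AE_unit_exponential_pos)
  from AE_fst[OF this] show ?thesis
    by eventually_elim (auto simp: stream.pred_set)
qed

lemma occ_le_total: "emeasure \<Omega> {z. occ k x t y z} \<le> ennreal (transition t x y)"
proof -
  have "emeasure \<Omega> {z. occ k x t y z} \<le> emeasure \<Omega> {z. state_at x t y z}"
    by (intro emeasure_mono sets_Collect_\<Omega>) (auto simp: state_at_def)
  then show ?thesis
    by (simp add: transition_def EI.emeasure_eq_measure)
qed

text \<open>Being elsewhere at time \<open>t\<close> excludes the event of no jump, which has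
  probability \<open>exp (- t / c x)\<close>.\<close>

lemma transition_other_le:
  assumes "0 \<le> t" "x \<noteq> y"
  shows "transition t x y \<le> 1 - exp (- t / c x)"
proof -
  have m: "{z. occ 0 x t x z} \<in> sets \<Omega>" "{z. state_at x t y z} \<in> sets \<Omega>"
    by (auto intro!: sets_Collect_\<Omega>)
  have "{z. state_at x t y z} \<inter> {z. occ 0 x t x z} = {}"
    using state_at_unique assms(2) unfolding state_at_def by blast
  then have "measure \<Omega> {z. state_at x t y z} + measure \<Omega> {z. occ 0 x t x z} =
      measure \<Omega> ({z. state_at x t y z} \<union> {z. occ 0 x t x z})"
    using m by (intro EI.finite_measure_Union[symmetric]) auto
  also have "\<dots> \<le> 1" by (rule EI.prob_le_1)
  also have "measure \<Omega> {z. occ 0 x t x z} = exp (- t / c x)"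
    using emeasure_occ_0[OF assms(1), of x] by (simp add: EI.emeasure_eq_measure)
  finally show ?thesis by (simp add: transition_def)
qed

text \<open>The renewal equation for the first jump. The lower and the upper estimate of
  \<open>transition\<close> both come from bounding its integrand.\<close>

lemma transition_first_step:
  assumes "0 \<le> h"
  shows "ennreal (transition h x y) = ennreal (of_bool (y = x) * exp (- h / c x)) +
    (\<integral>\<^sup>+e. \<integral>\<^sup>+n. indicator {.. h / c x} e * ennreal (transition (h - c x * e) (step x n) y) \<partial>\<kappa> \<partial>unit_exponential)"
proof -
  let ?B = "\<lambda>z. c x * shd (fst z) \<le> h \<and> state_at (step x (shd (snd z))) (h - c x * shd (fst z)) y (stl (fst z), stl (snd z))"
  have m: "Measurable.pred \<Omega> (\<lambda>z. \<exists>k. occ (Suc k) x h y z)" "Measurable.pred \<Omega> (occ 0 x h y)"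
    by measurable
  have B: "?B z \<longleftrightarrow> (\<exists>k. occ (Suc k) x h y z)" for z
    by (simp add: state_at_def)
  have split: "{z. state_at x h y z} = {z. occ 0 x h y z} \<union> {z. \<exists>k. occ (Suc k) x h y z}"
  proof -
    have "(\<exists>k. P k) \<longleftrightarrow> P 0 \<or> (\<exists>k. P (Suc k))" for P :: "nat \<Rightarrow> bool"
      by (metis not0_implies_Suc)
    from this[of "\<lambda>k. occ k x h y z" for z] show ?thesis
      unfolding state_at_def by blast
  qed
  have "emeasure \<Omega> {z. state_at x h y z} = emeasure \<Omega> {z. occ 0 x h y z} + emeasure \<Omega> {z. \<exists>k. occ (Suc k) x h y z}"
    unfolding split using m by (intro plus_emeasure[symmetric] sets_Collect_\<Omega>) auto
  also have "emeasure \<Omega> {z. occ 0 x h y z} = ennreal (of_bool (y = x) * exp (- h / c x))"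
    using emeasure_occ_0[OF assms, of x] by (cases "y = x") auto
  also have "emeasure \<Omega> {z. \<exists>k. occ (Suc k) x h y z} =
    (\<integral>\<^sup>+e. \<integral>\<^sup>+n. emeasure \<Omega> {z. \<exists>k. occ (Suc k) x h y (push e n z)} \<partial>\<kappa> \<partial>unit_exponential)"
    by (rule emeasure_first_step) (rule m)
  also have "\<dots> = (\<integral>\<^sup>+e. \<integral>\<^sup>+n. indicator {.. h / c x} e * ennreal (transition (h - c x * e) (step x n) y) \<partial>\<kappa> \<partial>unit_exponential)"
  proof (intro nn_integral_cong)
    fix e n
    have "c x * e \<le> h \<longleftrightarrow> e \<le> h / c x"
      using c_pos[of x] by (simp add: field_simps)
    then show "emeasure \<Omega> {z. \<exists>k. occ (Suc k) x h y (push e n z)} =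
      indicator {.. h / c x} e * ennreal (transition (h - c x * e) (step x n) y)"
      by (simp add: transition_def EI.emeasure_eq_measure state_at_def[symmetric] split: split_indicator)
  qed
  finally show ?thesis
    by (simp add: transition_def EI.emeasure_eq_measure)
qed

text \<open>Besides the event of no jump, the paths are counted that jump to \<open>y\<close> before
  \<open>h\<close> and stay there. The stay lasts at most \<open>h\<close>, which gives the factor
  \<open>exp (- h / c y)\<close> whatever the time of the jump.\<close>

lemma transition_lower:
  assumes h: "0 \<le> h"
  shows "of_bool (y = x) * exp (- h / c x) + (1 - exp (- h / c x)) * exp (- h / c y) * measure \<kappa> {n. step x n = y}
    \<le> transition h x y"
proof -
  let ?a = "h / c x" and ?q = "measure \<kappa> {n. step x n = y}"
  have a: "0 \<le> ?a" using h c_pos[of x] by simp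
  have "ennreal ((1 - exp (- ?a)) * exp (- h / c y) * ?q) =
      emeasure unit_exponential {..?a} * (ennreal (exp (- h / c y)) * emeasure \<kappa> {n. step x n = y})"
    using a by (simp add: emeasure_unit_exponential_atMost ennreal_mult' ennreal_mult'' measure_pmf.emeasure_eq_measure mult.assoc)
  also have "\<dots> = (\<integral>\<^sup>+e. \<integral>\<^sup>+n. indicator {.. ?a} e * (ennreal (exp (- h / c y)) * indicator {n. step x n = y} n) \<partial>\<kappa> \<partial>unit_exponential)"
    by (simp add: nn_integral_cmult nn_integral_multc)
  also have "\<dots> \<le> (\<integral>\<^sup>+e. \<integral>\<^sup>+n. indicator {.. ?a} e * ennreal (transition (h - c x * e) (step x n) y) \<partial>\<kappa> \<partial>unit_exponential)"
  proof (rule nn_integral_mono_AE, use AE_unit_exponential_pos in eventually_elim)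
    fix e :: real assume e: "0 < e"
    show "(\<integral>\<^sup>+n. indicator {.. ?a} e * (ennreal (exp (- h / c y)) * indicator {n. step x n = y} n) \<partial>\<kappa>) \<le>
      (\<integral>\<^sup>+n. indicator {.. ?a} e * ennreal (transition (h - c x * e) (step x n) y) \<partial>\<kappa>)"
    proof (intro nn_integral_mono)
      fix n
      show "indicator {.. ?a} e * (ennreal (exp (- h / c y)) * indicator {n. step x n = y} n) \<le>
        indicator {.. ?a} e * ennreal (transition (h - c x * e) (step x n) y)"
      proof (cases "step x n = y \<and> e \<le> ?a")
        case True
        then have le: "0 \<le> h - c x * e" using c_pos[of x] by (simp add: field_simps)
        have "exp (- h / c y) \<le> exp (- (h - c x * e) / c y)"
          using c_pos[of x] c_pos[of y] e by (simp add: divide_simps)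
        then have "ennreal (exp (- h / c y)) \<le> ennreal (exp (- (h - c x * e) / c y))"
          by (rule ennreal_leI)
        also have "\<dots> \<le> ennreal (transition (h - c x * e) y y)"
          using occ_le_total[of 0 y "h - c x * e" y] emeasure_occ_0[OF le, of y] by simp
        finally show ?thesis
          using True by simp
      qed (auto simp: not_le)
    qed
  qed
  finally have "ennreal (of_bool (y = x) * exp (- h / c x)) + ennreal ((1 - exp (- ?a)) * exp (- h / c y) * ?q) \<le> ennreal (transition h x y)"
    unfolding transition_first_step[OF h] by (intro add_left_mono)
  then have "ennreal (of_bool (y = x) * exp (- h / c x) + (1 - exp (- ?a)) * exp (- h / c y) * ?q) \<le> ennreal (transition h x y)"
    using a by (subst ennreal_plus) auto
  then show ?thesis
    by (simp add: ennreal_le_iff transition_nonneg)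
qed

text \<open>The mean probability that the state entered by the first jump is left again within time
  \<open>h\<close>. An average is taken because the rates \<open>1 / c\<close> need not be bounded
  over the possible targets.\<close>

definition escape_bound :: "'x \<Rightarrow> real \<Rightarrow> real" where
  "escape_bound x h = (\<integral>n. 1 - exp (- h / c (step x n)) \<partial>\<kappa>)"

text \<open>After a first jump the process can be at \<open>y\<close> at time \<open>h\<close> only
  if this jump led to \<open>y\<close> or another one follows before \<open>h\<close>;
  \<open>escape_bound\<close> controls the second case.\<close>

lemma transition_upper:
  assumes h: "0 \<le> h"
  shows "transition h x y \<le> of_bool (y = x) * exp (- h / c x) +
    (1 - exp (- h / c x)) * (measure \<kappa> {n. step x n = y} + escape_bound x h)"
proof -
  let ?a = "h / c x" and ?q = "measure \<kappa> {n. step x n = y}"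
  let ?g = "\<lambda>n. 1 - exp (- h / c (step x n))"
  have a: "0 \<le> ?a" using h c_pos[of x] by simp
  have g: "0 \<le> ?g n" "?g n \<le> 1" for n
    using h c_pos[of "step x n"] by auto
  have eb: "ennreal (escape_bound x h) = (\<integral>\<^sup>+n. ennreal (?g n) \<partial>\<kappa>)" "0 \<le> escape_bound x h"
    unfolding escape_bound_def using g
    by (auto intro!: nn_integral_eq_integral[symmetric] measure_pmf.integrable_const_bound[where B=1])
  have "(\<integral>\<^sup>+e. \<integral>\<^sup>+n. indicator {.. ?a} e * ennreal (transition (h - c x * e) (step x n) y) \<partial>\<kappa> \<partial>unit_exponential) \<le>
    (\<integral>\<^sup>+e. \<integral>\<^sup>+n. indicator {.. ?a} e * (indicator {n. step x n = y} n + ennreal (?g n)) \<partial>\<kappa> \<partial>unit_exponential)"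
  proof (rule nn_integral_mono_AE, use AE_unit_exponential_pos in eventually_elim)
    fix e :: real assume e: "0 < e"
    show "(\<integral>\<^sup>+n. indicator {.. ?a} e * ennreal (transition (h - c x * e) (step x n) y) \<partial>\<kappa>) \<le>
      (\<integral>\<^sup>+n. indicator {.. ?a} e * (indicator {n. step x n = y} n + ennreal (?g n)) \<partial>\<kappa>)"
    proof (intro nn_integral_mono)
      fix n
      consider "\<not> e \<le> ?a" | "step x n = y" | "e \<le> ?a" "step x n \<noteq> y" by blast
      then show "indicator {.. ?a} e * ennreal (transition (h - c x * e) (step x n) y) \<le>
        indicator {.. ?a} e * (indicator {n. step x n = y} n + ennreal (?g n))"
      proof cases
        case 2
        have "ennreal (transition (h - c x * e) (step x n) y) \<le> 1"
          unfolding transition_def using EI.prob_le_1 by (simp add: ennreal_le_1)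
        also have "\<dots> \<le> 1 + ennreal (?g n)" by simp
        finally show ?thesis using 2 by (auto intro: mult_left_mono)
      next
        case 3
        then have le: "0 \<le> h - c x * e" using c_pos[of x] by (simp add: field_simps)
        have "transition (h - c x * e) (step x n) y \<le> 1 - exp (- (h - c x * e) / c (step x n))"
          using transition_other_le[OF le 3(2)] .
        also have "\<dots> \<le> ?g n"
          using c_pos[of x] c_pos[of "step x n"] e by (simp add: divide_simps)
        finally show ?thesis using 3 by (auto intro: ennreal_leI)
      qed auto
    qed
  qed
  also have "\<dots> = emeasure unit_exponential {..?a} * (emeasure \<kappa> {n. step x n = y} + ennreal (escape_bound x h))"
    by (simp add: nn_integral_cmult nn_integral_multc nn_integral_add eb(1))
  also have "\<dots> = ennreal ((1 - exp (- ?a)) * (?q + escape_bound x h))"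
    using a eb(2) by (simp add: emeasure_unit_exponential_atMost ennreal_mult' measure_pmf.emeasure_eq_measure ennreal_plus)
  finally have "ennreal (transition h x y) \<le>
    ennreal (of_bool (y = x) * exp (- h / c x)) + ennreal ((1 - exp (- ?a)) * (?q + escape_bound x h))"
    unfolding transition_first_step[OF h] by (intro add_left_mono)
  also have "\<dots> = ennreal (of_bool (y = x) * exp (- h / c x) + (1 - exp (- ?a)) * (?q + escape_bound x h))"
    using a eb(2) by (intro ennreal_plus[symmetric]) auto
  finally show ?thesis
    using a eb(2) by (subst (asm) ennreal_le_iff) auto
qed

text \<open>Dominated convergence with bound 1: each integrand tends to 0, at a speed that depends
  on the innovation. Writing \<open>inverse u\<close> for \<open>h\<close> turns the one-sided limit
  into a limit at infinity.\<close>

lemma escape_bound_tendsto: "(escape_bound x \<longlongrightarrow> 0) (at_right 0)"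
  unfolding filterlim_at_right_to_top
proof -
  have "((\<lambda>u. \<integral>n. 1 - exp (- inverse u / c (step x n)) \<partial>\<kappa>) \<longlongrightarrow> (\<integral>n. 0 \<partial>\<kappa>)) at_top"
  proof (rule integral_dominated_convergence_at_top[where w="\<lambda>_. 1"])
    have "((\<lambda>u. 1 - exp (- inverse u / c (step x n))) \<longlongrightarrow> 1 - exp (- 0 / c (step x n))) at_top" for n
      using c_pos[of "step x n"] by (intro tendsto_intros tendsto_inverse_0_at_top filterlim_ident) auto
    then show "AE n in \<kappa>. ((\<lambda>u. 1 - exp (- inverse u / c (step x n))) \<longlongrightarrow> 0) at_top"
      by simp
    show "\<forall>\<^sub>F u in at_top. AE n in \<kappa>. norm (1 - exp (- inverse u / c (step x n))) \<le> (1::real)"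
      using eventually_gt_at_top[of 0]
    proof eventually_elim
      case (elim u)
      have "0 \<le> inverse u / c (step x n)" for n
        using elim c_pos[of "step x n"] by simp
      then show ?case by simp
    qed
  qed auto
  then show "((\<lambda>u. escape_bound x (inverse u)) \<longlongrightarrow> 0) at_top"
    by (simp add: escape_bound_def)
qed

text \<open>The two estimates have the same slope at 0: a jump before \<open>h\<close> has
  probability \<open>h / c x\<close> up to o(h), and what happens after it enters only through
  \<open>exp (- h / c y)\<close> and \<open>escape_bound\<close>, which tend to 1 and 0.\<close>

lemma transition_derivative:
  "((\<lambda>h. (transition h x y - of_bool (y = x)) / h) \<longlongrightarrow>
     (measure \<kappa> {n. step x n = y} - of_bool (y = x)) / c x) (at_right 0)"
proof -
  let ?q = "measure \<kappa> {n. step x n = y}" and ?d = "of_bool (y = x) :: real"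
  let ?a = "\<lambda>h. (1 - exp (- h / c x)) / h"
  have "((\<lambda>h. 1 - exp (- h / c x)) has_real_derivative exp (- 0 / c x) / c x) (at 0)"
    using c_pos[of x] by (auto intro!: derivative_eq_intros)
  then have "((\<lambda>h. 1 - exp (- h / c x)) has_real_derivative 1 / c x) (at 0 within {0<..})"
    by (simp add: has_field_derivative_at_within)
  then have a: "(?a \<longlongrightarrow> 1 / c x) (at_right 0)"
    by (simp add: has_field_derivative_iff)
  have "((\<lambda>h. - ?d * ?a h + ?a h * exp (- h / c y) * ?q) \<longlongrightarrow> - ?d * (1 / c x) + (1 / c x) * exp (- 0 / c y) * ?q) (at_right 0)"
    using c_pos[of y] by (intro tendsto_intros a) auto
  then have lower: "((\<lambda>h. - ?d * ?a h + ?a h * exp (- h / c y) * ?q) \<longlongrightarrow> (?q - ?d) / c x) (at_right 0)"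
    by (simp add: diff_divide_distrib)
  have "((\<lambda>h. - ?d * ?a h + ?a h * (?q + escape_bound x h)) \<longlongrightarrow> - ?d * (1 / c x) + (1 / c x) * (?q + 0)) (at_right 0)"
    by (intro tendsto_intros a escape_bound_tendsto)
  then have upper: "((\<lambda>h. - ?d * ?a h + ?a h * (?q + escape_bound x h)) \<longlongrightarrow> (?q - ?d) / c x) (at_right 0)"
    by (simp add: diff_divide_distrib)
  show ?thesis
  proof (rule tendsto_sandwich[OF _ _ lower upper])
    show "\<forall>\<^sub>F h in at_right 0. - ?d * ?a h + ?a h * exp (- h / c y) * ?q \<le> (transition h x y - ?d) / h"
      using eventually_at_right_less[of "0::real"]
    proof eventually_elim
      case (elim h)
      have "- ?d * ?a h + ?a h * exp (- h / c y) * ?q =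
        (?d * exp (- h / c x) + (1 - exp (- h / c x)) * exp (- h / c y) * ?q - ?d) / h"
        using elim by (simp add: field_simps)
      also have "\<dots> \<le> (transition h x y - ?d) / h"
        using elim transition_lower[of h y x] by (intro divide_right_mono) auto
      finally show ?case .
    qed
    show "\<forall>\<^sub>F h in at_right 0. (transition h x y - ?d) / h \<le> - ?d * ?a h + ?a h * (?q + escape_bound x h)"
      using eventually_at_right_less[of "0::real"]
    proof eventually_elim
      case (elim h)
      have "(transition h x y - ?d) / h \<le>
        (?d * exp (- h / c x) + (1 - exp (- h / c x)) * (?q + escape_bound x h) - ?d) / h"
        using elim transition_upper[of h x y] by (intro divide_right_mono) auto
      also have "\<dots> = - ?d * ?a h + ?a h * (?q + escape_bound x h)"
        using elim by (simp add: field_simps)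
      finally show ?case .
    qed
  qed
qed

section \<open>The jump process in terms of its jump chain and its jump times\<close>

primrec chain :: "'x \<Rightarrow> nat stream \<Rightarrow> nat \<Rightarrow> 'x" where
  "chain x u 0 = x"
| "chain x u (Suc k) = chain (step x (shd u)) (stl u) k"

end

definition arrival :: "real stream \<Rightarrow> nat \<Rightarrow> real" where
  "arrival s k = (\<Sum>j<k. s !! j)"

text \<open>The time of the \<open>k\<close>-th jump after the time change, for a walk that sits at
  \<open>\<rho> j\<close> between the original jump times \<open>\<tau> j\<close> and
  \<open>\<tau> (Suc j)\<close>.\<close>

definition changed_clock :: "('x \<Rightarrow> real) \<Rightarrow> (nat \<Rightarrow> 'x) \<Rightarrow> (nat \<Rightarrow> real) \<Rightarrow> nat \<Rightarrow> real" where
  "changed_clock c \<rho> \<tau> k = (\<Sum>j<k. c (\<rho> j) * (\<tau> (Suc j) - \<tau> j))"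

text \<open>A predicate of deterministic paths, so that it applies both to the exponential model,
  with \<open>arrival\<close>, and to jump times read off from a given Poisson process.\<close>

definition occupies :: "('x \<Rightarrow> real) \<Rightarrow> (nat \<Rightarrow> 'x) \<Rightarrow> (nat \<Rightarrow> real) \<Rightarrow> real \<Rightarrow> 'x \<Rightarrow> bool" where
  "occupies c \<rho> \<tau> t y \<longleftrightarrow>
     (\<exists>k. changed_clock c \<rho> \<tau> k \<le> t \<and> t < changed_clock c \<rho> \<tau> (Suc k) \<and> \<rho> k = y)"

lemma (in jump_process) occ_iff:
  assumes "\<And>j. 0 \<le> s !! j"
  shows "occ k x t y (s, u) \<longleftrightarrow>
    changed_clock c (chain x u) (arrival s) k \<le> t \<and> t < changed_clock c (chain x u) (arrival s) (Suc k) \<and>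
    chain x u k = y"
  using assms
proof (induction k arbitrary: x t s u)
  case 0
  then show ?case by (auto simp: changed_clock_def arrival_def)
next
  case (Suc k)
  have pos: "\<And>j. 0 \<le> stl s !! j"
    using Suc.prems by (metis snth.simps(2))
  have step: "changed_clock c (chain x u) (arrival s) (Suc k) =
      c x * shd s + changed_clock c (chain (step x (shd u)) (stl u)) (arrival (stl s)) k" for k
    unfolding changed_clock_def by (subst sum.lessThan_Suc_shift) (simp add: arrival_def)
  have "0 \<le> changed_clock c (chain (step x (shd u)) (stl u)) (arrival (stl s)) k"
    unfolding changed_clock_def using pos c_pos by (intro sum_nonneg mult_nonneg_nonneg) (auto simp: arrival_def less_imp_le)
  then show ?case
    unfolding occ.simps step fst_conv snd_conv Suc.IH[OF pos] by auto
qed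

lemma (in jump_process) state_at_iff_occupies:
  assumes "\<And>j. 0 \<le> s !! j"
  shows "state_at x t y (s, u) \<longleftrightarrow> occupies c (chain x u) (arrival s) t y"
  unfolding state_at_def occupies_def using occ_iff[OF assms] by blast


section \<open>Poisson counts from unit exponential holding times\<close>

locale counting_process =
  fixes \<kappa> :: "nat pmf"
begin

sublocale jump_process "\<lambda>_::nat. 1" "\<lambda>k _. Suc k" \<kappa>
  by standard simp

lemma occ_state: "occ j k t l z \<Longrightarrow> l = k + j"
proof (induction j arbitrary: k t z)
  case (Suc j)
  then show ?case
    using Suc.IH[of "Suc k" "t - shd (fst z)" "(stl (fst z), stl (snd z))"] by simp
qed simp

text \<open>Conditioned on the first jump at \<open>e\<close>, the density \<open>exp (- e)\<close>
  and the factor \<open>exp (e - t)\<close> from the induction combine to \<open>exp (- t)\<close>;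
  what is left to integrate is a multiple of \<open>(t - e) ^ j\<close> over
  \<open>[0, t]\<close>.\<close>

lemma emeasure_occ:
  assumes "0 \<le> t"
  shows "emeasure \<Omega> {z. occ j k t (k + j) z} = ennreal (exp (- t) * t ^ j / fact j)"
  using assms
proof (induction j arbitrary: k t)
  case 0
  then show ?case using emeasure_occ_0[of t k] by simp
next
  case (Suc j)
  have "emeasure \<Omega> {z. occ (Suc j) k t (k + Suc j) z} =
    (\<integral>\<^sup>+e. \<integral>\<^sup>+n. emeasure \<Omega> {z. occ (Suc j) k t (k + Suc j) (push e n z)} \<partial>\<kappa> \<partial>unit_exponential)"
    by (rule emeasure_first_step) measurable
  also have "\<dots> = (\<integral>\<^sup>+e. ennreal (exp (e - t) * (t - e) ^ j / fact j) * indicator {..t} e \<partial>unit_exponential)"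
  proof (intro nn_integral_cong)
    fix e
    show "(\<integral>\<^sup>+n. emeasure \<Omega> {z. occ (Suc j) k t (k + Suc j) (push e n z)} \<partial>\<kappa>) =
      ennreal (exp (e - t) * (t - e) ^ j / fact j) * indicator {..t} e"
      using Suc.IH[of "t - e" "Suc k"] by (cases "e \<le> t") (simp_all add: measure_pmf.emeasure_space_1[simplified])
  qed
  also have "\<dots> = (\<integral>\<^sup>+e. ennreal (exp (- t) * (t - e) ^ j / fact j) * indicator {0..t} e \<partial>lborel)"
  proof (subst nn_integral_unit_exponential)
    show "(\<integral>\<^sup>+e. ennreal (exponential_density 1 e) * (ennreal (exp (e - t) * (t - e) ^ j / fact j) * indicator {..t} e) \<partial>lborel) =
      (\<integral>\<^sup>+e. ennreal (exp (- t) * (t - e) ^ j / fact j) * indicator {0..t} e \<partial>lborel)"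
    proof (intro nn_integral_cong)
      fix e :: real
      show "ennreal (exponential_density 1 e) * (ennreal (exp (e - t) * (t - e) ^ j / fact j) * indicator {..t} e) =
        ennreal (exp (- t) * (t - e) ^ j / fact j) * indicator {0..t} e"
        by (auto simp: exponential_density_def ennreal_mult[symmetric] exp_add[symmetric] mult.assoc[symmetric] split: split_indicator)
    qed
  qed auto
  also have "\<dots> = ennreal (- (exp (- t) * (t - t) ^ Suc j / fact (Suc j)) - (- (exp (- t) * (t - 0) ^ Suc j / fact (Suc j))))"
  proof (rule nn_integral_FTC_Icc[where F="\<lambda>e. - (exp (- t) * (t - e) ^ Suc j / fact (Suc j))"])
    fix e :: real assume e: "e \<in> {0..t}"
    have "((\<lambda>e. - (exp (- t) * (t - e) ^ Suc j / fact (Suc j))) has_real_derivative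
      exp (- t) * (real (Suc j) * (t - e) ^ j) / fact (Suc j)) (at e)"
      by (rule derivative_eq_intros refl | simp del: power_Suc fact_Suc)+
    also have "exp (- t) * (real (Suc j) * (t - e) ^ j) / fact (Suc j) = exp (- t) * (t - e) ^ j / fact j"
      by (simp del: of_nat_Suc)
    finally show "((\<lambda>e. - (exp (- t) * (t - e) ^ Suc j / fact (Suc j))) has_real_derivative
      exp (- t) * (t - e) ^ j / fact j) (at e)" .
    show "0 \<le> exp (- t) * (t - e) ^ j / fact j" using e by simp
  qed (use Suc.prems in auto)
  finally show ?case by simp
qed

lemma transition_eq_poisson:
  assumes "0 < t"
  shows "transition t k l = (if k \<le> l then pmf (poisson_pmf t) (l - k) else 0)"
proof (cases "k \<le> l")
  case True
  then obtain j where j: "l = k + j" using le_Suc_ex by blast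
  have "{z. state_at k t l z} = {z. occ j k t (k + j) z}"
    unfolding state_at_def j using occ_state by fastforce
  then show ?thesis
    using emeasure_occ[of t j k] assms j
    by (simp add: transition_def EI.emeasure_eq_measure field_simps)
next
  case False
  then have "{z. state_at k t l z} = {}"
    unfolding state_at_def using occ_state by fastforce
  then show ?thesis using False unfolding transition_def by (simp only: measure_empty if_False)
qed

text \<open>Constant holding rates do not explode: the Poisson weights sum to 1, so at each positive
  integer time some count is attained.\<close>

lemma AE_state_exists: "AE z in \<Omega>. \<forall>n::nat. \<exists>k. state_at 0 (real (Suc n)) k z"
proof (subst AE_all_countable, intro allI)
  fix n :: nat
  let ?t = "real (Suc n)"
  have "emeasure \<Omega> {z. \<exists>k. state_at 0 ?t k z} = (\<Sum>k. emeasure \<Omega> {z. state_at 0 ?t k z})"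
  proof -
    have "{z. \<exists>k. state_at 0 ?t k z} = (\<Union>k. {z. state_at 0 ?t k z})" by auto
    moreover have "disjoint_family (\<lambda>k. {z. state_at 0 ?t k z})"
      using state_at_unique by (fastforce simp: disjoint_family_on_def)
    moreover have "range (\<lambda>k. {z. state_at 0 ?t k z}) \<subseteq> sets \<Omega>"
      by (auto intro!: sets_Collect_\<Omega>)
    ultimately show ?thesis by (simp add: suminf_emeasure)
  qed
  also have "\<dots> = (\<Sum>k. ennreal (pmf (poisson_pmf ?t) k))"
    using transition_eq_poisson[of ?t 0] by (simp add: transition_def EI.emeasure_eq_measure)
  also have "\<dots> = 1"
    using measure_pmf.emeasure_space_1[of "poisson_pmf ?t"]
    by (simp only: nn_integral_count_space_nat[symmetric] nn_integral_pmf space_measure_pmf)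
  finally have "measure \<Omega> {z. \<exists>k. state_at 0 ?t k z} = 1"
    by (simp add: EI.emeasure_eq_measure)
  then show "AE z in \<Omega>. \<exists>k. state_at 0 ?t k z"
    using EI.AE_prob_1[of "{z. \<exists>k. state_at 0 ?t k z}"] by simp
qed

lemma state_at_iff_arrival:
  assumes "\<And>j. 0 \<le> s !! j"
  shows "state_at 0 t k (s, u) \<longleftrightarrow> arrival s k \<le> t \<and> t < arrival s (Suc k)"
proof -
  have chain: "chain l u j = l + j" for l j
    by (induction j arbitrary: l u) auto
  have "changed_clock (\<lambda>_. 1) \<rho> (arrival s) j = arrival s j" for \<rho> :: "nat \<Rightarrow> nat" and j
    by (simp add: changed_clock_def arrival_def)
  then show ?thesis
    using state_at_iff_occupies[OF assms, of 0 t k u] by (simp add: occupies_def chain)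
qed

end

section \<open>Recovering the jump times of a Poisson process\<close>

lemma path_weight_eq_prod: "path_weight p x ys = (\<Prod>j<length ys. p ((x # ys) ! j) (ys ! j))"
proof (induction ys arbitrary: x)
  case (Cons y ys)
  show ?case
    by (simp add: Cons.IH prod.lessThan_Suc_shift del: prod.lessThan_Suc)
qed simp

section \<open>Laws of streams of discrete values\<close>

abbreviation discrete_streams :: "'c stream measure" where
  "discrete_streams \<equiv> stream_space (count_space UNIV)"

lemma measurable_to_stream_discrete:
  assumes "\<And>n. X n \<in> M \<rightarrow>\<^sub>M count_space UNIV"
  shows "(\<lambda>w. to_stream (\<lambda>n. X n w)) \<in> M \<rightarrow>\<^sub>M discrete_streams"
  by (rule measurable_stream_space2) (simp add: to_stream_def assms)

text \<open>The values have an arbitrary type but lie almost surely in the countable set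
  \<open>C\<close>; over \<open>C\<close> the sets of streams with a given initial segment determine
  a law.\<close>

lemma distr_to_stream_eqI:
  fixes X1 :: "nat \<Rightarrow> 'v \<Rightarrow> 'c" and X2 :: "nat \<Rightarrow> 'w \<Rightarrow> 'c"
  assumes M: "prob_space M1" "prob_space M2" and C: "countable C"
    and X1: "\<And>n. X1 n \<in> M1 \<rightarrow>\<^sub>M count_space UNIV" "AE w in M1. \<forall>n. X1 n w \<in> C"
    and X2: "\<And>n. X2 n \<in> M2 \<rightarrow>\<^sub>M count_space UNIV" "AE w in M2. \<forall>n. X2 n w \<in> C"
    and eq: "\<And>xs. xs \<noteq> [] \<Longrightarrow> set xs \<subseteq> C \<Longrightarrow> measure M1 {w \<in> space M1. \<forall>i<length xs. X1 i w = xs ! i} =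
      measure M2 {w \<in> space M2. \<forall>i<length xs. X2 i w = xs ! i}"
  shows "distr M1 discrete_streams (\<lambda>w. to_stream (\<lambda>n. X1 n w)) =
    distr M2 discrete_streams (\<lambda>w. to_stream (\<lambda>n. X2 n w))"
proof -
  interpret M1: prob_space M1 by fact
  interpret M2: prob_space M2 by fact
  note m1 = measurable_to_stream_discrete[OF X1(1)] and m2 = measurable_to_stream_discrete[OF X2(1)]
  have start: "measure M {w \<in> space M. \<forall>i<length xs. X i w = xs ! i} =
      measure (distr M discrete_streams (\<lambda>w. to_stream (\<lambda>n. X n w))) (sstart C xs)"
    if "prob_space M" "(\<lambda>w. to_stream (\<lambda>n. X n w)) \<in> M \<rightarrow>\<^sub>M discrete_streams" "AE w in M. \<forall>n. X n w \<in> C"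
      and X: "\<And>n. X n \<in> M \<rightarrow>\<^sub>M count_space UNIV"
    for M :: "'z measure" and X :: "nat \<Rightarrow> 'z \<Rightarrow> 'c" and xs
  proof -
    interpret prob_space M by fact
    note [measurable] = X
    have "measure M {w \<in> space M. \<forall>i<length xs. X i w = xs ! i} =
      measure M ((\<lambda>w. to_stream (\<lambda>n. X n w)) -` sstart C xs \<inter> space M)"
    proof (rule finite_measure_eq_AE)
      show "AE w in M. (w \<in> {w \<in> space M. \<forall>i<length xs. X i w = xs ! i}) =
          (w \<in> (\<lambda>w. to_stream (\<lambda>n. X n w)) -` sstart C xs \<inter> space M)"
        using that(3)
      proof eventually_elim
        case (elim w)
        then have "to_stream (\<lambda>n. X n w) \<in> streams C"
          by (simp add: to_stream_in_streams)
        from sstart_eq[OF this, of xs] show ?case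
          by (auto simp: to_stream_def)
      qed
      show "(\<lambda>w. to_stream (\<lambda>n. X n w)) -` sstart C xs \<inter> space M \<in> sets M"
        using that(2) by (rule measurable_sets) (rule sets_sstart)
    qed measurable
    then show ?thesis
      by (simp add: measure_distr[OF that(2) sets_sstart])
  qed
  have AE: "AE s in distr M discrete_streams (\<lambda>w. to_stream (\<lambda>n. X n w)). s \<in> streams C"
    if "(\<lambda>w. to_stream (\<lambda>n. X n w)) \<in> M \<rightarrow>\<^sub>M discrete_streams" "AE w in M. \<forall>n. X n w \<in> C"
    for M :: "'z measure" and X :: "nat \<Rightarrow> 'z \<Rightarrow> 'c"
  proof (subst AE_distr_iff[OF that(1)])
    have "streams C \<in> sets discrete_streams" by (rule streams_sets) simp
    then show "{s \<in> space discrete_streams. s \<in> streams C} \<in> sets discrete_streams"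
      by (simp add: space_stream_space Int_def[symmetric])
    show "AE w in M. to_stream (\<lambda>n. X n w) \<in> streams C"
      using that(2) by (simp add: to_stream_in_streams)
  qed
  show ?thesis
  proof (rule stream_space_eq_sstart[OF C])
    show p1: "prob_space (distr M1 discrete_streams (\<lambda>w. to_stream (\<lambda>n. X1 n w)))"
      using m1 by (rule M1.prob_space_distr)
    show p2: "prob_space (distr M2 discrete_streams (\<lambda>w. to_stream (\<lambda>n. X2 n w)))"
      using m2 by (rule M2.prob_space_distr)
    fix xs assume "xs \<noteq> []" "xs \<in> lists C"
    then have "measure (distr M1 discrete_streams (\<lambda>w. to_stream (\<lambda>n. X1 n w))) (sstart C xs) =
        measure (distr M2 discrete_streams (\<lambda>w. to_stream (\<lambda>n. X2 n w))) (sstart C xs)"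
      using eq[of xs] start[OF M(1) m1 X1(2,1)] start[OF M(2) m2 X2(2,1)] by (auto simp: in_lists_conv_set)
    then show "emeasure (distr M1 discrete_streams (\<lambda>w. to_stream (\<lambda>n. X1 n w))) (sstart C xs) =
        emeasure (distr M2 discrete_streams (\<lambda>w. to_stream (\<lambda>n. X2 n w))) (sstart C xs)"
      using p1 p2 by (simp add: finite_measure.emeasure_eq_measure prob_space_def)
  qed (use AE[OF m1 X1(2)] AE[OF m2 X2(2)] in auto)
qed

text \<open>Every nonnegative dyadic time is enumerated, with repetitions, so that the values of a
  path at all of them form a single stream.\<close>

definition dyadic :: "nat \<Rightarrow> real" where
  "dyadic n = real (fst (prod_decode n)) / 2 ^ snd (prod_decode n)"

lemma dyadic_nonneg: "0 \<le> dyadic n"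
  by (simp add: dyadic_def)

lemma dyadic_eq: "real j / 2 ^ m = dyadic (prod_encode (j, m))"
  by (simp add: dyadic_def)

lemma dyadic_between:
  assumes "0 \<le> a" "a < b"
  shows "\<exists>n. a < dyadic n \<and> dyadic n < b"
proof -
  obtain m where m: "(1/2::real) ^ m < b - a"
    using assms real_arch_pow_inv[of "b - a" "1/2"] by auto
  \<comment> \<open>Rounding \<open>c\<close> up to the grid moves it by less than
    \<open>1 / 2 ^ m\<close>, so the result stays below \<open>b\<close>.\<close>
  define c where "c = b - 1 / 2 ^ m"
  have c: "a < c" using m by (simp add: c_def power_one_over)
  then have c0: "0 \<le> c" using assms by simp
  show ?thesis
    using dyadic_ceiling_bounds[OF c0, of m] c
    by (intro exI[of _ "prod_encode (dyadic_ceiling m c, m)"]) (simp add: c_def flip: dyadic_eq)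
qed

lemma dyadic_common_level: "\<exists>m J. \<forall>i<(n::nat). dyadic i = real (J i) / 2 ^ m"
proof -
  define m where "m = Max (insert 0 ((\<lambda>i. snd (prod_decode i)) ` {..<n}))"
  have le: "snd (prod_decode i) \<le> m" if "i < n" for i
    unfolding m_def using that by (intro Max_ge) auto
  have "dyadic i = real (fst (prod_decode i) * 2 ^ (m - snd (prod_decode i))) / 2 ^ m" if "i < n" for i
    using le[OF that] by (simp add: dyadic_def field_simps flip: power_add)
  then show ?thesis
    by (intro exI[of _ m] exI[of _ "\<lambda>i. fst (prod_decode i) * 2 ^ (m - snd (prod_decode i))"]) blast
qed

text \<open>Any finite number of the enumerated dyadic times lie on a common grid, and the law on
  each grid is known by hypothesis.\<close>

lemma distr_dyadic_stream_eqI: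
  fixes N1 :: "real \<Rightarrow> 'v \<Rightarrow> nat" and N2 :: "real \<Rightarrow> 'w \<Rightarrow> nat"
  assumes M: "prob_space M1" "prob_space M2"
    and N1: "\<And>t. 0 \<le> t \<Longrightarrow> N1 t \<in> M1 \<rightarrow>\<^sub>M count_space UNIV"
    and N2: "\<And>t. 0 \<le> t \<Longrightarrow> N2 t \<in> M2 \<rightarrow>\<^sub>M count_space UNIV"
    and eq: "\<And>m ks. ks \<noteq> [] \<Longrightarrow> measure M1 {w \<in> space M1. \<forall>i<length ks. N1 (real i / 2 ^ m) w = ks ! i} =
      measure M2 {w \<in> space M2. \<forall>i<length ks. N2 (real i / 2 ^ m) w = ks ! i}"
  shows "distr M1 discrete_streams (\<lambda>w. to_stream (\<lambda>n. N1 (dyadic n) w)) =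
    distr M2 discrete_streams (\<lambda>w. to_stream (\<lambda>n. N2 (dyadic n) w))"
proof (rule distr_to_stream_eqI[OF M, of UNIV])
  fix xs :: "nat list"
  obtain m J where mJ: "\<And>i. i < length xs \<Longrightarrow> dyadic i = real (J i) / 2 ^ m"
    using dyadic_common_level by metis
  have level: "distr M1 discrete_streams (\<lambda>w. to_stream (\<lambda>j. N1 (real j / 2 ^ m) w)) =
      distr M2 discrete_streams (\<lambda>w. to_stream (\<lambda>j. N2 (real j / 2 ^ m) w))"
    by (rule distr_to_stream_eqI[OF M, of UNIV]) (auto intro!: N1 N2 eq)
  let ?A = "{s \<in> space discrete_streams. \<forall>i<length xs. s !! J i = xs ! i} :: nat stream set"
  have A: "?A \<in> sets discrete_streams" by measurable
  have 1: "measure (distr M1 discrete_streams (\<lambda>w. to_stream (\<lambda>j. N1 (real j / 2 ^ m) w))) ?A =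
      measure M1 {w \<in> space M1. \<forall>i<length xs. N1 (dyadic i) w = xs ! i}"
    using mJ by (subst measure_distr[OF measurable_to_stream_discrete A])
      (auto intro!: N1 arg_cong[where f="measure M1"] simp: to_stream_def space_stream_space)
  have 2: "measure (distr M2 discrete_streams (\<lambda>w. to_stream (\<lambda>j. N2 (real j / 2 ^ m) w))) ?A =
      measure M2 {w \<in> space M2. \<forall>i<length xs. N2 (dyadic i) w = xs ! i}"
    using mJ by (subst measure_distr[OF measurable_to_stream_discrete A])
      (auto intro!: N2 arg_cong[where f="measure M2"] simp: to_stream_def space_stream_space)
  show "measure M1 {w \<in> space M1. \<forall>i<length xs. N1 (dyadic i) w = xs ! i} =
      measure M2 {w \<in> space M2. \<forall>i<length xs. N2 (dyadic i) w = xs ! i}"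
    using 1 2 level by simp
qed (auto intro!: N1 N2 dyadic_nonneg)

section \<open>Counting functions and their jump times\<close>

definition count :: "(nat \<Rightarrow> real) \<Rightarrow> real \<Rightarrow> nat" where
  "count \<tau> t = (LEAST k. t < \<tau> (Suc k))"

text \<open>\<open>\<tau> 0\<close> is the start and not a jump, which explains the
  \<open>Suc\<close> in \<open>count\<close>. Monotonicity is not strict: several jumps may happen
  at one time, since \<open>count_of_jump_time\<close> starts from paths that are merely monotone.
  The last clause excludes an accumulation of jumps.\<close>

definition counting_times :: "(nat \<Rightarrow> real) \<Rightarrow> bool" where
  "counting_times \<tau> \<longleftrightarrow> incseq \<tau> \<and> \<tau> 0 = 0 \<and> (\<forall>t. \<exists>k. t < \<tau> k)"

lemma count_eq_iff:
  assumes "counting_times \<tau>" "0 \<le> t"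
  shows "count \<tau> t = k \<longleftrightarrow> \<tau> k \<le> t \<and> t < \<tau> (Suc k)"
proof -
  have inc: "incseq \<tau>" "\<tau> 0 = 0" using assms by (auto simp: counting_times_def)
  obtain k' where "t < \<tau> k'" using assms by (auto simp: counting_times_def)
  then have ex: "t < \<tau> (Suc (k' - 1))"
    using inc assms(2) by (cases k') auto
  have "\<tau> (count \<tau> t) \<le> t \<and> t < \<tau> (Suc (count \<tau> t))"
  proof
    show "t < \<tau> (Suc (count \<tau> t))"
      unfolding count_def by (rule LeastI, rule ex)
    show "\<tau> (count \<tau> t) \<le> t"
    proof (cases "count \<tau> t")
      case (Suc j)
      then have "j < (LEAST k. t < \<tau> (Suc k))" by (simp add: count_def)
      from not_less_Least[OF this] show ?thesis using Suc by simp
    qed (use inc assms(2) in auto)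
  qed
  moreover have "k = l" if "\<tau> k \<le> t" "t < \<tau> (Suc k)" "\<tau> l \<le> t" "t < \<tau> (Suc l)" for k l
  proof (rule ccontr)
    assume "k \<noteq> l"
    then consider "Suc k \<le> l" | "Suc l \<le> k" by linarith
    then show False using that incseqD[OF inc(1)] by cases (meson leD le_less_trans order_trans)+
  qed
  ultimately show ?thesis by blast
qed

lemma count_less_iff:
  assumes "counting_times \<tau>" "0 \<le> t"
  shows "count \<tau> t < i \<longleftrightarrow> t < \<tau> i"
proof -
  have *: "\<tau> (count \<tau> t) \<le> t" "t < \<tau> (Suc (count \<tau> t))"
    using count_eq_iff[OF assms, of "count \<tau> t"] by auto
  have inc: "incseq \<tau>" using assms by (auto simp: counting_times_def)
  show ?thesis
  proof
    assume "count \<tau> t < i"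
    then have "\<tau> (Suc (count \<tau> t)) \<le> \<tau> i" by (intro incseqD[OF inc]) simp
    then show "t < \<tau> i" using * by simp
  next
    assume "t < \<tau> i"
    show "count \<tau> t < i"
    proof (rule ccontr)
      assume "\<not> count \<tau> t < i"
      then have "\<tau> i \<le> \<tau> (count \<tau> t)" by (intro incseqD[OF inc]) simp
      then show False using * \<open>t < \<tau> i\<close> by simp
    qed
  qed
qed

text \<open>The times of the jumps of a counting function are recovered from its values \<open>\<nu>\<close> at dyadic times.\<close>

definition jump_time :: "nat stream \<Rightarrow> nat \<Rightarrow> ennreal" where
  "jump_time \<nu> i = (SUP n. if \<nu> !! n < i then ennreal (dyadic n) else 0)"

text \<open>\<open>count \<tau> t < i\<close> means \<open>t < \<tau> i\<close>, so the supremum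
  runs over the dyadic times below \<open>\<tau> i\<close>, which come arbitrarily close to
  it.\<close>

lemma jump_time_of_count:
  assumes \<tau>: "counting_times \<tau>" and \<nu>: "\<And>n. \<nu> !! n = count \<tau> (dyadic n)"
  shows "jump_time \<nu> i = ennreal (\<tau> i)"
proof (rule antisym)
  have *: "\<nu> !! n < i \<longleftrightarrow> dyadic n < \<tau> i" for n
    unfolding \<nu> using count_less_iff[OF \<tau> dyadic_nonneg] .
  show "jump_time \<nu> i \<le> ennreal (\<tau> i)"
    unfolding jump_time_def * by (intro SUP_least) (auto intro: ennreal_leI less_imp_le)
  show "ennreal (\<tau> i) \<le> jump_time \<nu> i"
  proof (rule dense_le)
    fix u assume u: "u < ennreal (\<tau> i)"
    then obtain r where r: "u = ennreal r" "0 \<le> r" by (cases u) auto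
    then have "r < \<tau> i" using u by (simp add: ennreal_less_iff)
    then obtain n where n: "r < dyadic n" "dyadic n < \<tau> i" using dyadic_between[OF r(2)] by blast
    have "u \<le> (if \<nu> !! n < i then ennreal (dyadic n) else 0)"
      using n r * by (auto intro: ennreal_leI)
    also have "\<dots> \<le> jump_time \<nu> i"
      unfolding jump_time_def by (rule SUP_upper) simp
    finally show "u \<le> jump_time \<nu> i" .
  qed
qed

lemma measurable_jump_time [measurable]: "(\<lambda>\<nu>. jump_time \<nu> i) \<in> borel_measurable discrete_streams"
  unfolding jump_time_def by measurable

text \<open>All follows from the equivalence of \<open>n t < i\<close> and
  \<open>t < \<tau> i\<close>: right-constancy provides a dyadic time after \<open>t\<close> with
  the same value, and monotonicity gives the converse. Unboundedness makes the times finite, so that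
  \<open>enn2real\<close> loses nothing.\<close>

lemma count_of_jump_time:
  fixes n :: "real \<Rightarrow> nat"
  assumes zero: "n 0 = 0" and mono: "\<And>s t. 0 \<le> s \<Longrightarrow> s \<le> t \<Longrightarrow> n s \<le> n t"
    and rc: "\<And>t. 0 \<le> t \<Longrightarrow> \<forall>\<^sub>F s in at_right t. n s = n t"
    and unbounded: "\<And>i. \<exists>m. i \<le> n (dyadic m)"
    and \<nu>: "\<And>m. \<nu> !! m = n (dyadic m)"
  defines "\<tau> \<equiv> \<lambda>i. enn2real (jump_time \<nu> i)"
  shows "counting_times \<tau>" "0 \<le> t \<Longrightarrow> n t = count \<tau> t"
proof -
  have fin: "jump_time \<nu> i = ennreal (\<tau> i)" for i
  proof -
    obtain m where m: "i \<le> n (dyadic m)" using unbounded by blast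
    have "jump_time \<nu> i \<le> ennreal (dyadic m)"
      unfolding jump_time_def
    proof (intro SUP_least)
      fix l
      have "dyadic l \<le> dyadic m" if "n (dyadic l) < i"
        using that m mono[of "dyadic m" "dyadic l"] dyadic_nonneg by (meson leD le_trans linear not_le)
      then show "(if \<nu> !! l < i then ennreal (dyadic l) else 0) \<le> ennreal (dyadic m)"
        by (auto simp: \<nu> intro: ennreal_leI)
    qed
    then have "jump_time \<nu> i < \<infinity>" using le_less_trans by fastforce
    then show ?thesis by (simp add: \<tau>_def less_top)
  qed
  have less: "n t < i \<longleftrightarrow> t < \<tau> i" if t: "0 \<le> t" for t i
  proof
    assume lt: "n t < i"
    obtain b where b: "t < b" "\<And>s. t < s \<Longrightarrow> s < b \<Longrightarrow> n s = n t"
      using rc[OF t] by (auto simp: eventually_at_right_field)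
    obtain m where m: "t < dyadic m" "dyadic m < b" using dyadic_between[OF t b(1)] by blast
    have "ennreal (dyadic m) \<le> jump_time \<nu> i"
      unfolding jump_time_def by (rule SUP_upper2[of m]) (use m b lt in \<open>auto simp: \<nu>\<close>)
    then show "t < \<tau> i"
      using m t unfolding fin by (auto simp: ennreal_le_iff2 dyadic_nonneg)
  next
    assume "t < \<tau> i"
    then have "ennreal t < jump_time \<nu> i" using t by (simp add: fin ennreal_lessI)
    then obtain m where m: "ennreal t < (if \<nu> !! m < i then ennreal (dyadic m) else 0)"
      unfolding jump_time_def less_SUP_iff by blast
    then have "n (dyadic m) < i" "t < dyadic m"
      using t by (auto simp: \<nu> ennreal_less_iff split: if_splits)
    then show "n t < i" using mono[OF t, of "dyadic m"] by simp
  qed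
  have \<tau>0: "\<tau> 0 = 0" by (simp add: \<tau>_def jump_time_def)
  have \<tau>_nonneg: "0 \<le> \<tau> i" for i by (simp add: \<tau>_def)
  show ct: "counting_times \<tau>"
    unfolding counting_times_def
  proof (intro conjI allI)
    show "incseq \<tau>"
    proof (rule incseq_SucI, rule ccontr)
      fix i assume "\<not> \<tau> i \<le> \<tau> (Suc i)"
      then have "n (\<tau> (Suc i)) < i" using less[OF \<tau>_nonneg] by simp
      then have "n (\<tau> (Suc i)) < Suc i" by simp
      then show False using less[OF \<tau>_nonneg, of "Suc i" "Suc i"] by simp
    qed
    show "\<exists>k. t < \<tau> k" for t
    proof (cases "0 \<le> t")
      case True
      then show ?thesis using less[of t "Suc (n t)"] by auto
    next
      case False
      then show ?thesis using \<tau>0 by (intro exI[of _ 0]) simp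
    qed
  qed (rule \<tau>0)
  show "n t = count \<tau> t" if "0 \<le> t"
    using less[OF that] count_less_iff[OF ct that] by (metis linorder_neqE_nat nat_less_le)
qed

context counting_process begin

lemma measurable_fst_snth [measurable]: "(\<lambda>z. fst z !! j) \<in> borel_measurable \<Omega>"
proof -
  have "(\<lambda>z. fst z !! j) \<in> \<Omega> \<rightarrow>\<^sub>M unit_exponential" by measurable
  then show ?thesis
    by (subst measurable_cong_sets[OF refl, of borel unit_exponential]) auto
qed

lemma measurable_arrival [measurable]: "(\<lambda>z. arrival (fst z) k) \<in> borel_measurable \<Omega>"
  unfolding arrival_def by measurable

lemma measurable_count_arrival [measurable]: "(\<lambda>z. count (arrival (fst z)) t) \<in> \<Omega> \<rightarrow>\<^sub>M count_space UNIV"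
  unfolding count_def by measurable

lemma AE_counting_times: "AE z in \<Omega>. counting_times (arrival (fst z))"
  using AE_positive_holding AE_state_exists
proof eventually_elim
  case (elim z)
  obtain s u where z: "z = (s, u)" by (cases z)
  have pos: "\<And>j. 0 < s !! j" using elim z by auto
  then have nonneg: "\<And>j. 0 \<le> s !! j" by (simp add: less_imp_le)
  have "\<exists>k. t < arrival s k" for t
  proof -
    have "t < real (Suc (nat \<lceil>t\<rceil>))" by linarith
    moreover obtain k where "state_at 0 (real (Suc (nat \<lceil>t\<rceil>))) k z" using elim(2) by blast
    then have "real (Suc (nat \<lceil>t\<rceil>)) < arrival s (Suc k)"
      using state_at_iff_arrival[OF nonneg] z by blast
    ultimately show ?thesis by (meson less_trans)
  qed
  then show ?case
    unfolding counting_times_def z fst_conv by (auto intro!: incseq_SucI simp: arrival_def nonneg)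
qed

lemma AE_state_at_iff_count:
  "AE z in \<Omega>. \<forall>t\<ge>0. \<forall>k. state_at 0 t k z \<longleftrightarrow> count (arrival (fst z)) t = k"
  using AE_positive_holding AE_counting_times
proof eventually_elim
  case (elim z)
  obtain s u where z: "z = (s, u)" by (cases z)
  have nonneg: "\<And>j. 0 \<le> s !! j" using elim z by (auto intro: less_imp_le)
  show ?case
    using count_eq_iff elim(2) state_at_iff_arrival[OF nonneg] unfolding z fst_conv by blast
qed

lemma measure_count_grid:
  assumes "0 < h"
  shows "measure \<Omega> {z \<in> space \<Omega>. \<forall>i<length (k # ys). count (arrival (fst z)) (real i * h) = (k # ys) ! i} =
    of_bool (k = 0) * path_weight (transition h) 0 ys"
proof (cases "k = 0")
  case True
  have "measure \<Omega> {z \<in> space \<Omega>. \<forall>i<length (k # ys). count (arrival (fst z)) (real i * h) = (k # ys) ! i} =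
    measure \<Omega> {z. \<forall>j\<le>length ys. state_at 0 (real j * h) ((0 # ys) ! j) z}"
  proof (rule EI.finite_measure_eq_AE)
    show "AE z in \<Omega>. (z \<in> {z \<in> space \<Omega>. \<forall>i<length (k # ys). count (arrival (fst z)) (real i * h) = (k # ys) ! i}) =
        (z \<in> {z. \<forall>j\<le>length ys. state_at 0 (real j * h) ((0 # ys) ! j) z})"
      using AE_state_at_iff_count
    proof eventually_elim
      case (elim z)
      then have "state_at 0 (real j * h) l z \<longleftrightarrow> count (arrival (fst z)) (real j * h) = l" for j l
        using assms by simp
      then show ?case by (simp add: True less_Suc_eq_le)
    qed
    show "{z. \<forall>j\<le>length ys. state_at 0 (real j * h) ((0 # ys) ! j) z} \<in> sets \<Omega>"
      by (rule sets_Collect_\<Omega>) measurable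
  qed measurable
  then show ?thesis
    using measure_skeleton[OF assms, of ys 0] True by simp
next
  case False
  have "AE z in \<Omega>. z \<notin> {z \<in> space \<Omega>. \<forall>i<length (k # ys). count (arrival (fst z)) (real i * h) = (k # ys) ! i}"
    using AE_state_at_0[of 0] AE_state_at_iff_count
  proof eventually_elim
    case (elim z)
    have "count (arrival (fst z)) 0 = 0" using elim by simp
    then show ?case using False by (auto dest!: spec[of _ 0])
  qed
  then have "measure \<Omega> {z \<in> space \<Omega>. \<forall>i<length (k # ys). count (arrival (fst z)) (real i * h) = (k # ys) ! i} = 0"
    by (subst EI.prob_eq_0) measurable
  then show ?thesis using False by simp
qed

end

section \<open>The jump times of a given Poisson process\<close>

context
  fixes P :: "'p measure" and N :: "real \<Rightarrow> 'p \<Rightarrow> nat"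
  assumes P: "prob_space P" and N: "poisson_process P N"
begin

interpretation prob_space P by (rule P)

lemma poisson_measurable: "0 \<le> t \<Longrightarrow> N t \<in> P \<rightarrow>\<^sub>M count_space UNIV"
  using N by (simp add: poisson_process_def)

lemma poisson_paths:
  "AE w in P. N 0 w = 0 \<and> (\<forall>s t. 0 \<le> s \<longrightarrow> s \<le> t \<longrightarrow> N s w \<le> N t w) \<and>
     (\<forall>t\<ge>0. \<forall>\<^sub>F s in at_right t. N s w = N t w)"
proof -
  have "AE w in P. N 0 w = 0 \<and> mono_on {0..} (\<lambda>t. N t w) \<and> (\<forall>t\<ge>0. ((\<lambda>s. N s w) \<longlongrightarrow> N t w) (at_right t))"
    using N by (simp add: poisson_process_def)
  then show ?thesis
    by eventually_elim (auto simp: mono_on_def tendsto_discrete)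
qed

text \<open>Along a path that starts at 0 the grid values amount to the increments, and these are
  independent Poisson variables.\<close>

lemma poisson_grid:
  assumes h: "0 < h"
  shows "measure P {w \<in> space P. \<forall>i<length (k # ys). N (real i * h) w = (k # ys) ! i} =
    of_bool (k = 0) * path_weight (\<lambda>k l. if k \<le> l then pmf (poisson_pmf h) (l - k) else 0) 0 ys"
    (is "measure P ?E = _ * path_weight ?p 0 ys")
proof -
  let ?n = "length ys" and ?z = "k # ys"
  define inc where "inc i w = N (real (Suc i) * h) w - N (real i * h) w" for i w
  \<comment> \<open>Subtraction of natural numbers truncates, so the increment alone would not
    reject a decreasing word; the inequality does.\<close>
  define A where "A i = {w \<in> space P. ?z ! i \<le> ys ! i \<and> inc i w = ys ! i - ?z ! i}" for i
  have Nm [measurable]: "N (real i * h) \<in> P \<rightarrow>\<^sub>M count_space UNIV" for i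
    using h by (intro poisson_measurable) simp
  have [measurable]: "N (real (Suc i) * h) \<in> P \<rightarrow>\<^sub>M count_space UNIV" for i by (rule Nm)
  have E_sets: "?E \<in> sets P" by measurable
  have incm [measurable]: "inc i \<in> P \<rightarrow>\<^sub>M count_space UNIV" for i
    unfolding inc_def by measurable
  have A_sets: "A i \<in> sets P" for i unfolding A_def by measurable
  have distr: "distr P (count_space UNIV) (inc i) = measure_pmf (poisson_pmf h)" for i
  proof -
    have "0 \<le> real i * h" "real i * h < real (Suc i) * h" using h by auto
    then have "distr P (count_space UNIV) (\<lambda>w. N (real (Suc i) * h) w - N (real i * h) w) =
        measure_pmf (poisson_pmf (real (Suc i) * h - real i * h))"
      using N unfolding poisson_process_def by blast
    then show ?thesis unfolding inc_def by (simp add: algebra_simps)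
  qed
  have pA: "measure P (A i) = ?p (?z ! i) (ys ! i)" for i
  proof (cases "?z ! i \<le> ys ! i")
    case True
    have "measure P (A i) = measure P (inc i -` {ys ! i - ?z ! i} \<inter> space P)"
      using True by (intro arg_cong[where f="measure P"]) (auto simp: A_def)
    also have "\<dots> = measure (distr P (count_space UNIV) (inc i)) {ys ! i - ?z ! i}"
      by (subst measure_distr[OF incm]) auto
    also have "\<dots> = pmf (poisson_pmf h) (ys ! i - ?z ! i)"
      unfolding distr by (rule measure_pmf_single)
    finally show ?thesis using True by simp
  qed (simp add: A_def)
  have AE_E: "AE w in P. w \<in> ?E \<longleftrightarrow> k = 0 \<and> (\<forall>i<?n. w \<in> A i)"
    using poisson_paths AE_space
  proof eventually_elim
    case (elim w)
    have mono: "N (real i * h) w \<le> N (real (Suc i) * h) w" for i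
      using elim h by (auto intro!: mult_right_mono)
    show ?case
    proof
      assume E: "w \<in> ?E"
      have "N (real i * h) w = ?z ! i" if "i \<le> ?n" for i
        using E that by (simp add: less_Suc_eq_le)
      from this[of 0] this[OF less_imp_le] this[of "Suc i" for i]
      show "k = 0 \<and> (\<forall>i<?n. w \<in> A i)"
        using elim mono unfolding A_def inc_def by (auto simp del: of_nat_Suc) (metis Suc_leI nth_Cons_Suc)+
    next
      assume A: "k = 0 \<and> (\<forall>i<?n. w \<in> A i)"
      have "i \<le> ?n \<Longrightarrow> N (real i * h) w = ?z ! i" for i
      proof (induction i)
        case 0 then show ?case using elim A by simp
      next
        case (Suc i)
        then have "w \<in> A i" "N (real i * h) w = ?z ! i" using A by auto
        then show ?case using mono[of i] by (auto simp: A_def inc_def eq_diff_iff simp del: of_nat_Suc)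
      qed
      then show "w \<in> ?E" using elim by (simp add: less_Suc_eq_le)
    qed
  qed
  show ?thesis
  proof (cases "k = 0")
    case False
    then have "AE w in P. w \<notin> ?E" using AE_E by simp
    then have "measure P ?E = 0" using prob_eq_0[OF E_sets] by simp
    then show ?thesis using False by simp
  next
    case True
    show ?thesis
    \<comment> \<open>The product formula for independent variables is used with a nonempty index
      set, so a word without increments is treated apart.\<close>
    proof (cases "?n = 0")
      case True': True
      then have "AE w in P. w \<in> ?E" using AE_E True by simp
      then have "measure P ?E = 1" using prob_eq_1[OF E_sets] by simp
      then show ?thesis using True True' by simp
    next
      case False
      let ?A = "\<lambda>i. if ?z ! i \<le> ys ! i then {ys ! i - ?z ! i} else {}"
      have Ai: "A i = inc i -` ?A i \<inter> space P" for i by (auto simp: A_def)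
      have "indep_vars (\<lambda>_. count_space UNIV) (\<lambda>i w. N (real (Suc i) * h) w - N (real i * h) w) {..<?n}"
        using N h unfolding poisson_process_def strict_mono_def
        by (elim conjE allE[of _ "\<lambda>i. real i * h"] allE[of _ ?n] impE) auto
      then have ind: "indep_vars (\<lambda>_. count_space UNIV) inc {..<?n}"
        by (simp add: inc_def[abs_def])
      have "measure P ?E = measure P (\<Inter>i\<in>{..<?n}. A i)"
      proof (rule finite_measure_eq_AE)
        show "AE w in P. (w \<in> ?E) = (w \<in> (\<Inter>i\<in>{..<?n}. A i))"
          using AE_E by eventually_elim (use True in auto)
        show "(\<Inter>i\<in>{..<?n}. A i) \<in> sets P" using A_sets False by (intro sets.finite_INT) auto
      qed (rule E_sets)
      also have "\<dots> = (\<Prod>i\<in>{..<?n}. measure P (A i))"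
        unfolding Ai using False by (intro indep_varsD_finite[OF ind]) auto
      also have "\<dots> = path_weight ?p k ys"
        unfolding path_weight_eq_prod pA ..
      finally show ?thesis using True by simp
    qed
  qed
qed

text \<open>The law \<open>\<kappa>\<close> is free because the count depends on the holding times
  only. Thus the Poisson process can be modelled on the product space that also carries the
  innovations of the walk.\<close>

lemma distr_poisson_stream:
  fixes \<kappa> :: "nat pmf"
  shows "distr P discrete_streams (\<lambda>w. to_stream (\<lambda>n. N (dyadic n) w)) =
    distr (stream_space unit_exponential \<Otimes>\<^sub>M stream_space (measure_pmf \<kappa>)) discrete_streams
      (\<lambda>z. to_stream (\<lambda>n. count (arrival (fst z)) (dyadic n)))"
proof -
  interpret C: counting_process \<kappa> .
  show ?thesis
  proof (rule distr_dyadic_stream_eqI[OF P C.prob_space_\<Omega>])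
    fix m and ks :: "nat list" assume "ks \<noteq> []"
    then obtain k ys where ks: "ks = k # ys" by (cases ks) auto
    have "path_weight (C.transition h) 0 ys = path_weight (\<lambda>k l. if k \<le> l then pmf (poisson_pmf h) (l - k) else 0) 0 ys"
      if "0 < h" for h
      by (simp add: C.transition_eq_poisson[OF that] path_weight_eq_prod)
    then show "measure P {w \<in> space P. \<forall>i<length ks. N (real i / 2 ^ m) w = ks ! i} =
        measure C.\<Omega> {z \<in> space C.\<Omega>. \<forall>i<length ks. count (arrival (fst z)) (real i / 2 ^ m) = ks ! i}"
      using poisson_grid[of "1 / 2 ^ m" k ys] C.measure_count_grid[of "1 / 2 ^ m" k ys] ks by simp
  qed (auto intro: poisson_measurable)
qed

text \<open>Unboundedness along dyadic times is a measurable property of the stream of values, so it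
  is inherited from the exponential model, where all arrival times are finite.\<close>

lemma poisson_unbounded: "AE w in P. \<forall>i. \<exists>m. i \<le> N (dyadic m) w"
proof -
  interpret C: counting_process "return_pmf 0" .
  let ?U = "\<lambda>\<nu> :: nat stream. \<forall>i. \<exists>m. i \<le> \<nu> !! m"
  have m1: "(\<lambda>w. to_stream (\<lambda>n. N (dyadic n) w)) \<in> P \<rightarrow>\<^sub>M discrete_streams"
    by (intro measurable_to_stream_discrete poisson_measurable dyadic_nonneg)
  have m2: "(\<lambda>z. to_stream (\<lambda>n. count (arrival (fst z)) (dyadic n))) \<in> C.\<Omega> \<rightarrow>\<^sub>M discrete_streams"
    by (intro measurable_to_stream_discrete C.measurable_count_arrival)
  have U: "{\<nu> \<in> space discrete_streams. ?U \<nu>} \<in> sets discrete_streams" by measurable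
  have "AE z in C.\<Omega>. ?U (to_stream (\<lambda>n. count (arrival (fst z)) (dyadic n)))"
    using C.AE_counting_times
  proof eventually_elim
    case (elim z)
    have "\<exists>m. i \<le> count (arrival (fst z)) (dyadic m)" for i
    proof -
      have "0 \<le> arrival (fst z) i"
        using elim incseqD[of "arrival (fst z)" 0 i] by (auto simp: counting_times_def)
      from dyadic_between[OF this, of "arrival (fst z) i + 1"] obtain m where "arrival (fst z) i < dyadic m" by auto
      then have "\<not> count (arrival (fst z)) (dyadic m) < i"
        using count_less_iff[OF elim dyadic_nonneg] by simp
      then show ?thesis by (auto simp: not_less)
    qed
    then show ?case by (simp add: to_stream_def)
  qed
  then have "AE \<nu> in distr C.\<Omega> discrete_streams (\<lambda>z. to_stream (\<lambda>n. count (arrival (fst z)) (dyadic n))). ?U \<nu>"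
    by (subst AE_distr_iff[OF m2 U])
  then have "AE \<nu> in distr P discrete_streams (\<lambda>w. to_stream (\<lambda>n. N (dyadic n) w)). ?U \<nu>"
    unfolding distr_poisson_stream[of "return_pmf 0"] .
  then have "AE w in P. ?U (to_stream (\<lambda>n. N (dyadic n) w))"
    by (subst (asm) AE_distr_iff[OF m1 U])
  then show ?thesis by (simp add: to_stream_def)
qed

text \<open>A measurable function of the values at dyadic times; hence its joint law with the walk
  can be computed in the exponential model.\<close>

definition poisson_times :: "'p \<Rightarrow> nat \<Rightarrow> real" where
  "poisson_times w i = enn2real (jump_time (to_stream (\<lambda>n. N (dyadic n) w)) i)"

lemma AE_poisson_times:
  "AE w in P. counting_times (poisson_times w) \<and> (\<forall>t\<ge>0. N t w = count (poisson_times w) t)"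
  using poisson_paths poisson_unbounded
proof eventually_elim
  case (elim w)
  note * = count_of_jump_time[of "\<lambda>t. N t w" "to_stream (\<lambda>n. N (dyadic n) w)"]
  show ?case
    unfolding poisson_times_def using elim by (intro conjI allI impI *) (auto simp: to_stream_def)
qed

end

lemma (in jump_process) measurable_chain [measurable]: "(\<lambda>u. chain x u k) \<in> I \<rightarrow>\<^sub>M count_space UNIV"
proof (induction k arbitrary: x)
  case (Suc k)
  have "(\<lambda>u. chain (step x n) (stl u) k) \<in> I \<rightarrow>\<^sub>M count_space UNIV" for n
    by (rule measurable_compose[OF _ Suc.IH]) measurable
  moreover have "shd \<in> I \<rightarrow>\<^sub>M count_space UNIV"
    using measurable_shd[of "measure_pmf \<kappa>"]
    by (subst measurable_cong_sets[OF refl, of "count_space UNIV" "measure_pmf \<kappa>"]) auto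
  ultimately show ?case
    unfolding chain.simps by (rule measurable_compose_countable)
qed simp

lemma (in jump_process) emeasure_chain:
  "emeasure I {u. \<forall>j\<le>length ys. chain x u j = (x # ys) ! j} =
    ennreal (path_weight (\<lambda>y z. measure \<kappa> {n. step y n = z}) x ys)"
proof (induction ys arbitrary: x)
  case Nil
  then show ?case using I.emeasure_space_1 by (simp add: space_stream_space)
next
  case (Cons y ys)
  let ?A = "\<lambda>x ys. {u. \<forall>j\<le>length ys. chain x u j = (x # ys) ! j}"
  have sets: "?A x ys \<in> sets I" for x ys
  proof -
    have "{u \<in> space I. \<forall>j\<le>length ys. chain x u j = (x # ys) ! j} \<in> sets I" by measurable
    then show ?thesis by (simp add: space_stream_space)
  qed
  have nn: "0 \<le> path_weight (\<lambda>y z. measure \<kappa> {n. step y n = z}) y ys"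
    by (simp add: path_weight_eq_prod prod_nonneg)
  have push: "n ## u \<in> ?A x (y # ys) \<longleftrightarrow> step x n = y \<and> u \<in> ?A y ys" for n u
  proof
    assume L: "n ## u \<in> ?A x (y # ys)"
    then have L: "chain x (n ## u) j = (x # y # ys) ! j" if "j \<le> Suc (length ys)" for j using that by simp
    have "step x n = y" using L[of 1] by simp
    then show "step x n = y \<and> u \<in> ?A y ys" using L[of "Suc j" for j] by simp
  next
    assume R: "step x n = y \<and> u \<in> ?A y ys"
    show "n ## u \<in> ?A x (y # ys)"
    proof (intro CollectI allI impI)
      fix j assume "j \<le> length (y # ys)"
      then show "chain x (n ## u) j = (x # y # ys) ! j" using R by (cases j) auto
    qed
  qed
  have "emeasure I (?A x (y # ys)) = (\<integral>\<^sup>+n. emeasure I {u \<in> space I. n ## u \<in> ?A x (y # ys)} \<partial>\<kappa>)"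
    by (rule prob_space.emeasure_stream_space[OF measure_pmf.prob_space_axioms sets])
  also have "\<dots> = (\<integral>\<^sup>+n. indicator {n. step x n = y} n * emeasure I (?A y ys) \<partial>\<kappa>)"
    unfolding push by (intro nn_integral_cong) (auto simp: space_stream_space split: split_indicator)
  also have "\<dots> = emeasure \<kappa> {n. step x n = y} * emeasure I (?A y ys)"
    by (simp add: nn_integral_multc)
  finally show ?case
    using nn by (simp add: Cons.IH measure_pmf.emeasure_eq_measure ennreal_mult')
qed

section \<open>The killed time-changed walk\<close>

text \<open>The increments are coded by natural numbers, so that the innovations of the jump process range
  over a countable type.\<close>

definition coded_step :: "('a, 'b) monoid_scheme \<Rightarrow> 'a \<Rightarrow> nat \<Rightarrow> 'a" where
  "coded_step G x n = x \<otimes>\<^bsub>G\<^esub> from_nat_into (carrier G) n"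

definition coded_pmf :: "('a, 'b) monoid_scheme \<Rightarrow> 'a pmf \<Rightarrow> nat pmf" where
  "coded_pmf G \<mu> = map_pmf (to_nat_on (carrier G)) \<mu>"

lemma measure_coded_step:
  assumes "group G" "countable (carrier G)" "set_pmf \<mu> \<subseteq> carrier G" "x \<in> carrier G" "y \<in> carrier G"
  shows "measure (coded_pmf G \<mu>) {n. coded_step G x n = y} = pmf \<mu> (inv\<^bsub>G\<^esub> x \<otimes>\<^bsub>G\<^esub> y)"
proof -
  interpret group G by fact
  have "measure (coded_pmf G \<mu>) {n. coded_step G x n = y} =
      measure \<mu> {g. coded_step G x (to_nat_on (carrier G) g) = y}"
    by (simp add: coded_pmf_def vimage_def)
  also have "\<dots> = measure \<mu> {inv\<^bsub>G\<^esub> x \<otimes>\<^bsub>G\<^esub> y}"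
  proof (rule measure_pmf.finite_measure_eq_AE)
    show "AE g in \<mu>. (g \<in> {g. coded_step G x (to_nat_on (carrier G) g) = y}) = (g \<in> {inv\<^bsub>G\<^esub> x \<otimes>\<^bsub>G\<^esub> y})"
    proof (rule AE_pmfI)
      fix g assume "g \<in> set_pmf \<mu>"
      then have g: "g \<in> carrier G" using assms by auto
      then have "coded_step G x (to_nat_on (carrier G) g) = x \<otimes>\<^bsub>G\<^esub> g"
        using assms by (simp add: coded_step_def)
      then show "(g \<in> {g. coded_step G x (to_nat_on (carrier G) g) = y}) = (g \<in> {inv\<^bsub>G\<^esub> x \<otimes>\<^bsub>G\<^esub> y})"
        using assms g by (auto simp: inv_solve_left m_assoc[symmetric])
    qed
  qed auto
  finally show ?thesis by (simp add: measure_pmf_single)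
qed

lemma coded_step_closed:
  assumes "group G" "x \<in> carrier G"
  shows "coded_step G x n \<in> carrier G"
proof -
  interpret group G by fact
  have "from_nat_into (carrier G) n \<in> carrier G" by (rule from_nat_into) auto
  then show ?thesis using assms by (simp add: coded_step_def)
qed

lemma measurable_occupies:
  assumes \<rho> [measurable]: "\<And>k. (\<lambda>w. \<rho> w k) \<in> M \<rightarrow>\<^sub>M count_space UNIV"
    and \<tau> [measurable]: "\<And>k. (\<lambda>w. \<tau> w k) \<in> borel_measurable M"
  shows "Measurable.pred M (\<lambda>w. occupies c (\<rho> w) (\<tau> w) t y)"
proof -
  have [measurable]: "(\<lambda>w. c (\<rho> w k)) \<in> borel_measurable M" for k
    by (rule measurable_compose[OF \<rho>]) simp
  show ?thesis unfolding occupies_def changed_clock_def by measurable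
qed

section \<open>Joint law of the walk and the Poisson process\<close>

locale walk_setup = prob_space P
  for G :: "('a, 'b) monoid_scheme" and \<mu> :: "'a pmf" and x :: 'a and P :: "'p measure"
    and R :: "nat \<Rightarrow> 'p \<Rightarrow> 'a" and N :: "real \<Rightarrow> 'p \<Rightarrow> nat" and c :: "'a \<Rightarrow> real" +
  assumes G: "group G" "countable (carrier G)" and \<mu>: "set_pmf \<mu> \<subseteq> carrier G" and x: "x \<in> carrier G"
    and R: "random_walk G \<mu> x P R" and N: "poisson_process P N"
    and indep: "independent_processes G P R N" and c: "\<And>y. 0 < c y"
begin

sublocale J: jump_process c "coded_step G" "coded_pmf G \<mu>"
  by standard (rule c)

sublocale C: counting_process "coded_pmf G \<mu>" .

abbreviation \<tau> :: "'p \<Rightarrow> nat \<Rightarrow> real" where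
  "\<tau> \<equiv> poisson_times N"

abbreviation walk_stream :: "'p \<Rightarrow> 'a stream" where
  "walk_stream w \<equiv> to_stream (\<lambda>n. R n w)"

abbreviation poisson_stream :: "'p \<Rightarrow> nat stream" where
  "poisson_stream w \<equiv> to_stream (\<lambda>n. N (dyadic n) w)"

lemma R_carrier: "w \<in> space P \<Longrightarrow> R n w \<in> carrier G"
  using R measurable_space[of "R n" P "count_space (carrier G)"] by (auto simp: random_walk_def)

lemma measurable_R [measurable]: "R n \<in> P \<rightarrow>\<^sub>M count_space UNIV"
proof -
  have "R n \<in> P \<rightarrow>\<^sub>M count_space (carrier G)" using R by (simp add: random_walk_def)
  from measurable_compose[OF this, of "\<lambda>x. x" "count_space UNIV"] show ?thesis by simp
qed

lemma measurable_walk_stream: "walk_stream \<in> P \<rightarrow>\<^sub>M discrete_streams"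
  by (intro measurable_to_stream_discrete measurable_R)

lemma measurable_poisson_stream: "poisson_stream \<in> P \<rightarrow>\<^sub>M discrete_streams"
  by (intro measurable_to_stream_discrete poisson_measurable[OF prob_space_axioms N] dyadic_nonneg)

lemma chain_carrier: "y \<in> carrier G \<Longrightarrow> J.chain y u k \<in> carrier G"
  by (induction k arbitrary: y u) (auto simp: coded_step_closed[OF G(1)])

lemma distr_walk_stream:
  "distr P discrete_streams walk_stream = distr J.I discrete_streams (\<lambda>u. to_stream (\<lambda>n. J.chain x u n))"
proof (rule distr_to_stream_eqI[OF prob_space_axioms J.I.prob_space_axioms G(2)])
  fix xs assume "xs \<noteq> []" and sub: "set xs \<subseteq> carrier G"
  then obtain y ys where xs: "xs = y # ys" by (cases xs) auto
  \<comment> \<open>\<open>random_walk\<close> speaks of total functions; beyond the end of the word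
    this one continues with \<open>x\<close>, so that all its values lie in the carrier.\<close>
  define f where "f i = (if i < length xs then xs ! i else x)" for i
  have f: "f i \<in> carrier G" for i using sub x by (auto simp: f_def)
  have "{w \<in> space P. \<forall>i<length xs. R i w = xs ! i} = {w \<in> space P. \<forall>i\<le>length ys. R i w = f i}"
    by (auto simp: xs f_def less_Suc_eq_le)
  then have 1: "measure P {w \<in> space P. \<forall>i<length xs. R i w = xs ! i} =
      (if f 0 = x then \<Prod>i<length ys. pmf \<mu> (inv\<^bsub>G\<^esub> (f i) \<otimes>\<^bsub>G\<^esub> f (Suc i)) else 0)"
    using R f by (simp add: random_walk_def)
  show "measure P {w \<in> space P. \<forall>i<length xs. R i w = xs ! i} =
      measure J.I {u \<in> space J.I. \<forall>i<length xs. J.chain x u i = xs ! i}"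
  proof (cases "y = x")
    case True
    have "measure J.I {u \<in> space J.I. \<forall>i<length xs. J.chain x u i = xs ! i} =
        measure J.I {u. \<forall>j\<le>length ys. J.chain x u j = (x # ys) ! j}"
      by (simp add: xs True less_Suc_eq_le space_stream_space)
    also have "\<dots> = path_weight (\<lambda>y z. measure (coded_pmf G \<mu>) {n. coded_step G y n = z}) x ys"
      using J.emeasure_chain[of ys x] by (simp add: J.I.emeasure_eq_measure path_weight_eq_prod prod_nonneg)
    also have "\<dots> = (\<Prod>i<length ys. pmf \<mu> (inv\<^bsub>G\<^esub> (f i) \<otimes>\<^bsub>G\<^esub> f (Suc i)))"
      unfolding path_weight_eq_prod
    proof (intro prod.cong refl)
      fix i assume "i \<in> {..<length ys}"
      then have "(x # ys) ! i = f i" "ys ! i = f (Suc i)" by (auto simp: f_def xs True)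
      then show "measure (coded_pmf G \<mu>) {n. coded_step G ((x # ys) ! i) n = ys ! i} =
          pmf \<mu> (inv\<^bsub>G\<^esub> (f i) \<otimes>\<^bsub>G\<^esub> f (Suc i))"
        using measure_coded_step[OF G \<mu> f f] by simp
    qed
    finally show ?thesis using 1 True by (simp add: f_def xs)
  next
    case False
    then have "{u \<in> space J.I. \<forall>i<length xs. J.chain x u i = xs ! i} = {}"
      by (auto simp: xs dest!: spec[of _ 0])
    then have "measure J.I {u \<in> space J.I. \<forall>i<length xs. J.chain x u i = xs ! i} = 0"
      by (simp only: measure_empty)
    then show ?thesis using 1 False by (simp add: f_def xs)
  qed
qed (use R_carrier chain_carrier x in auto)

text \<open>\<open>independent_processes\<close> concerns the sigma-algebras generated by the whole
  paths. Both streams are measurable for these, so the product formula holds on rectangles.\<close>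

lemma indep_streams:
  "distr P (discrete_streams \<Otimes>\<^sub>M discrete_streams) (\<lambda>w. (walk_stream w, poisson_stream w)) =
    distr P discrete_streams walk_stream \<Otimes>\<^sub>M distr P discrete_streams poisson_stream"
proof -
  let ?A = "vimage_algebra (space P) (\<lambda>w n. R n w) (\<Pi>\<^sub>M n\<in>UNIV. count_space (carrier G))"
  let ?B = "vimage_algebra (space P) (\<lambda>w. \<lambda>t\<in>{0..}. N t w) (\<Pi>\<^sub>M t\<in>{0..}. count_space (UNIV :: nat set))"
  have indep_AB: "indep_set (sets ?A) (sets ?B)"
    using indep by (simp add: independent_processes_def)
  have RA: "R n \<in> ?A \<rightarrow>\<^sub>M count_space UNIV" for n
  proof -
    have "(\<lambda>w n. R n w) \<in> ?A \<rightarrow>\<^sub>M (\<Pi>\<^sub>M n\<in>UNIV. count_space (carrier G))"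
      by (rule measurable_vimage_algebra1) (auto simp: space_PiM R_carrier)
    from measurable_compose[OF this measurable_component_singleton[of n]]
    have "R n \<in> ?A \<rightarrow>\<^sub>M count_space (carrier G)" by simp
    from measurable_compose[OF this, of "\<lambda>x. x" "count_space UNIV"] show ?thesis by simp
  qed
  have NB: "N t \<in> ?B \<rightarrow>\<^sub>M count_space UNIV" if "0 \<le> t" for t
  proof -
    have "(\<lambda>w. \<lambda>t\<in>{0..}. N t w) \<in> ?B \<rightarrow>\<^sub>M (\<Pi>\<^sub>M t\<in>{0..}. count_space (UNIV :: nat set))"
      by (rule measurable_vimage_algebra1) (auto simp: space_PiM)
    from measurable_compose[OF this measurable_component_singleton[of t]] that
    show ?thesis by simp
  qed
  have mA: "walk_stream \<in> ?A \<rightarrow>\<^sub>M discrete_streams"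
    by (intro measurable_to_stream_discrete RA)
  have mB: "poisson_stream \<in> ?B \<rightarrow>\<^sub>M discrete_streams"
    by (intro measurable_to_stream_discrete NB dyadic_nonneg)
  interpret d1: prob_space "distr P discrete_streams walk_stream"
    by (rule prob_space_distr) (rule measurable_walk_stream)
  interpret d2: prob_space "distr P discrete_streams poisson_stream"
    by (rule prob_space_distr) (rule measurable_poisson_stream)
  note pair = measurable_Pair[OF measurable_walk_stream measurable_poisson_stream]
  show ?thesis
  proof (rule pair_measure_eqI[symmetric])
    fix A B assume "A \<in> sets (distr P discrete_streams walk_stream)" "B \<in> sets (distr P discrete_streams poisson_stream)"
    then have AB: "A \<in> sets discrete_streams" "B \<in> sets discrete_streams" by auto
    have 1: "walk_stream -` A \<inter> space P \<in> sets ?A"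
      using measurable_sets[OF mA AB(1)] by simp
    have 2: "poisson_stream -` B \<inter> space P \<in> sets ?B"
      using measurable_sets[OF mB AB(2)] by simp
    have "(\<lambda>w. (walk_stream w, poisson_stream w)) -` (A \<times> B) \<inter> space P =
        (walk_stream -` A \<inter> space P) \<inter> (poisson_stream -` B \<inter> space P)" by auto
    then show "emeasure (distr P discrete_streams walk_stream) A * emeasure (distr P discrete_streams poisson_stream) B =
        emeasure (distr P (discrete_streams \<Otimes>\<^sub>M discrete_streams) (\<lambda>w. (walk_stream w, poisson_stream w))) (A \<times> B)"
      using indep_setD[OF indep_AB 1 2] AB
      by (simp add: emeasure_distr[OF measurable_walk_stream] emeasure_distr[OF measurable_poisson_stream]
          emeasure_distr[OF pair] emeasure_eq_measure ennreal_mult)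
  qed (auto intro: d1.sigma_finite_measure_axioms d2.sigma_finite_measure_axioms)
qed

text \<open>In the model the walk is a function of the innovations and the Poisson stream one of the
  holding times, so both sides are products with equal marginals. The swap is due to the order of
  the factors of \<open>J.\<Omega>\<close>.\<close>

lemma joint_law:
  "distr P (discrete_streams \<Otimes>\<^sub>M discrete_streams) (\<lambda>w. (walk_stream w, poisson_stream w)) =
   distr J.\<Omega> (discrete_streams \<Otimes>\<^sub>M discrete_streams)
     (\<lambda>z. (to_stream (\<lambda>n. J.chain x (snd z) n), to_stream (\<lambda>n. count (arrival (fst z)) (dyadic n))))"
proof -
  let ?S = discrete_streams
  let ?f = "\<lambda>s. to_stream (\<lambda>n. count (arrival s) (dyadic n))" and ?g = "\<lambda>u. to_stream (\<lambda>n. J.chain x u n)"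
  have [measurable]: "(\<lambda>s. s !! j) \<in> borel_measurable J.E" for j
  proof -
    have "(\<lambda>s. s !! j) \<in> J.E \<rightarrow>\<^sub>M unit_exponential" by measurable
    then show ?thesis by (subst measurable_cong_sets[OF refl, of borel unit_exponential]) auto
  qed
  have [measurable]: "(\<lambda>s. count (arrival s) t) \<in> J.E \<rightarrow>\<^sub>M count_space UNIV" for t
    unfolding count_def arrival_def by measurable
  have f: "?f \<in> J.E \<rightarrow>\<^sub>M ?S" by (intro measurable_to_stream_discrete) measurable
  have g: "?g \<in> J.I \<rightarrow>\<^sub>M ?S" by (intro measurable_to_stream_discrete) measurable
  have nu: "distr P ?S poisson_stream = distr J.E ?S ?f"
  proof -
    have "distr P ?S poisson_stream = distr J.\<Omega> ?S (\<lambda>z. ?f (fst z))"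
      by (rule distr_poisson_stream[OF prob_space_axioms N])
    also have "\<dots> = distr (distr J.\<Omega> J.E fst) ?S ?f"
      by (subst distr_distr[OF f measurable_fst]) (simp add: comp_def)
    also have "distr J.\<Omega> J.E fst = J.E"
      by (rule J.I.distr_pair_fst)
    finally show ?thesis .
  qed
  interpret d1: prob_space "distr J.E ?S ?f" using f by (rule J.E.prob_space_distr)
  interpret d2: prob_space "distr J.I ?S ?g" using g by (rule J.I.prob_space_distr)
  interpret dd: pair_sigma_finite "distr J.E ?S ?f" "distr J.I ?S ?g" ..
  have "distr P (?S \<Otimes>\<^sub>M ?S) (\<lambda>w. (walk_stream w, poisson_stream w)) = distr J.I ?S ?g \<Otimes>\<^sub>M distr J.E ?S ?f"
    unfolding indep_streams distr_walk_stream nu ..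
  also have "\<dots> = distr (J.I \<Otimes>\<^sub>M J.E) (?S \<Otimes>\<^sub>M ?S) (\<lambda>(u, s). (?g u, ?f s))"
    by (rule pair_measure_distr[OF g f]) (rule d1.sigma_finite_measure_axioms)
  also have "J.I \<Otimes>\<^sub>M J.E = distr J.\<Omega> (J.I \<Otimes>\<^sub>M J.E) (\<lambda>(s, u). (u, s))"
  proof -
    interpret IE: pair_sigma_finite J.I J.E ..
    show ?thesis by (rule IE.distr_pair_swap)
  qed
  also have "distr (distr J.\<Omega> (J.I \<Otimes>\<^sub>M J.E) (\<lambda>(s, u). (u, s))) (?S \<Otimes>\<^sub>M ?S) (\<lambda>(u, s). (?g u, ?f s)) =
      distr J.\<Omega> (?S \<Otimes>\<^sub>M ?S) (\<lambda>z. (?g (snd z), ?f (fst z)))"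
  proof (subst distr_distr)
    show "(\<lambda>(u, s). (?g u, ?f s)) \<in> J.I \<Otimes>\<^sub>M J.E \<rightarrow>\<^sub>M ?S \<Otimes>\<^sub>M ?S"
      using f g by measurable
  qed (auto simp: comp_def case_prod_unfold)
  finally show ?thesis .
qed

text \<open>The event depends on the two streams alone and may therefore be evaluated in the model,
  where the recovered jump times are almost surely the arrival times.\<close>

lemma measure_occupies:
  "measure P {w \<in> space P. \<forall>(t, y)\<in>set L. occupies c (\<lambda>n. R n w) (\<tau> w) t y} =
    measure J.\<Omega> {z. J.states_at x L z}"
proof -
  let ?S = discrete_streams
  let ?A = "{(\<rho>, \<nu>) \<in> space (?S \<Otimes>\<^sub>M ?S). \<forall>(t, y)\<in>set L. occupies c (\<lambda>n. \<rho> !! n) (\<lambda>i. enn2real (jump_time \<nu> i)) t y}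
    :: ('a stream \<times> nat stream) set"
  have snth_eq: "(!!) (to_stream f) = f" for f :: "nat \<Rightarrow> 'a"
    by (simp add: to_stream_def fun_eq_iff)
  have \<tau>_eq: "\<tau> w = (\<lambda>i. enn2real (jump_time (poisson_stream w) i))" for w
    by (simp add: poisson_times_def[OF prob_space_axioms N] fun_eq_iff)
  have m1: "(\<lambda>p. fst p !! k) \<in> ?S \<Otimes>\<^sub>M ?S \<rightarrow>\<^sub>M count_space UNIV" for k
    by (rule measurable_compose[OF measurable_fst measurable_snth])
  have m2: "(\<lambda>p. enn2real (jump_time (snd p) k)) \<in> borel_measurable (?S \<Otimes>\<^sub>M ?S)" for k
    by (rule measurable_compose[OF measurable_compose[OF measurable_snd measurable_jump_time]]) simp
  have A: "?A \<in> sets (?S \<Otimes>\<^sub>M ?S)"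
  proof -
    have "Measurable.pred (?S \<Otimes>\<^sub>M ?S) (\<lambda>p. \<forall>q\<in>set L. occupies c (\<lambda>n. fst p !! n) (\<lambda>i. enn2real (jump_time (snd p) i)) (fst q) (snd q))"
      by (intro pred_intros_finite measurable_occupies m1 m2) auto
    then show ?thesis by (simp add: pred_def case_prod_unfold)
  qed
  note pair = measurable_Pair[OF measurable_walk_stream measurable_poisson_stream]
  have pair2: "(\<lambda>z. (to_stream (\<lambda>n. J.chain x (snd z) n), to_stream (\<lambda>n. count (arrival (fst z)) (dyadic n)))) \<in>
      J.\<Omega> \<rightarrow>\<^sub>M ?S \<Otimes>\<^sub>M ?S"
    by (intro measurable_Pair measurable_to_stream_discrete) measurable
  have "measure P {w \<in> space P. \<forall>(t, y)\<in>set L. occupies c (\<lambda>n. R n w) (\<tau> w) t y} =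
      measure (distr P (?S \<Otimes>\<^sub>M ?S) (\<lambda>w. (walk_stream w, poisson_stream w))) ?A"
    by (subst measure_distr[OF pair A])
      (auto intro!: arg_cong[where f="measure P"] simp: \<tau>_eq snth_eq space_pair_measure space_stream_space)
  also have "\<dots> = measure J.\<Omega> {z \<in> space J.\<Omega>. \<forall>(t, y)\<in>set L. occupies c (J.chain x (snd z))
      (\<lambda>i. enn2real (jump_time (to_stream (\<lambda>n. count (arrival (fst z)) (dyadic n))) i)) t y}"
    unfolding joint_law
    by (subst measure_distr[OF pair2 A])
      (auto intro!: arg_cong[where f="measure J.\<Omega>"] simp: snth_eq space_pair_measure space_stream_space)
  also have "\<dots> = measure J.\<Omega> {z. J.states_at x L z}"
  proof (rule J.EI.finite_measure_eq_AE)
    show "AE z in J.\<Omega>. (z \<in> {z \<in> space J.\<Omega>. \<forall>(t, y)\<in>set L. occupies c (J.chain x (snd z))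
      (\<lambda>i. enn2real (jump_time (to_stream (\<lambda>n. count (arrival (fst z)) (dyadic n))) i)) t y}) =
      (z \<in> {z. J.states_at x L z})"
      using J.AE_positive_holding C.AE_counting_times
    proof eventually_elim
      case (elim z)
      obtain s u where z: "z = (s, u)" by (cases z)
      have nonneg: "\<And>j. 0 \<le> s !! j" using elim z by (auto intro: less_imp_le)
      have "enn2real (jump_time (to_stream (\<lambda>n. count (arrival s) (dyadic n))) i) = arrival s i" for i
        using jump_time_of_count[of "arrival s" "to_stream (\<lambda>n. count (arrival s) (dyadic n))" i] elim z nonneg
        by (simp add: to_stream_def arrival_def sum_nonneg)
      then show ?case
        unfolding z J.states_at_def using J.state_at_iff_occupies[OF nonneg] by simp
    qed
    show "{z. J.states_at x L z} \<in> sets J.\<Omega>" by (rule J.sets_Collect_\<Omega>) measurable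
    show "{z \<in> space J.\<Omega>. \<forall>(t, y)\<in>set L. occupies c (J.chain x (snd z))
      (\<lambda>i. enn2real (jump_time (to_stream (\<lambda>n. count (arrival (fst z)) (dyadic n))) i)) t y} \<in> sets J.\<Omega>"
      using measurable_sets[OF pair2 A]
      by (rule back_subst[where P="\<lambda>A. A \<in> sets J.\<Omega>"]) (auto simp: snth_eq space_pair_measure space_stream_space)
  qed
  finally show ?thesis .
qed

end

section \<open>The clock and the time change along a single path\<close>

lemma changed_clock_Suc:
  "changed_clock c \<rho> \<tau> (Suc k) = changed_clock c \<rho> \<tau> k + c (\<rho> k) * (\<tau> (Suc k) - \<tau> k)"
  by (simp add: changed_clock_def)

lemma incseq_changed_clock:
  assumes "incseq \<tau>" "\<And>k. 0 < c (\<rho> k)"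
  shows "incseq (changed_clock c \<rho> \<tau>)"
  using assms by (intro incseq_SucI) (simp add: changed_clock_Suc incseq_SucD less_imp_le)

lemma changed_clock_unique:
  assumes "incseq (changed_clock c \<rho> \<tau>)"
    and "changed_clock c \<rho> \<tau> k \<le> t" "t < changed_clock c \<rho> \<tau> (Suc k)"
    and "changed_clock c \<rho> \<tau> l \<le> t" "t < changed_clock c \<rho> \<tau> (Suc l)"
  shows "k = l"
proof (rule ccontr)
  assume "k \<noteq> l"
  then consider "Suc k \<le> l" | "Suc l \<le> k" by linarith
  then show False
    using assms incseqD[OF assms(1)] by cases (meson leD le_less_trans order_trans)+
qed

lemma occupies_unique:
  assumes "incseq (changed_clock c \<rho> \<tau>)" "occupies c \<rho> \<tau> t y" "occupies c \<rho> \<tau> t z"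
  shows "y = z"
  using assms changed_clock_unique[OF assms(1)] unfolding occupies_def by blast

text \<open>Before the total clock is exhausted the state is constant up to the next jump; from then
  on no state is occupied any more.\<close>

lemma occupies_right_constant:
  assumes inc: "incseq \<tau>" and c: "\<And>k. 0 < c (\<rho> k)" and t: "0 \<le> t"
  shows "\<forall>\<^sub>F s in at_right t. occupies c \<rho> \<tau> s y = occupies c \<rho> \<tau> t y"
proof -
  let ?A = "changed_clock c \<rho> \<tau>"
  have incA: "incseq ?A" using inc c by (rule incseq_changed_clock)
  have A0: "?A 0 = 0" by (simp add: changed_clock_def)
  show ?thesis
  proof (cases "\<exists>k. t < ?A k")
    case True
    define k where "k = (LEAST k. t < ?A k)"
    have k: "t < ?A k" using True unfolding k_def by (rule LeastI_ex)
    then obtain j where j: "k = Suc j" using A0 t by (cases k) auto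
    have jt: "?A j \<le> t" using not_less_Least[of j "\<lambda>k. t < ?A k"] j unfolding k_def by simp
    have *: "occupies c \<rho> \<tau> s y \<longleftrightarrow> \<rho> j = y" if "t \<le> s" "s < ?A k" for s
    proof -
      have js: "?A j \<le> s" "s < ?A (Suc j)" using that jt j by auto
      show ?thesis
        unfolding occupies_def using changed_clock_unique[OF incA js] js by blast
    qed
    show ?thesis
      unfolding eventually_at_right_field using k * by (intro exI[of _ "?A k"]) simp
  next
    case False
    then have "\<not> occupies c \<rho> \<tau> s y" if "t \<le> s" for s
      using that unfolding occupies_def by (meson less_le_trans not_less order_trans)
    then show ?thesis
      unfolding eventually_at_right_field by (intro exI[of _ "t + 1"]) simp
  qed
qed

text \<open>A state is occupied at \<open>t\<close> only if some jump comes after \<open>t\<close>,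
  so only finitely many jumps have been made by then.\<close>

lemma occupies_finitely_many_states:
  assumes inc: "incseq \<tau>" and c: "\<And>k. 0 < c (\<rho> k)" and occ: "occupies c \<rho> \<tau> t y"
  shows "\<exists>k. \<forall>s. 0 \<le> s \<longrightarrow> s \<le> t \<longrightarrow> (\<exists>z\<in>\<rho> ` {..k}. occupies c \<rho> \<tau> s z)"
proof -
  let ?A = "changed_clock c \<rho> \<tau>"
  have A0: "?A 0 = 0" by (simp add: changed_clock_def)
  obtain k where k: "t < ?A (Suc k)" using occ by (auto simp: occupies_def)
  have "\<exists>z\<in>\<rho> ` {..k}. occupies c \<rho> \<tau> s z" if s: "0 \<le> s" "s \<le> t" for s
  proof -
    define l where "l = (LEAST l. s < ?A l)"
    have l: "s < ?A l" unfolding l_def by (rule LeastI[of _ "Suc k"]) (use k s in simp)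
    have lk: "l \<le> Suc k" unfolding l_def by (rule Least_le) (use k s in simp)
    obtain j where j: "l = Suc j" using A0 s l by (cases l) auto
    have "?A j \<le> s" using not_less_Least[of j "\<lambda>l. s < ?A l"] j unfolding l_def by simp
    then have "occupies c \<rho> \<tau> s (\<rho> j)" using l j by (auto simp: occupies_def)
    then show ?thesis using lk j by auto
  qed
  then show ?thesis by blast
qed

context
  fixes \<omega> :: "'a measure" and c :: "'a \<Rightarrow> real" and \<rho> :: "nat \<Rightarrow> 'a" and \<tau> :: "nat \<Rightarrow> real"
    and R :: "nat \<Rightarrow> 'p \<Rightarrow> 'a" and N :: "real \<Rightarrow> 'p \<Rightarrow> nat" and w :: 'p
  assumes \<tau>: "counting_times \<tau>" and c: "\<And>k. 0 < c (\<rho> k)"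
    and R: "\<And>n. R n w = \<rho> n" and N: "\<And>t. 0 \<le> t \<Longrightarrow> N t w = count \<tau> t"
    and \<omega>: "\<And>k. emeasure \<omega> {\<rho> k} = ennreal (c (\<rho> k))"
begin

text \<open>The clock as a measure on the time axis: its values follow by additivity from the
  intervals between jumps, where the density is constant.\<close>

definition clock_measure :: "real measure" where
  "clock_measure = density lborel (\<lambda>s. ennreal (c (\<rho> (count \<tau> s))))"

private lemma measurable_rate: "(\<lambda>s. ennreal (c (\<rho> (count \<tau> s)))) \<in> borel_measurable lborel"
proof -
  have "count \<tau> \<in> borel \<rightarrow>\<^sub>M count_space UNIV"
    unfolding count_def by measurable
  from measurable_compose[OF this, of "\<lambda>k. ennreal (c (\<rho> k))" borel] show ?thesis by simp
qed

private lemma inc: "incseq \<tau>" and \<tau>0: "\<tau> 0 = 0"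
  using \<tau> by (auto simp: counting_times_def)

private lemma \<tau>_nonneg: "0 \<le> \<tau> k"
  using incseqD[OF inc, of 0 k] \<tau>0 by simp

private lemma walk_clock_eq:
  assumes "B \<in> sets borel" "B \<subseteq> {0..}"
  shows "walk_clock \<omega> (constant_speed_walk R N) B w = emeasure clock_measure B"
proof -
  have "walk_clock \<omega> (constant_speed_walk R N) B w =
      (\<integral>\<^sup>+s. ennreal (c (\<rho> (count \<tau> s))) * indicator B s \<partial>lborel)"
    unfolding walk_clock_def constant_speed_walk_def
    using assms(2) by (intro nn_integral_cong) (auto simp: R N \<omega> subset_iff split: split_indicator)
  then show ?thesis
    using assms measurable_rate by (simp add: clock_measure_def emeasure_density)
qed

private lemma clock_interval:
  assumes "B \<in> sets borel" "B \<subseteq> {\<tau> k..<\<tau> (Suc k)}"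
  shows "emeasure clock_measure B = ennreal (c (\<rho> k)) * emeasure lborel B"
proof -
  have "emeasure clock_measure B = (\<integral>\<^sup>+s. ennreal (c (\<rho> (count \<tau> s))) * indicator B s \<partial>lborel)"
    using assms measurable_rate by (simp add: clock_measure_def emeasure_density)
  also have "\<dots> = (\<integral>\<^sup>+s. ennreal (c (\<rho> k)) * indicator B s \<partial>lborel)"
  proof (intro nn_integral_cong)
    fix s
    show "ennreal (c (\<rho> (count \<tau> s))) * indicator B s = ennreal (c (\<rho> k)) * indicator B s"
    proof (cases "s \<in> B")
      case True
      then have s: "\<tau> k \<le> s" "s < \<tau> (Suc k)" using assms by auto
      then have "0 \<le> s" using \<tau>_nonneg[of k] by simp
      then have "count \<tau> s = k" using count_eq_iff[OF \<tau>] s by blast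
      then show ?thesis by simp
    qed simp
  qed
  finally show ?thesis using assms by (simp add: nn_integral_cmult)
qed

private lemma clock_upto_jump: "emeasure clock_measure {0..<\<tau> k} = ennreal (changed_clock c \<rho> \<tau> k)"
proof (induction k)
  case 0
  then show ?case by (simp add: \<tau>0 changed_clock_def)
next
  case (Suc k)
  have le: "\<tau> k \<le> \<tau> (Suc k)" using inc by (simp add: incseq_SucD)
  have nn: "0 \<le> changed_clock c \<rho> \<tau> k"
    using incseqD[OF incseq_changed_clock[where c=c and \<rho>=\<rho>, OF inc c], of 0 k] by (simp add: changed_clock_def)
  have "{0..<\<tau> (Suc k)} = {0..<\<tau> k} \<union> {\<tau> k..<\<tau> (Suc k)}"
    using le \<tau>_nonneg[of k] by auto
  then have "emeasure clock_measure {0..<\<tau> (Suc k)} =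
      emeasure clock_measure {0..<\<tau> k} + emeasure clock_measure {\<tau> k..<\<tau> (Suc k)}"
    by (simp only:, intro plus_emeasure[symmetric]) (auto simp: clock_measure_def)
  also have "\<dots> = ennreal (changed_clock c \<rho> \<tau> k) + ennreal (c (\<rho> k) * (\<tau> (Suc k) - \<tau> k))"
    using le c[of k] clock_interval[of "{\<tau> k..<\<tau> (Suc k)}" k] by (simp add: Suc.IH ennreal_mult)
  also have "\<dots> = ennreal (changed_clock c \<rho> \<tau> (Suc k))"
    using nn le c[of k] by (simp add: changed_clock_Suc ennreal_plus)
  finally show ?case .
qed

private lemma clock_upto:
  assumes "\<tau> k \<le> s" "s < \<tau> (Suc k)"
  shows "emeasure clock_measure {0..s} = ennreal (changed_clock c \<rho> \<tau> k + c (\<rho> k) * (s - \<tau> k))"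
proof -
  have nn: "0 \<le> changed_clock c \<rho> \<tau> k"
    using incseqD[OF incseq_changed_clock[where c=c and \<rho>=\<rho>, OF inc c], of 0 k] by (simp add: changed_clock_def)
  have "{0..s} = {0..<\<tau> k} \<union> {\<tau> k..s}"
    using assms \<tau>_nonneg[of k] by auto
  then have "emeasure clock_measure {0..s} =
      emeasure clock_measure {0..<\<tau> k} + emeasure clock_measure {\<tau> k..s}"
    by (simp only:, intro plus_emeasure[symmetric]) (auto simp: clock_measure_def)
  also have "emeasure clock_measure {\<tau> k..s} = ennreal (c (\<rho> k) * (s - \<tau> k))"
    using assms c[of k] by (subst clock_interval[of _ k]) (auto simp: ennreal_mult)
  also have "emeasure clock_measure {0..<\<tau> k} + ennreal (c (\<rho> k) * (s - \<tau> k)) =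
      ennreal (changed_clock c \<rho> \<tau> k + c (\<rho> k) * (s - \<tau> k))"
    unfolding clock_upto_jump using nn assms c[of k] by (intro ennreal_plus[symmetric]) auto
  finally show ?thesis .
qed

text \<open>The lifetime of \<open>Y\<close> is thus the limit of its jump times, that is, its
  explosion time.\<close>

private lemma clock_total: "emeasure clock_measure {0..} = (SUP k. ennreal (changed_clock c \<rho> \<tau> k))"
proof -
  have "{0..} = (\<Union>k. {0..<\<tau> k})"
    using \<tau> by (auto simp: counting_times_def)
  moreover have "incseq (\<lambda>k. {0..<\<tau> k})"
    by (intro incseq_SucI) (use incseq_SucD[OF inc] in \<open>force intro: less_le_trans\<close>)
  moreover have "range (\<lambda>k. {0..<\<tau> k}) \<subseteq> sets clock_measure"
    by (auto simp: clock_measure_def)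
  ultimately show ?thesis
    using SUP_emeasure_incseq[of "\<lambda>k. {0..<\<tau> k}" clock_measure] by (simp add: clock_upto_jump)
qed

text \<open>Between two jumps the clock runs at the constant positive speed
  \<open>c (\<rho> k)\<close>, so its right-continuous inverse is explicit.\<close>

lemma time_changed_walk_eq_Some_iff:
  "time_changed_walk \<omega> (constant_speed_walk R N) t w = Some p \<longleftrightarrow>
     t < \<infinity> \<and> (\<exists>y. p = Inner y \<and> occupies c \<rho> \<tau> (enn2real t) y)"
proof -
  let ?A = "changed_clock c \<rho> \<tau>" and ?X = "constant_speed_walk R N"
  have incA: "incseq ?A" using inc c by (rule incseq_changed_clock)
  have A0: "?A 0 = 0" by (simp add: changed_clock_def)
  have total: "walk_clock \<omega> ?X {0..} w = (SUP k. ennreal (?A k))"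
    using walk_clock_eq[of "{0..}"] clock_total by simp
  show ?thesis
  proof (cases "t < walk_clock \<omega> ?X {0..} w")
    case False
    have "\<not> (t < \<infinity> \<and> (\<exists>y. occupies c \<rho> \<tau> (enn2real t) y))"
    proof
      assume *: "t < \<infinity> \<and> (\<exists>y. occupies c \<rho> \<tau> (enn2real t) y)"
      then obtain k where "enn2real t < ?A (Suc k)" by (auto simp: occupies_def)
      then have "t < ennreal (?A (Suc k))" using * by (cases t) (auto simp: ennreal_less_iff)
      also have "\<dots> \<le> (SUP k. ennreal (?A k))" by (rule SUP_upper) simp
      finally show False using False total by simp
    qed
    then show ?thesis using False by (auto simp: time_changed_walk_def)
  next
    case True
    then obtain k' where k': "t < ennreal (?A k')" unfolding total less_SUP_iff by blast
    then obtain r where r: "t = ennreal r" "0 \<le> r" by (cases t) (auto simp: top.not_eq_extremum)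
    define l where "l = (LEAST l. r < ?A l)"
    have "r < ?A k'" using k' r by (simp add: ennreal_less_iff)
    then have l: "r < ?A l" unfolding l_def by (rule LeastI)
    then obtain k where k: "l = Suc k" using A0 r(2) by (cases l) auto
    have kr: "?A k \<le> r" "r < ?A (Suc k)"
      using not_less_Least[of k "\<lambda>l. r < ?A l"] l k unfolding l_def by auto
    \<comment> \<open>At this time the clock shows exactly \<open>t\<close>: since the last jump it
      has advanced by \<open>r - ?A k\<close> at speed \<open>c (\<rho> k)\<close>.\<close>
    define s where "s = \<tau> k + (r - ?A k) / c (\<rho> k)"
    have s: "\<tau> k \<le> s" "s < \<tau> (Suc k)"
    proof -
      show "\<tau> k \<le> s" using kr c[of k] by (simp add: s_def)
      have "(r - ?A k) / c (\<rho> k) < \<tau> (Suc k) - \<tau> k"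
        using kr(2) c[of k] by (simp add: changed_clock_Suc field_simps)
      then show "s < \<tau> (Suc k)" by (simp add: s_def)
    qed
    have s0: "0 \<le> s" using s \<tau>_nonneg[of k] by simp
    have K: "walk_clock \<omega> ?X {0..u} w = emeasure clock_measure {0..u}" for u
      by (rule walk_clock_eq) auto
    have mono: "emeasure clock_measure {0..u} \<le> emeasure clock_measure {0..v}" if "u \<le> v" for u v
      using that by (intro emeasure_mono) (auto simp: clock_measure_def)
    have Ks: "emeasure clock_measure {0..s} = t"
      using clock_upto[OF s] c[of k] r by (simp add: s_def)
    have "{u. 0 \<le> u \<and> t < walk_clock \<omega> ?X {0..u} w} = {s<..}"
    proof (intro Set.set_eqI iffI)
      fix u assume u: "u \<in> {u. 0 \<le> u \<and> t < walk_clock \<omega> ?X {0..u} w}"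
      show "u \<in> {s<..}"
      proof (rule ccontr)
        assume "u \<notin> {s<..}"
        then have "walk_clock \<omega> ?X {0..u} w \<le> t" using mono[of u s] Ks K[of u] by simp
        moreover have "t < walk_clock \<omega> ?X {0..u} w" using u by simp
        ultimately show False by (rule leD[THEN notE])
      qed
    next
      fix u assume u: "u \<in> {s<..}"
      \<comment> \<open>The time \<open>u\<close> may lie beyond the next jump. \<open>v\<close>
        lies between \<open>s\<close> and \<open>u\<close> and before that jump, where the clock is
        explicit and has strictly passed \<open>t\<close>; monotonicity does the rest.\<close>
      define v where "v = min u ((s + \<tau> (Suc k)) / 2)"
      have v: "s < v" "v \<le> u" "v < \<tau> (Suc k)" using u s by (auto simp: v_def min_def)
      have "t = ennreal (?A k + c (\<rho> k) * (s - \<tau> k))"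
        using clock_upto[OF s] Ks by simp
      also have "\<dots> < ennreal (?A k + c (\<rho> k) * (v - \<tau> k))"
        using v s kr r c[of k] incseqD[OF incA, of 0 k] A0
        by (intro ennreal_lessI add_strict_left_mono mult_strict_left_mono) (auto intro!: add_nonneg_pos)
      also have "\<dots> = emeasure clock_measure {0..v}"
        using clock_upto[of k v] v s by simp
      also have "\<dots> \<le> emeasure clock_measure {0..u}" using mono v by simp
      finally show "u \<in> {u. 0 \<le> u \<and> t < walk_clock \<omega> ?X {0..u} w}"
        using u s0 K[of u] by simp
    qed
    then have "time_changed_walk \<omega> ?X t w = Some (Inner (?X s w))"
      using True by (simp add: time_changed_walk_def)
    also have "?X s w = \<rho> k"
      using count_eq_iff[OF \<tau> s0, of k] s s0 by (simp add: constant_speed_walk_def R N)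
    finally have "time_changed_walk \<omega> ?X t w = Some (Inner (\<rho> k))" .
    moreover have occ: "occupies c \<rho> \<tau> r (\<rho> k)" using kr by (auto simp: occupies_def)
    moreover have "enn2real t = r" using r by simp
    moreover have "t < \<infinity>" using r by simp
    moreover have "y = \<rho> k" if "occupies c \<rho> \<tau> r y" for y
      using occupies_unique[OF incA that occ] .
    ultimately show ?thesis by (metis option.inject)
  qed
qed

end

lemma incseq_finite_subset:
  assumes "incseq K" "finite A" "A \<subseteq> (\<Union>n. K n)"
  shows "\<exists>n. A \<subseteq> K n"
  using assms(2,3)
proof (induction A)
  case (insert a A)
  then obtain n m where "A \<subseteq> K n" "a \<in> K m" by auto
  then show ?case
    using incseqD[OF assms(1), of n "max n m"] incseqD[OF assms(1), of m "max n m"] by (intro exI[of _ "max n m"]) auto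
qed simp

section \<open>The killed walk as a skeleton process\<close>

context walk_setup begin

text \<open>Defined from the recovered jump times rather than from \<open>N\<close>, so that it
  depends on countably many random variables and is measurable; almost surely it describes
  \<open>Y\<close>. The condition \<open>counting_times\<close> makes the occupied state unique on
  every path.\<close>

definition killed_walk :: "real \<Rightarrow> 'p \<Rightarrow> 'a option" where
  "killed_walk t w = (if counting_times (\<tau> w) \<and> (\<exists>y. occupies c (\<lambda>n. R n w) (\<tau> w) t y)
     then Some (THE y. occupies c (\<lambda>n. R n w) (\<tau> w) t y) else None)"

lemma incseq_clock: "counting_times (\<tau> w) \<Longrightarrow> incseq (changed_clock c (\<lambda>n. R n w) (\<tau> w))"
  by (intro incseq_changed_clock c) (simp add: counting_times_def)

lemma killed_walk_eq_Some_iff: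
  "killed_walk t w = Some y \<longleftrightarrow> counting_times (\<tau> w) \<and> occupies c (\<lambda>n. R n w) (\<tau> w) t y"
proof (cases "counting_times (\<tau> w) \<and> (\<exists>y. occupies c (\<lambda>n. R n w) (\<tau> w) t y)")
  case True
  then obtain z where z: "occupies c (\<lambda>n. R n w) (\<tau> w) t z" by blast
  have u: "y = z" if "occupies c (\<lambda>n. R n w) (\<tau> w) t y" for y
    using occupies_unique[OF incseq_clock that z] True by blast
  then have "(THE y. occupies c (\<lambda>n. R n w) (\<tau> w) t y) = z"
    using z by (intro the_equality u)
  then have "killed_walk t w = Some z" using True by (simp add: killed_walk_def)
  then show ?thesis using True z u by (metis option.inject)
qed (auto simp: killed_walk_def)

lemma measurable_\<tau> [measurable]: "(\<lambda>w. \<tau> w k) \<in> borel_measurable P"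
  unfolding poisson_times_def[OF prob_space_axioms N]
  by (rule measurable_compose[OF measurable_compose[OF measurable_poisson_stream measurable_jump_time]]) simp

lemma measurable_counting_times: "Measurable.pred P (\<lambda>w. counting_times (\<tau> w))"
proof -
  \<comment> \<open>Natural thresholds replace the uncountably many real ones.\<close>
  have "counting_times \<sigma> \<longleftrightarrow> (\<forall>k. \<sigma> k \<le> \<sigma> (Suc k)) \<and> \<sigma> 0 = 0 \<and> (\<forall>n::nat. \<exists>k. real n < \<sigma> k)" for \<sigma> :: "nat \<Rightarrow> real"
  proof -
    have "(\<forall>n::nat. \<exists>k. real n < \<sigma> k) \<Longrightarrow> \<exists>k. t < \<sigma> k" for t
      by (meson le_less_trans real_arch_simple)
    then show ?thesis unfolding counting_times_def incseq_Suc_iff by blast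
  qed
  then show ?thesis by simp
qed

lemma AE_\<tau>: "AE w in P. counting_times (\<tau> w) \<and> (\<forall>t\<ge>0. N t w = count (\<tau> w) t)"
  by (rule AE_poisson_times[OF prob_space_axioms N])

lemma occupies_carrier: "w \<in> space P \<Longrightarrow> occupies c (\<lambda>n. R n w) (\<tau> w) t y \<Longrightarrow> y \<in> carrier G"
  using R_carrier by (auto simp: occupies_def)

lemma skeleton_process_killed_walk:
  "skeleton_process P killed_walk (carrier G) J.transition x"
proof
  show "{w \<in> space P. killed_walk t w = Some y} \<in> sets P" for t y
  proof -
    have "Measurable.pred P (\<lambda>w. occupies c (\<lambda>n. R n w) (\<tau> w) t y)"
      by (rule measurable_occupies) measurable
    then show ?thesis
      unfolding killed_walk_eq_Some_iff using measurable_counting_times by measurable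
  qed
  show "killed_walk t w \<in> insert None (Some ` carrier G)" if "w \<in> space P" for t w
    using killed_walk_eq_Some_iff[of t w] occupies_carrier[OF that] by (cases "killed_walk t w") auto
  show "AE w in P. \<forall>t\<ge>0. \<forall>y\<in>carrier G. \<forall>\<^sub>F s in at_right t. (killed_walk s w = Some y) = (killed_walk t w = Some y)"
    using AE_\<tau>
  proof eventually_elim
    case (elim w)
    then have "incseq (\<tau> w)" by (simp add: counting_times_def)
    from occupies_right_constant[where c=c, OF this c] show ?case
      unfolding killed_walk_eq_Some_iff using elim by simp
  qed
  show "measure P {w \<in> space P. \<forall>j\<le>length ys. killed_walk (real j * h) w = Some ((x # ys) ! j)} =
      path_weight (J.transition h) x ys" if h: "0 < h" and ys: "set ys \<subseteq> carrier G" for h ys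
  proof -
    let ?L = "map (\<lambda>j. (real j * h, (x # ys) ! j)) [0..<Suc (length ys)]"
    have set_L: "(\<forall>(t, y)\<in>set ?L. Q t y) \<longleftrightarrow> (\<forall>j\<le>length ys. Q (real j * h) ((x # ys) ! j))" for Q
      by (auto simp del: upt_Suc simp add: less_Suc_eq_le)
    have occ: "Measurable.pred P (\<lambda>w. occupies c (\<lambda>n. R n w) (\<tau> w) t y)" for t y
      by (rule measurable_occupies) measurable
    have "measure P {w \<in> space P. \<forall>j\<le>length ys. killed_walk (real j * h) w = Some ((x # ys) ! j)} =
        measure P {w \<in> space P. \<forall>(t, y)\<in>set ?L. occupies c (\<lambda>n. R n w) (\<tau> w) t y}"
    proof (rule finite_measure_eq_AE)
      show "AE w in P. (w \<in> {w \<in> space P. \<forall>j\<le>length ys. killed_walk (real j * h) w = Some ((x # ys) ! j)}) =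
          (w \<in> {w \<in> space P. \<forall>(t, y)\<in>set ?L. occupies c (\<lambda>n. R n w) (\<tau> w) t y})"
        using AE_\<tau> unfolding set_L killed_walk_eq_Some_iff by eventually_elim simp
      show "{w \<in> space P. \<forall>j\<le>length ys. killed_walk (real j * h) w = Some ((x # ys) ! j)} \<in> sets P"
        unfolding killed_walk_eq_Some_iff using measurable_counting_times occ by measurable
      show "{w \<in> space P. \<forall>(t, y)\<in>set ?L. occupies c (\<lambda>n. R n w) (\<tau> w) t y} \<in> sets P"
        unfolding set_L using occ by measurable
    qed
    also have "\<dots> = measure J.\<Omega> {z. J.states_at x ?L z}"
      by (rule measure_occupies)
    also have "\<dots> = path_weight (J.transition h) x ys"
      unfolding J.states_at_def set_L by (rule J.measure_skeleton[OF h])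
    finally show ?thesis .
  qed
qed (auto simp: J.transition_nonneg J.sum_transition_le_1 x)

lemma transition_derivative:
  assumes "y \<in> carrier G" "z \<in> carrier G"
  shows "((\<lambda>h. (J.transition h y z - of_bool (z = y)) / h) \<longlongrightarrow>
    (pmf \<mu> (inv\<^bsub>G\<^esub> y \<otimes>\<^bsub>G\<^esub> z) - of_bool (z = y)) / c y) (at_right 0)"
  using J.transition_derivative[of y z] measure_coded_step[OF G \<mu> assms] by simp

text \<open>\<open>Y\<close> never takes a value on the boundary, so it leaves the group only by
  dying. While it is alive it has visited finitely many states, which confines it to some
  \<open>K n\<close>.\<close>

lemma AE_path_before_exit:
  assumes \<omega>: "\<And>y. y \<in> carrier G \<Longrightarrow> emeasure \<omega> {y} = ennreal (c y)"
    and K: "incseq K" "(\<Union>n. K n) = carrier G"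
  shows "AE w in P. path_before_exit G (time_changed_walk \<omega> (constant_speed_walk R N)) w =
    (\<lambda>t. map_option Inner (killed K killed_walk t w))"
  using AE_\<tau> AE_space
proof eventually_elim
  case (elim w)
  let ?\<rho> = "\<lambda>n. R n w"
  let ?Y = "\<lambda>t. time_changed_walk \<omega> (constant_speed_walk R N) t w"
  have ct: "counting_times (\<tau> w)" and inc: "incseq (\<tau> w)" and w: "w \<in> space P"
    using elim by (auto simp: counting_times_def)
  have Y: "?Y t = Some p \<longleftrightarrow> t < \<infinity> \<and> (\<exists>y. p = Inner y \<and> occupies c ?\<rho> (\<tau> w) (enn2real t) y)" for t p
    using elim by (intro time_changed_walk_eq_Some_iff[where c=c and \<rho>="?\<rho>", OF ct]) (auto simp: c R_carrier \<omega>)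
  have confined: "\<exists>n. confined killed_walk (K n) t w" if occ: "occupies c ?\<rho> (\<tau> w) t y" for t y
  proof -
    obtain k where k: "\<And>s. 0 \<le> s \<Longrightarrow> s \<le> t \<Longrightarrow> \<exists>z\<in>?\<rho> ` {..k}. occupies c ?\<rho> (\<tau> w) s z"
      using occupies_finitely_many_states[where c=c and \<rho>="?\<rho>", OF inc c occ] by blast
    obtain n where n: "?\<rho> ` {..k} \<subseteq> K n"
      using incseq_finite_subset[OF K(1), of "?\<rho> ` {..k}"] K(2) R_carrier[OF w] by auto
    have "confined killed_walk (K n) t w"
      unfolding confined_def
    proof (intro allI impI)
      fix j m assume "real j / 2 ^ m \<le> t"
      then obtain z where "z \<in> ?\<rho> ` {..k}" "occupies c ?\<rho> (\<tau> w) (real j / 2 ^ m) z"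
        using k[of "real j / 2 ^ m"] by auto
      then show "killed_walk (real j / 2 ^ m) w \<in> Some ` K n"
        using n ct by (auto simp: image_iff intro!: bexI[of _ z] simp: killed_walk_eq_Some_iff)
    qed
    then show ?thesis by blast
  qed
  have killed_iff: "killed K killed_walk t w = Some y \<longleftrightarrow> t < \<infinity> \<and> occupies c ?\<rho> (\<tau> w) (enn2real t) y" for t y
    unfolding killed_eq_Some_iff killed_walk_eq_Some_iff using ct confined by blast
  have before_exit: "t < exit_time G (time_changed_walk \<omega> (constant_speed_walk R N)) w"
    if t: "t < \<infinity>" and occ: "occupies c ?\<rho> (\<tau> w) (enn2real t) y" for t y
  proof -
    have "\<forall>\<^sub>F s in at_right (enn2real t). occupies c ?\<rho> (\<tau> w) s y"
      using occupies_right_constant[where c=c and \<rho>="?\<rho>", OF inc c, of "enn2real t" y] occ by simp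
    then obtain b where b: "enn2real t < b" "\<And>s. enn2real t < s \<Longrightarrow> s < b \<Longrightarrow> occupies c ?\<rho> (\<tau> w) s y"
      by (auto simp: eventually_at_right_field)
    \<comment> \<open>The infimum that defines the exit time has to exceed \<open>t\<close>
      strictly, so the path is followed up to a slightly later time at which it is still
      alive.\<close>
    define u where "u = (enn2real t + b) / 2"
    have u: "enn2real t < u" "u < b" using b(1) by (auto simp: u_def)
    have u0: "0 \<le> u" using u by (meson enn2real_nonneg less_imp_le order_trans)
    have occ_u: "occupies c ?\<rho> (\<tau> w) u y" using b(2)[OF u] .
    obtain k where k: "\<And>s. 0 \<le> s \<Longrightarrow> s \<le> u \<Longrightarrow> \<exists>z\<in>?\<rho> ` {..k}. occupies c ?\<rho> (\<tau> w) s z"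
      using occupies_finitely_many_states[where c=c and \<rho>="?\<rho>", OF inc c occ_u] by blast
    have "ennreal u \<le> exit_time G (time_changed_walk \<omega> (constant_speed_walk R N)) w"
      unfolding exit_time_def
    proof (rule Inf_greatest, rule ccontr)
      fix s assume s: "s \<in> {t. 0 < t \<and> ?Y t \<notin> Some ` Inner ` carrier G}" and "\<not> ennreal u \<le> s"
      then have su: "s < ennreal u" by simp
      then have fin: "s < \<infinity>" "enn2real s \<le> u"
        using u0 by (auto intro: enn2real_leI less_imp_le simp: less_top[symmetric] dest: less_trans)
      then obtain z where z: "occupies c ?\<rho> (\<tau> w) (enn2real s) z" using k[of "enn2real s"] by auto
      then have "?Y s = Some (Inner z)" using Y fin by simp
      then show False using s occupies_carrier[OF w z] by auto
    qed
    moreover have "t < ennreal u"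
      using u(1) t by (cases t) (auto simp: ennreal_lessI)
    ultimately show ?thesis by (rule less_le_trans[rotated])
  qed
  show ?case
  proof
    fix t
    show "path_before_exit G (time_changed_walk \<omega> (constant_speed_walk R N)) w t = map_option Inner (killed K killed_walk t w)"
    proof (cases "killed K killed_walk t w")
      case None
      then have "?Y t = None"
      proof -
        have "?Y t \<noteq> Some p" for p
          unfolding Y[of t p] using None killed_iff[of t] by auto
        then show ?thesis by (cases "?Y t") blast+
      qed
      then show ?thesis using None by (simp add: path_before_exit_def)
    next
      case (Some y)
      then have *: "t < \<infinity>" "occupies c ?\<rho> (\<tau> w) (enn2real t) y" using killed_iff[of t y] by simp_all
      then have "?Y t = Some (Inner y)" unfolding Y by blast
      then show ?thesis
        using before_exit[OF *] Some by (simp add: path_before_exit_def)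
    qed
  qed
qed

end

section \<open>The reflecting walk\<close>

lemma space_borel_of: "space (borel_of X) = topspace X"
  unfolding borel_of_def by (rule space_measure_of) (auto dest: openin_subset)

lemma sets_borel_of_open: "openin X U \<Longrightarrow> U \<in> sets (borel_of X)"
  unfolding borel_of_def by (subst sets_measure_of) (auto dest: openin_subset)

lemma has_sum_pmf: "(pmf p has_sum measure p B) B"
proof -
  have "Infinite_Sum.abs_summable_on (pmf p) B"
    using pmf_abs_summable abs_summable_equivalent by blast
  then have "pmf p summable_on B" by (rule abs_summable_summable)
  moreover have "infsum (pmf p) B = measure p B"
    using infsetsum_infsum[OF pmf_abs_summable, of p B] measure_pmf_conv_infsetsum[of p B] by simp
  ultimately show ?thesis using has_sum_infsum by metis
qed

section \<open>Word length and the topology of the compactification\<close>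

locale marked_group = group G for G (structure) +
  fixes S
  assumes gens: "finite_symmetric_generators G S"
begin

abbreviation word_value :: "'a list \<Rightarrow> 'a" where
  "word_value ws \<equiv> foldr (\<otimes>) ws \<one>"

lemma gens_carrier: "S \<subseteq> carrier G"
  using gens by (simp add: finite_symmetric_generators_def)

lemma word_value_closed: "set ws \<subseteq> S \<Longrightarrow> word_value ws \<in> carrier G"
  using gens_carrier by (induction ws) auto

lemma word_value_append:
  "set ws \<subseteq> S \<Longrightarrow> set vs \<subseteq> S \<Longrightarrow> word_value (ws @ vs) = word_value ws \<otimes> word_value vs"
proof (induction ws)
  case (Cons a ws)
  then show ?case
    using gens_carrier word_value_closed[of ws] word_value_closed[of vs] by (auto simp: m_assoc)
qed (simp add: word_value_closed)

lemma ex_word: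
  assumes "x \<in> carrier G"
  shows "\<exists>ws. set ws \<subseteq> S \<and> word_value ws = x"
proof -
  have "x \<in> generate G S"
    using assms gens by (simp add: finite_symmetric_generators_def)
  then show ?thesis
  proof induction
    case one
    then show ?case by (intro exI[of _ "[]"]) simp
  next
    case (incl h)
    then show ?case using gens_carrier by (intro exI[of _ "[h]"]) auto
  next
    case (inv h)
    then have "inv h \<in> S" using gens by (simp add: finite_symmetric_generators_def)
    then show ?case using gens_carrier by (intro exI[of _ "[inv h]"]) auto
  next
    case (eng h1 h2)
    then obtain ws vs where "set ws \<subseteq> S" "word_value ws = h1" "set vs \<subseteq> S" "word_value vs = h2" by auto
    then show ?case by (intro exI[of _ "ws @ vs"]) (simp add: word_value_append del: foldr_append)
  qed
qed

lemma countable_carrier: "countable (carrier G)"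
proof -
  have "countable S"
    using gens by (simp add: finite_symmetric_generators_def countable_finite)
  then have "countable (word_value ` lists S)" by simp
  moreover have "carrier G \<subseteq> word_value ` lists S"
    using ex_word by (fastforce simp: in_lists_conv_set subset_iff)
  ultimately show ?thesis by (rule countable_subset[rotated])
qed

lemma word_length_le: "set ws \<subseteq> S \<Longrightarrow> word_length G S (word_value ws) \<le> length ws"
  unfolding word_length_def by (rule Least_le) blast

lemma ex_geodesic_word:
  assumes "x \<in> carrier G"
  shows "\<exists>ws. set ws \<subseteq> S \<and> length ws = word_length G S x \<and> word_value ws = x"
proof -
  obtain ws where "set ws \<subseteq> S" "word_value ws = x" using ex_word[OF assms] by blast
  then have "\<exists>ws'. set ws' \<subseteq> S \<and> length ws' = length ws \<and> word_value ws' = x" by blast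
  then show ?thesis
    unfolding word_length_def by (rule LeastI)
qed

lemma word_length_mult:
  assumes "x \<in> carrier G" "y \<in> carrier G"
  shows "word_length G S (x \<otimes> y) \<le> word_length G S x + word_length G S y"
proof -
  obtain ws vs where w: "set ws \<subseteq> S" "length ws = word_length G S x" "word_value ws = x"
    and v: "set vs \<subseteq> S" "length vs = word_length G S y" "word_value vs = y"
    using ex_geodesic_word assms by metis
  then show ?thesis
    using word_length_le[of "ws @ vs"] by (simp add: word_value_append del: foldr_append)
qed

lemma word_length_inv:
  assumes "x \<in> carrier G"
  shows "word_length G S (inv x) \<le> word_length G S x"
proof -
  obtain ws where ws: "set ws \<subseteq> S" "length ws = word_length G S x" "word_value ws = x"
    using ex_geodesic_word[OF assms] by blast
  have inv_S: "inv s \<in> S" if "s \<in> S" for s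
    using that gens by (simp add: finite_symmetric_generators_def)
  have "set (rev (map (\<lambda>s. inv s) vs)) \<subseteq> S \<and> word_value (rev (map (\<lambda>s. inv s) vs)) = inv (word_value vs)"
    if "set vs \<subseteq> S" for vs
    using that
  proof (induction vs)
    case (Cons a vs)
    then have "a \<in> S" "a \<in> carrier G" "set vs \<subseteq> S" using gens_carrier by auto
    then show ?case
      using Cons.IH inv_S word_value_closed[of vs] word_value_append[of "rev (map (\<lambda>s. inv s) vs)" "[inv a]"]
      by (simp add: inv_mult_group del: foldr_append)
  qed simp
  from this[OF ws(1)] show ?thesis
    using word_length_le[of "rev (map (\<lambda>s. inv s) ws)"] ws by simp
qed

text \<open>The triangle inequality for the word length, applied to \<open>u\<close> as the product
  of \<open>z\<close> and the inverse of \<open>inv u \<otimes> z\<close>.\<close>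

lemma gromov_product_le:
  assumes "u \<in> carrier G" "z \<in> carrier G"
  shows "gromov_product G S \<one> u z \<le> real (word_length G S z)"
proof -
  have "u = z \<otimes> inv (inv u \<otimes> z)"
    using assms by (simp add: inv_mult_group m_assoc[symmetric])
  then have "word_length G S u \<le> word_length G S z + word_length G S (inv (inv u \<otimes> z))"
    using word_length_mult[of z "inv (inv u \<otimes> z)"] assms by simp
  also have "\<dots> \<le> word_length G S z + word_length G S (inv u \<otimes> z)"
    using word_length_inv[of "inv u \<otimes> z"] assms by simp
  finally show ?thesis
    using assms unfolding gromov_product_def word_dist_def by simp
qed

text \<open>The bound does not depend on \<open>\<xi>\<close>: a point of the group stays away from
  all boundary points, so that its singleton is closed as well as open.\<close>

lemma gromov_product_ext_Inner_le:
  assumes "\<xi> \<in> gromov_boundary G S" "z \<in> carrier G"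
  shows "gromov_product_ext G S (Boundary \<xi>) (Inner z) \<le> ereal (real (word_length G S z))"
  unfolding gromov_product_ext_def
proof (rule SUP_least, clarsimp)
  fix u assume u: "u \<in> \<xi>"
  then have "gromov_sequence G S u"
    using assms(1) by (auto simp: gromov_boundary_def quotient_def gromov_rel_def)
  then have "u i \<in> carrier G" for i by (simp add: gromov_sequence_def)
  then show "Liminf (sequentially \<times>\<^sub>F sequentially) (\<lambda>(i, j). ereal (gromov_product G S \<one> (u i) z))
      \<le> ereal (real (word_length G S z))"
    using gromov_product_le assms(2)
    by (intro Liminf_le) (auto simp: prod_filter_eq_bot intro!: always_eventually)
qed

abbreviation T :: "'a point topology" where
  "T \<equiv> gromov_compactification G S"

abbreviation A :: "'a point option topology" where
  "A \<equiv> Alexandroff_compactification T"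

abbreviation pt :: "'a \<Rightarrow> 'a point option" where
  "pt y \<equiv> Some (Inner y)"

lemma Inner_in_compact_points: "Inner y \<in> compact_points G S \<longleftrightarrow> y \<in> carrier G"
  by (auto simp: compact_points_def)

lemma openin_T_Inner: "y \<in> carrier G \<Longrightarrow> openin T {Inner y}"
  by (simp add: openin_gromov_compactification compactification_open_def compact_points_def)

lemma openin_T_minus_Inner:
  assumes "y \<in> carrier G"
  shows "openin T (compact_points G S - {Inner y})"
  unfolding openin_gromov_compactification compactification_open_def
proof (intro conjI allI impI)
  fix \<xi> assume "Boundary \<xi> \<in> compact_points G S - {Inner y}"
  then have \<xi>: "\<xi> \<in> gromov_boundary G S" by (auto simp: compact_points_def)
  show "\<exists>r::real. \<forall>z\<in>compact_points G S. gromov_product_ext G S (Boundary \<xi>) z > ereal r \<longrightarrow>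
      z \<in> compact_points G S - {Inner y}"
    using gromov_product_ext_Inner_le[OF \<xi> assms]
    by (intro exI[of _ "real (word_length G S y)"]) (auto dest: leD)
qed auto

lemma openin_A_pt: "y \<in> carrier G \<Longrightarrow> openin A {pt y}"
  using openin_Alexandroff_compactification_image_Some[of T "{Inner y}"] openin_T_Inner[of y] by simp

lemma openin_A_minus_pt:
  assumes "y \<in> carrier G"
  shows "openin A (topspace A - {pt y})"
proof -
  have "closedin T {Inner y}"
    using openin_T_minus_Inner[OF assms] Inner_in_compact_points[of y] assms by (simp add: closedin_def)
  moreover have "compactin T {Inner y}"
    using Inner_in_compact_points[of y] assms by simp
  ultimately have "closedin A (Some ` {Inner y})"
    using closedin_Alexandroff_compactification by blast
  then show ?thesis by (simp add: closedin_def)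
qed

lemma topspace_A_pt: "pt y \<in> topspace A \<longleftrightarrow> y \<in> carrier G"
  by (auto simp: compact_points_def)

section \<open>Dirichlet energy of indicators of points\<close>

lemma has_sum_pmf_translate:
  assumes \<mu>: "set_pmf \<mu> \<subseteq> carrier G" and y: "y \<in> carrier G"
  shows "((\<lambda>b. pmf \<mu> (inv y \<otimes> b)) has_sum (1 - pmf \<mu> \<one>)) (carrier G - {y})"
proof -
  have bij: "bij_betw (\<lambda>b. inv y \<otimes> b) (carrier G - {y}) (carrier G - {\<one>})"
  proof (rule bij_betwI[where g="\<lambda>b. y \<otimes> b"])
    show "(\<lambda>b. inv y \<otimes> b) \<in> carrier G - {y} \<rightarrow> carrier G - {\<one>}"
    proof (intro Pi_I)
      fix b assume b: "b \<in> carrier G - {y}"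
      have "inv y \<otimes> b \<noteq> \<one>"
      proof
        assume "inv y \<otimes> b = \<one>"
        then have "b = y \<otimes> \<one>" using y b by (metis DiffD1 inv_solve_left one_closed)
        then show False using b y by simp
      qed
      then show "inv y \<otimes> b \<in> carrier G - {\<one>}" using b y by simp
    qed
    show "(\<lambda>b. y \<otimes> b) \<in> carrier G - {\<one>} \<rightarrow> carrier G - {y}"
      using y by (auto simp: r_cancel_one' r_cancel_one l_cancel_one)
  qed (use y in \<open>auto simp: m_assoc[symmetric]\<close>)
  have "measure \<mu> (carrier G - {\<one>}) = 1 - pmf \<mu> \<one>"
  proof -
    have "measure \<mu> (carrier G) = 1"
      using \<mu> by (intro measure_pmf.prob_eq_1[THEN iffD2]) (auto intro: AE_pmfI)
    moreover have "measure \<mu> (carrier G) = measure \<mu> (carrier G - {\<one>}) + measure \<mu> {\<one>}"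
      by (subst measure_pmf.finite_measure_Union[symmetric]) (auto intro!: arg_cong[where f="measure \<mu>"])
    ultimately show ?thesis by (simp add: measure_pmf_single)
  qed
  then show ?thesis
    using has_sum_pmf[of \<mu> "carrier G - {\<one>}"] has_sum_reindex_bij_betw[OF bij, of "pmf \<mu>"] by simp
qed

lemma pmf_symmetric_step:
  assumes sym: "\<forall>x\<in>carrier G. pmf \<mu> (inv x) = pmf \<mu> x" and "a \<in> carrier G" "b \<in> carrier G"
  shows "pmf \<mu> (inv a \<otimes> b) = pmf \<mu> (inv b \<otimes> a)"
proof -
  have "inv (inv b \<otimes> a) = inv a \<otimes> b" using assms by (simp add: inv_mult_group)
  then show ?thesis using sym assms by (metis inv_closed m_closed)
qed

text \<open>Only pairs with exactly one entry \<open>y\<close> contribute. They form two families,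
  each of total mass \<open>1 - pmf \<mu> \<one>\<close>, the second one by the symmetry of
  \<open>\<mu>\<close>.\<close>

lemma has_sum_energy_indicator:
  assumes \<mu>: "set_pmf \<mu> \<subseteq> carrier G" and sym: "\<forall>x\<in>carrier G. pmf \<mu> (inv x) = pmf \<mu> x"
    and y: "y \<in> carrier G"
  shows "((\<lambda>(a, b). pmf \<mu> (inv a \<otimes> b) * (of_bool (a = y) - of_bool (b = y))\<^sup>2) has_sum 2 * (1 - pmf \<mu> \<one>))
    (carrier G \<times> carrier G)"
proof -
  let ?C = "carrier G - {y}"
  have s: "((\<lambda>b. pmf \<mu> (inv y \<otimes> b)) has_sum (1 - pmf \<mu> \<one>)) ?C"
    by (rule has_sum_pmf_translate[OF \<mu> y])
  have 1: "((\<lambda>(a, b). pmf \<mu> (inv a \<otimes> b)) has_sum (1 - pmf \<mu> \<one>)) (Pair y ` ?C)"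
    using s by (subst has_sum_reindex) (auto simp: inj_on_def comp_def)
  have 2: "((\<lambda>(a, b). pmf \<mu> (inv a \<otimes> b)) has_sum (1 - pmf \<mu> \<one>)) ((\<lambda>a. (a, y)) ` ?C)"
  proof (subst has_sum_reindex)
    show "((\<lambda>(a, b). pmf \<mu> (inv a \<otimes> b)) \<circ> (\<lambda>a. (a, y)) has_sum 1 - pmf \<mu> \<one>) ?C"
      using s pmf_symmetric_step[OF sym] y by (subst has_sum_cong) auto
  qed (auto simp: inj_on_def)
  have "((\<lambda>(a, b). pmf \<mu> (inv a \<otimes> b)) has_sum ((1 - pmf \<mu> \<one>) + (1 - pmf \<mu> \<one>)))
      (Pair y ` ?C \<union> (\<lambda>a. (a, y)) ` ?C)"
    by (intro has_sum_Un_disjoint 1 2) auto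
  then show ?thesis
    by (subst has_sum_cong_neutral[where T="Pair y ` ?C \<union> (\<lambda>a. (a, y)) ` ?C" and g="\<lambda>(a, b). pmf \<mu> (inv a \<otimes> b)"])
      (use y in \<open>auto simp: of_bool_def split: if_splits\<close>)
qed

text \<open>For \<open>z = y\<close> this is half the sum in
  \<open>has_sum_energy_indicator\<close>. Otherwise only the pairs \<open>(y, z)\<close> and
  \<open>(z, y)\<close> contribute, with equal terms by symmetry.\<close>

lemma dirichlet_energy_indicators:
  assumes \<mu>: "set_pmf \<mu> \<subseteq> carrier G" and sym: "\<forall>x\<in>carrier G. pmf \<mu> (inv x) = pmf \<mu> x"
    and y: "y \<in> carrier G" and z: "z \<in> carrier G"
  shows "dirichlet_energy G \<mu> (\<lambda>a. of_bool (a = z)) (\<lambda>a. of_bool (a = y)) = of_bool (z = y) - pmf \<mu> (inv y \<otimes> z)"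
proof (cases "z = y")
  case True
  have "(\<Sum>\<^sub>\<infinity>(a, b)\<in>carrier G \<times> carrier G. pmf \<mu> (inv a \<otimes> b) * (of_bool (a = y) - of_bool (b = y)) *
      (of_bool (a = y) - of_bool (b = y))) = 2 * (1 - pmf \<mu> \<one>)"
    using infsumI[OF has_sum_energy_indicator[OF \<mu> sym y]] by (simp add: power2_eq_square mult.assoc)
  then show ?thesis using True y by (simp add: dirichlet_energy_def)
next
  case False
  let ?f = "\<lambda>(a, b). pmf \<mu> (inv a \<otimes> b) * (of_bool (a = z) - of_bool (b = z)) * (of_bool (a = y) - of_bool (b = y)) :: real"
  have "(?f has_sum sum ?f {(y, z), (z, y)}) {(y, z), (z, y)}"
    by (rule has_sum_finite) simp
  also have "(?f has_sum sum ?f {(y, z), (z, y)}) {(y, z), (z, y)} \<longleftrightarrow>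
      (?f has_sum sum ?f {(y, z), (z, y)}) (carrier G \<times> carrier G)"
    by (rule has_sum_cong_neutral) (use y z False in \<open>auto simp: of_bool_def split: if_splits\<close>)
  finally have "(?f has_sum sum ?f {(y, z), (z, y)}) (carrier G \<times> carrier G)" .
  then have "infsum ?f (carrier G \<times> carrier G) = sum ?f {(y, z), (z, y)}"
    by (rule infsumI)
  also have "sum ?f {(y, z), (z, y)} = - 2 * pmf \<mu> (inv y \<otimes> z)"
    using False pmf_symmetric_step[OF sym y z] by simp
  finally have "infsum ?f (carrier G \<times> carrier G) = - 2 * pmf \<mu> (inv y \<otimes> z)" .
  then show ?thesis using False by (simp add: dirichlet_energy_def)
qed

end

text \<open>The Markov property of \<open>W\<close> is applied at the last grid time, while
  \<open>path_weight\<close> recurs from the first.\<close>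

lemma path_weight_snoc: "path_weight p x (ys @ [z]) = path_weight p x ys * p (last (x # ys)) z"
  by (induction ys arbitrary: x) auto

lemma filterlim_ennreal_at_right:
  assumes t: "0 \<le> t"
  shows "filterlim ennreal (at_right (ennreal t)) (at_right t)"
proof -
  have "(ennreal \<longlongrightarrow> ennreal t) (at_right t)"
    by (intro tendsto_ennrealI tendsto_ident_at)
  moreover have "\<forall>\<^sub>F s in at_right t. ennreal s \<in> {ennreal t<..} \<and> ennreal s \<noteq> ennreal t"
    using eventually_at_right_less[of t]
    by eventually_elim (use t in \<open>auto simp: ennreal_less_iff\<close>)
  ultimately show ?thesis
    unfolding filterlim_at by auto
qed

section \<open>Skeletons of the reflecting walk\<close>

locale reflecting_setup = marked_group G S for G (structure) and S +
  fixes \<mu> :: "'a pmf" and \<omega> :: "'a measure" and M :: "'w measure" and F :: "ennreal \<Rightarrow> 'w measure"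
    and W :: "ennreal \<Rightarrow> 'w \<Rightarrow> 'a point option" and Q :: "'a point option \<Rightarrow> 'w measure"
  assumes \<mu>: "\<mu> \<in> step_distributions G S 2"
    and \<omega>: "finite_measure \<omega>" "full_support_measure G \<omega>"
    and W: "reflecting_random_walk G S \<mu> \<omega> M F W Q"
begin

sublocale H: hunt_process T M F W Q
  using W by (simp add: reflecting_random_walk_def)

lemma W_in_topspace: "w \<in> space M \<Longrightarrow> W t w \<in> topspace A"
  using measurable_space[OF H.adapted, of w t] by (simp add: space_borel_of H.space_F)

lemma sets_W_eq:
  assumes "y \<in> carrier G"
  shows "{w \<in> space M. W t w = pt y} \<in> sets (F t)"
proof -
  from assms have "W t -` {pt y} \<inter> space (F t) \<in> sets (F t)"
    by (intro measurable_sets[OF H.adapted] sets_borel_of_open openin_A_pt)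
  then show ?thesis by (simp add: H.space_F vimage_def Int_def conj_commute)
qed

lemma Q_pt:
  assumes "y \<in> carrier G"
  shows "prob_space (Q (pt y))" "sets (Q (pt y)) = sets M" "space (Q (pt y)) = space M"
proof -
  have "Q (pt y) \<in> space (prob_algebra M)"
    using measurable_space[OF H.kernel, of "pt y"] assms topspace_A_pt[of y] by (simp add: space_borel_of)
  then show "prob_space (Q (pt y))" "sets (Q (pt y)) = sets M"
    by (auto simp: space_prob_algebra)
  then show "space (Q (pt y)) = space M" by (intro sets_eq_imp_space_eq)
qed

definition transition :: "real \<Rightarrow> 'a \<Rightarrow> 'a \<Rightarrow> real" where
  "transition h y z = measure (Q (pt y)) {w \<in> space M. W (ennreal h) w = pt z}"

text \<open>The strong Markov property at the constant stopping time \<open>s\<close>, with a point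
  mass as initial law, for which the bind collapses to \<open>Q (pt x)\<close>.\<close>

lemma markov:
  assumes xyz: "x \<in> carrier G" "y \<in> carrier G" "z \<in> carrier G"
    and E: "E \<in> sets (F s)" "\<And>w. w \<in> E \<Longrightarrow> W s w = pt y"
  shows "measure (Q (pt x)) {w \<in> E. W (s + ennreal t) w = pt z} = measure (Q (pt x)) E * transition t y z"
proof -
  let ?\<pi> = "return (borel_of A) (pt x)"
  interpret Qx: prob_space "Q (pt x)" by (rule Q_pt[OF xyz(1)])
  interpret Qy: prob_space "Q (pt y)" by (rule Q_pt[OF xyz(2)])
  have x: "pt x \<in> space (borel_of A)" using xyz topspace_A_pt[of x] by (simp add: space_borel_of)
  have bind: "Giry_Monad.bind ?\<pi> Q = Q (pt x)"
    by (rule bind_return[OF measurable_prob_algebraD[OF H.kernel] x])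
  have EM: "E \<in> sets (Q (pt x))"
    using E(1) H.sets_filtration Q_pt(2)[OF xyz(1)] by auto
  have "E \<in> sets (H.pre_sigma (\<lambda>_. s))"
  proof (rule H.sets_pre_sigmaI[OF stopping_time_const])
    show "{w \<in> E. s \<le> t} \<in> sets (F t)" for t
      using E(1) H.sets_F_mono[of s t] by (cases "s \<le> t") auto
  qed
  then have "emeasure (Q (pt x)) {w \<in> E. W (s + ennreal t) w \<in> {pt z}} =
      (\<integral>\<^sup>+ w\<in>E. emeasure (Q (W s w)) {v \<in> space M. W (ennreal t) v \<in> {pt z}} \<partial>Q (pt x))"
    using H.strong_markov[OF prob_space_return[OF x] sets_return stopping_time_const, of E s "{pt z}" "ennreal t"]
      sets_borel_of_open[OF openin_A_pt[OF xyz(3)]] unfolding bind by blast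
  also have "\<dots> = (\<integral>\<^sup>+ w. ennreal (transition t y z) * indicator E w \<partial>Q (pt x))"
    using E(2) by (intro nn_integral_cong) (auto simp: transition_def Qy.emeasure_eq_measure split: split_indicator)
  also have "\<dots> = ennreal (transition t y z) * emeasure (Q (pt x)) E"
    using EM by (simp add: nn_integral_cmult)
  finally show ?thesis
    by (simp add: Qx.emeasure_eq_measure transition_def mult.commute flip: ennreal_mult)
qed

text \<open>\<open>None\<close> stands for the cemetery and for every boundary point alike, since
  the comparison looks only at the path inside the group.\<close>

definition state :: "real \<Rightarrow> 'w \<Rightarrow> 'a option" where
  "state t w = (case W (ennreal t) w of Some (Inner y) \<Rightarrow> Some y | _ \<Rightarrow> None)"

lemma state_eq_Some_iff: "state t w = Some y \<longleftrightarrow> W (ennreal t) w = pt y"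
  by (auto simp: state_def split: option.splits point.splits)

text \<open>The event is measurable at the time of its last observation, as the Markov property at
  that time requires; hence an induction that adds letters at the end.\<close>

lemma skeleton_event:
  assumes h: "0 < h" and x: "x \<in> carrier G" and ys: "set ys \<subseteq> carrier G"
  defines "E \<equiv> \<lambda>ys. {w \<in> space M. \<forall>j\<le>length ys. state (real j * h) w = Some ((x # ys) ! j)}"
  shows "E ys \<in> sets (F (ennreal (real (length ys) * h)))"
    and "measure (Q (pt x)) (E ys) = path_weight (transition h) x ys"
proof -
  have nth: "(x # ys) ! j \<in> carrier G" if "j \<le> length ys" "set ys \<subseteq> carrier G" for ys j
    using that x nth_mem[of j "x # ys"] by (auto simp del: nth_mem)
  have sets: "E ys \<in> sets (F (ennreal (real (length ys) * h)))" if "set ys \<subseteq> carrier G" for ys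
  proof -
    have "{w \<in> space (F (ennreal (real (length ys) * h))). \<forall>j\<in>{..length ys}. state (real j * h) w = Some ((x # ys) ! j)}
        \<in> sets (F (ennreal (real (length ys) * h)))"
    proof (intro sets.sets_Collect_finite_All)
      fix j assume j: "j \<in> {..length ys}"
      then have "ennreal (real j * h) \<le> ennreal (real (length ys) * h)"
        using h by (intro ennreal_leI mult_right_mono) auto
      then show "{w \<in> space (F (ennreal (real (length ys) * h))). state (real j * h) w = Some ((x # ys) ! j)}
        \<in> sets (F (ennreal (real (length ys) * h)))"
        using sets_W_eq[OF nth, of j ys "ennreal (real j * h)"] H.sets_F_mono j that
        unfolding state_eq_Some_iff H.space_F by blast
    qed auto
    moreover have "{w \<in> space (F (ennreal (real (length ys) * h))). \<forall>j\<in>{..length ys}. state (real j * h) w = Some ((x # ys) ! j)} = E ys"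
      unfolding E_def H.space_F atMost_iff Ball_def by (rule refl)
    ultimately show ?thesis by (simp only:)
  qed
  show "E ys \<in> sets (F (ennreal (real (length ys) * h)))" using ys by (rule sets)
  interpret Qx: prob_space "Q (pt x)" by (rule Q_pt[OF x])
  show "measure (Q (pt x)) (E ys) = path_weight (transition h) x ys"
    using ys
  proof (induction ys rule: rev_induct)
    case Nil
    have "AE w in Q (pt x). W 0 w = pt x"
      using H.normal topspace_A_pt[of x] x by blast
    moreover have "E [] = {w \<in> space (Q (pt x)). W 0 w = pt x}"
      by (auto simp: E_def state_eq_Some_iff Q_pt(3)[OF x])
    moreover have "E [] \<in> sets (Q (pt x))"
      using sets[of "[]"] H.sets_filtration Q_pt(2)[OF x] by auto
    ultimately have "measure (Q (pt x)) (E []) = 1"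
      using Qx.prob_eq_1[of "E []"] by simp
    then show ?case by simp
  next
    case (snoc z ys)
    then have sub: "set ys \<subseteq> carrier G" and z: "z \<in> carrier G" by auto
    have last: "last (x # ys) = (x # ys) ! length ys"
      by (simp add: last_conv_nth)
    have lc: "last (x # ys) \<in> carrier G"
      unfolding last using nth sub by simp
    have eq: "E (ys @ [z]) = {w \<in> E ys. W (ennreal (real (length ys) * h) + ennreal h) w = pt z}"
    proof -
      have time: "ennreal (real (length ys) * h) + ennreal h = ennreal (real (Suc (length ys)) * h)"
        using h by (simp add: algebra_simps flip: ennreal_plus)
      have nth1: "(x # ys @ [z]) ! j = (x # ys) ! j" if "j \<le> length ys" for j
        using that nth_append[of "x # ys" "[z]" j] by simp
      have nth2: "(x # ys @ [z]) ! Suc (length ys) = z" by simp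
      have all: "(\<forall>j\<le>length (ys @ [z]). B j) \<longleftrightarrow> (\<forall>j\<le>length ys. B j) \<and> B (Suc (length ys))" for B
        by (auto simp: le_Suc_eq)
      show ?thesis
        unfolding E_def all nth2 time state_eq_Some_iff[symmetric] using nth1 by auto
    qed
    have "measure (Q (pt x)) (E (ys @ [z])) = measure (Q (pt x)) (E ys) * transition h (last (x # ys)) z"
      unfolding eq
    proof (rule markov[OF x lc z sets[OF sub]])
      fix w assume "w \<in> E ys"
      then show "W (ennreal (real (length ys) * h)) w = pt (last (x # ys))"
        unfolding last by (simp add: E_def flip: state_eq_Some_iff)
    qed
    then show ?case using snoc.IH[OF sub] by (simp add: path_weight_snoc)
  qed
qed

text \<open>The set \<open>{pt y}\<close> and its complement are both open, so right continuity
  carries over being at \<open>y\<close> as well as not being there.\<close>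

lemma eventually_right_W:
  assumes "w \<in> space M" "t < \<infinity>" "y \<in> carrier G"
  shows "\<forall>\<^sub>F s in at_right t. (W s w = pt y) = (W t w = pt y)"
proof (cases "W t w = pt y")
  case True
  then show ?thesis
    using limitinD[OF H.right_continuous[OF assms(1,2)] openin_A_pt[OF assms(3)]] by simp
next
  case False
  then have "\<forall>\<^sub>F s in at_right t. W s w \<in> topspace A - {pt y}"
    using W_in_topspace[OF assms(1)]
    by (intro limitinD[OF H.right_continuous[OF assms(1,2)] openin_A_minus_pt[OF assms(3)]]) auto
  then show ?thesis by eventually_elim (use False in auto)
qed

lemma skeleton_process_state:
  assumes x: "x \<in> carrier G"
  shows "skeleton_process (Q (pt x)) state (carrier G) transition x"
proof -
  interpret Qx: prob_space "Q (pt x)" by (rule Q_pt[OF x])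
  note sp = Q_pt(3)[OF x] and se = Q_pt(2)[OF x]
  show ?thesis
  proof
    show "{w \<in> space (Q (pt x)). state t w = Some y} \<in> sets (Q (pt x))" if "0 \<le> t" "y \<in> carrier G" for t y
      using sets_W_eq[OF that(2), of "ennreal t"] H.sets_filtration unfolding state_eq_Some_iff sp se by blast
    show "state t w \<in> insert None (Some ` carrier G)" if "w \<in> space (Q (pt x))" for t w
    proof (cases "state t w")
      case (Some a)
      then have "pt a \<in> topspace A"
        using W_in_topspace[of w "ennreal t"] that unfolding sp state_eq_Some_iff by (simp only:)
      then show ?thesis using Some topspace_A_pt[of a] by simp
    qed simp
    show "AE w in Q (pt x). \<forall>t\<ge>0. \<forall>y\<in>carrier G. \<forall>\<^sub>F s in at_right t. (state s w = Some y) = (state t w = Some y)"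
    proof (rule AE_I2, intro allI impI ballI)
      fix w y and t :: real assume w: "w \<in> space (Q (pt x))" and t: "0 \<le> t" and y: "y \<in> carrier G"
      have "\<forall>\<^sub>F s in at_right (ennreal t). (W s w = pt y) = (W (ennreal t) w = pt y)"
        using w y sp by (intro eventually_right_W) auto
      from eventually_compose_filterlim[OF this filterlim_ennreal_at_right[OF t]]
      show "\<forall>\<^sub>F s in at_right t. (state s w = Some y) = (state t w = Some y)"
        by (simp add: state_eq_Some_iff)
    qed
    show "measure (Q (pt x)) {w \<in> space (Q (pt x)). \<forall>j\<le>length ys. state (real j * h) w = Some ((x # ys) ! j)} =
        path_weight (transition h) x ys" if "0 < h" "set ys \<subseteq> carrier G" for h ys
      using skeleton_event(2)[OF that(1) x that(2)] by (simp add: sp)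
    show "0 \<le> transition h y z" for h y z
      by (simp add: transition_def)
    show "(\<Sum>z\<in>K. transition h y z) \<le> 1" if y: "y \<in> carrier G" and K: "K \<subseteq> carrier G" "finite K" for h y K
    proof -
      interpret Qy: prob_space "Q (pt y)" by (rule Q_pt[OF y])
      have "(\<Sum>z\<in>K. transition h y z) = measure (Q (pt y)) (\<Union>z\<in>K. {w \<in> space M. W (ennreal h) w = pt z})"
        unfolding transition_def
      proof (rule Qy.finite_measure_finite_Union[symmetric])
        show "(\<lambda>z. {w \<in> space M. W (ennreal h) w = pt z}) ` K \<subseteq> sets (Q (pt y))"
          using sets_W_eq[of _ "ennreal h"] H.sets_filtration K unfolding Q_pt(2)[OF y] by blast
      qed (use K in \<open>auto simp: disjoint_family_on_def\<close>)
      also have "\<dots> \<le> 1" by (rule Qy.prob_le_1)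
      finally show ?thesis .
    qed
  qed (rule x)
qed

end

section \<open>The Dirichlet form of the reflecting walk at indicators of points\<close>

context reflecting_setup begin

abbreviation m :: "'a point measure" where
  "m \<equiv> extend_measure_by_zero G S \<omega>"

abbreviation ind :: "'a \<Rightarrow> 'a point \<Rightarrow> real" where
  "ind z \<equiv> (\<lambda>p. of_bool (p = Inner z))"

lemma form: "has_dirichlet_form m Q W (reflected_domain G S \<mu> \<omega>) (reflected_form G \<mu>)"
  using W by (simp add: reflecting_random_walk_def)

lemma sets_\<omega>: "sets \<omega> = Pow (carrier G)" and space_\<omega>: "space \<omega> = carrier G"
proof -
  show s: "sets \<omega> = Pow (carrier G)" using \<omega>(2) by (simp add: full_support_measure_def)
  have "sets \<omega> = sets (count_space (carrier G))" using s by simp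
  from sets_eq_imp_space_eq[OF this] show "space \<omega> = carrier G" by simp
qed

lemma Inner_measurable: "Inner \<in> \<omega> \<rightarrow>\<^sub>M borel_of T"
  by (rule measurableI) (auto simp: space_\<omega> sets_\<omega> space_borel_of Inner_in_compact_points)

lemma sets_m: "sets m = sets (borel_of T)"
  by (simp add: extend_measure_by_zero_def)

lemma sets_Inner: "y \<in> carrier G \<Longrightarrow> {Inner y} \<in> sets (borel_of T)"
  by (intro sets_borel_of_open openin_T_Inner)

lemma ind_measurable:
  assumes z: "z \<in> carrier G"
  shows "ind z \<in> borel_measurable (borel_of T)"
proof -
  have "ind z = indicator {Inner z}" by (auto simp: indicator_def)
  then show ?thesis using sets_Inner[OF z] by simp
qed

lemma measure_m: "y \<in> carrier G \<Longrightarrow> measure m {Inner y} = measure \<omega> {y}"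
  unfolding extend_measure_by_zero_def
  by (subst measure_distr[OF Inner_measurable sets_Inner])
    (auto simp: space_\<omega> intro!: arg_cong[where f="measure \<omega>"])

text \<open>A function in the reflected domain has boundary values, so nonemptiness yields the almost sure
  convergence of the walk to the boundary. It is free: \<open>0\<close> lies in the domain of the form of the
  process.\<close>

lemma reflected_domain_nonempty: "reflected_domain G S \<mu> \<omega> \<noteq> {}"
proof -
  let ?z = "\<lambda>_ :: 'a point. 0 :: real"
  have "transition_operator Q W t ?z = (\<lambda>_. 0)" for t
    by (simp add: transition_operator_def fun_eq_iff option.case_eq_if)
  then have "approximating_form m Q W t ?z ?z = 0" for t
    by (simp add: approximating_form_def)
  then have "((\<lambda>t. approximating_form m Q W t ?z ?z) \<longlongrightarrow> 0) (at_right 0)" by simp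
  moreover have "?z \<in> square_integrable m" by (simp add: square_integrable_def)
  ultimately have "?z \<in> {f \<in> square_integrable m. \<exists>l. ((\<lambda>t. approximating_form m Q W t f f) \<longlongrightarrow> l) (at_right 0)}"
    by blast
  moreover have "{f \<in> square_integrable m. \<exists>l. ((\<lambda>t. approximating_form m Q W t f f) \<longlongrightarrow> l) (at_right 0)} =
      {f \<in> square_integrable m. \<exists>g\<in>reflected_domain G S \<mu> \<omega>. AE x in m. f x = g x}"
    using form unfolding has_dirichlet_form_def by (elim conjE)
  ultimately have "?z \<in> {f \<in> square_integrable m. \<exists>g\<in>reflected_domain G S \<mu> \<omega>. AE x in m. f x = g x}"
    by (simp only:)
  then show ?thesis by blast
qed

lemma \<mu>_facts: "set_pmf \<mu> \<subseteq> carrier G" "\<forall>x\<in>carrier G. pmf \<mu> (inv x) = pmf \<mu> x"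
  using \<mu> by (auto simp: step_distributions_def)

text \<open>The boundary value of the indicator is 0: the walk converges to a boundary point, of
  which the complement of \<open>z\<close> is a neighbourhood, so it is eventually off
  \<open>z\<close>.\<close>

lemma ind_in_domain:
  assumes z: "z \<in> carrier G"
  shows "ind z \<in> reflected_domain G S \<mu> \<omega>"
proof -
  interpret fin: finite_measure \<omega> by (rule \<omega>)
  have "has_boundary_values G S \<mu> (ind z)"
  proof -
    obtain g where "g \<in> reflected_domain G S \<mu> \<omega>" using reflected_domain_nonempty by blast
    then have "has_boundary_values G S \<mu> g"
      by (simp add: reflected_domain_def extended_domain_def)
    then have "AE u in (\<Pi>\<^sub>M n\<in>(UNIV :: nat set). measure_pmf \<mu>). \<exists>\<xi>\<in>gromov_boundary G S.
        limitin T (\<lambda>n. Inner (walk_path G u n)) (Boundary \<xi>) sequentially"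
      unfolding has_boundary_values_def by eventually_elim blast
    then show ?thesis
      unfolding has_boundary_values_def
    proof eventually_elim
      case (elim u)
      then obtain \<xi> where \<xi>: "\<xi> \<in> gromov_boundary G S"
        and lim: "limitin T (\<lambda>n. Inner (walk_path G u n)) (Boundary \<xi>) sequentially" by blast
      have "Boundary \<xi> \<in> compact_points G S - {Inner z}"
        using \<xi> by (auto simp: compact_points_def)
      from limitinD[OF lim openin_T_minus_Inner[OF z] this]
      have "\<forall>\<^sub>F n in sequentially. ind z (Inner (walk_path G u n)) = ind z (Boundary \<xi>)"
        by eventually_elim auto
      then have "(\<lambda>n. ind z (Inner (walk_path G u n))) \<longlonglongrightarrow> ind z (Boundary \<xi>)"
        by (rule tendsto_eventually)
      then show ?case using \<xi> lim by blast
    qed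
  qed
  moreover have "(\<lambda>x. ind z (Inner x)) \<in> finite_energy G \<mu>"
    using has_sum_imp_summable[OF has_sum_energy_indicator[OF \<mu>_facts z]] by (simp add: finite_energy_def)
  moreover have "(\<lambda>x. ind z (Inner x)) \<in> square_integrable \<omega>"
  proof -
    have "(\<lambda>x. ind z (Inner x)) \<in> borel_measurable \<omega>"
      by (rule measurableI) (auto simp: sets_\<omega> space_\<omega>)
    moreover from this have "integrable \<omega> (\<lambda>x. (ind z (Inner x))\<^sup>2)"
      by (intro fin.integrable_const_bound[where B=1]) (auto simp: of_bool_def)
    ultimately show ?thesis by (simp add: square_integrable_def)
  qed
  ultimately show ?thesis
    using ind_measurable[OF z] by (simp add: reflected_domain_def extended_domain_def)
qed

lemma transition_operator_ind:
  assumes "y \<in> carrier G" "z \<in> carrier G"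
  shows "transition_operator Q W (ennreal t) (ind z) (Inner y) = transition t y z"
proof -
  interpret Qy: prob_space "Q (pt y)" by (rule Q_pt[OF assms(1)])
  let ?E = "{w \<in> space M. W (ennreal t) w = pt z}"
  have E: "?E \<in> sets (Q (pt y))"
    using sets_W_eq[OF assms(2), of "ennreal t"] H.sets_filtration Q_pt(2)[OF assms(1)] by blast
  have "transition_operator Q W (ennreal t) (ind z) (Inner y) = (\<integral>w. indicator ?E w \<partial>Q (pt y))"
    unfolding transition_operator_def
    by (intro Bochner_Integration.integral_cong refl)
      (auto simp: Q_pt(3)[OF assms(1)] indicator_def split: option.splits)
  also have "\<dots> = measure (Q (pt y)) ?E" using E by simp
  finally show ?thesis by (simp add: transition_def)
qed

lemma \<omega>_pos:
  assumes "y \<in> carrier G"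
  shows "0 < measure \<omega> {y}"
proof -
  interpret fin: finite_measure \<omega> by (rule \<omega>)
  from assms have "0 < emeasure \<omega> {y}" using \<omega>(2) by (simp add: full_support_measure_def)
  then show ?thesis by (simp add: fin.emeasure_eq_measure)
qed

text \<open>Multiplication by \<open>ind y\<close> reduces the integral to the atom at
  \<open>y\<close>, where the semigroup applied to \<open>ind z\<close> is a transition
  probability.\<close>

lemma approximating_form_ind:
  assumes y: "y \<in> carrier G" and z: "z \<in> carrier G"
  shows "approximating_form m Q W t (ind z) (ind y) = (1 / t) * ((of_bool (z = y) - transition t y z) * measure \<omega> {y})"
proof -
  have "(\<integral>x. (ind z x - transition_operator Q W (ennreal t) (ind z) x) * ind y x \<partial>m) =
      (\<integral>x. (of_bool (z = y) - transition t y z) * indicator {Inner y} x \<partial>m)"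
    by (intro Bochner_Integration.integral_cong refl)
      (auto simp: indicator_def transition_operator_ind[OF y z])
  also have "\<dots> = (of_bool (z = y) - transition t y z) * measure m {Inner y}"
    using sets_Inner[OF y] sets_m sets.sets_into_space[of "{Inner y}" m] by (simp add: Int_absorb2)
  finally show ?thesis
    by (simp add: approximating_form_def measure_m[OF y])
qed

lemma transition_derivative:
  assumes y: "y \<in> carrier G" and z: "z \<in> carrier G"
  shows "((\<lambda>h. (transition h y z - of_bool (z = y)) / h) \<longlongrightarrow>
    (pmf \<mu> (inv y \<otimes> z) - of_bool (z = y)) / measure \<omega> {y}) (at_right 0)"
proof -
  have "((\<lambda>t. approximating_form m Q W t (ind z) (ind y)) \<longlongrightarrow> reflected_form G \<mu> (ind z) (ind y)) (at_right 0)"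
  proof -
    have "\<forall>f\<in>reflected_domain G S \<mu> \<omega>. \<forall>g\<in>reflected_domain G S \<mu> \<omega>.
        ((\<lambda>t. approximating_form m Q W t f g) \<longlongrightarrow> reflected_form G \<mu> f g) (at_right 0)"
      using form unfolding has_dirichlet_form_def by (elim conjE)
    from bspec[OF bspec[OF this ind_in_domain[OF z]] ind_in_domain[OF y]] show ?thesis .
  qed
  also have "reflected_form G \<mu> (ind z) (ind y) = of_bool (z = y) - pmf \<mu> (inv y \<otimes> z)"
    using dirichlet_energy_indicators[OF \<mu>_facts y z] by (simp add: reflected_form_def)
  finally have "((\<lambda>t. - (approximating_form m Q W t (ind z) (ind y) / measure \<omega> {y})) \<longlongrightarrow>
      - ((of_bool (z = y) - pmf \<mu> (inv y \<otimes> z)) / measure \<omega> {y})) (at_right 0)"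
    using \<omega>_pos[OF y] by (intro tendsto_intros) auto
  moreover have "- (approximating_form m Q W t (ind z) (ind y) / measure \<omega> {y}) =
      (transition t y z - of_bool (z = y)) / t" for t
    using \<omega>_pos[OF y] by (simp add: approximating_form_ind[OF y z] minus_divide_left)
  moreover have "- ((of_bool (z = y) - pmf \<mu> (inv y \<otimes> z)) / measure \<omega> {y}) =
      (pmf \<mu> (inv y \<otimes> z) - of_bool (z = y)) / measure \<omega> {y}"
    by (simp add: minus_divide_left)
  ultimately show ?thesis
    by (simp only:)
qed

section \<open>Exit times of the reflecting walk from finite sets\<close>

definition exit_from :: "'a set \<Rightarrow> 'w \<Rightarrow> ennreal" where
  "exit_from K w = Inf {t. W t w \<notin> pt ` K}"

lemma eventually_right_W_in:
  assumes w: "w \<in> space M" "t < \<infinity>" and K: "finite K" "K \<subseteq> carrier G"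
  shows "\<forall>\<^sub>F s in at_right t. (W s w \<in> pt ` K) = (W t w \<in> pt ` K)"
proof -
  have "\<forall>\<^sub>F s in at_right t. \<forall>y\<in>K. (W s w = pt y) = (W t w = pt y)"
    using K eventually_right_W[OF w] by (intro eventually_ball_finite) auto
  then show ?thesis
    by eventually_elim (auto simp: image_iff)
qed

text \<open>The infimum is attained: were the path in \<open>K\<close> at that time, right
  continuity would keep it there a little longer.\<close>

lemma W_exit_from:
  assumes w: "w \<in> space M" and K: "finite K" "K \<subseteq> carrier G" and fin: "exit_from K w < \<infinity>"
  shows "W (exit_from K w) w \<notin> pt ` K"
proof
  let ?\<sigma> = "exit_from K w"
  assume "W ?\<sigma> w \<in> pt ` K"
  then have "\<forall>\<^sub>F s in at_right ?\<sigma>. W s w \<in> pt ` K"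
    using eventually_right_W_in[OF w fin K] by simp
  then obtain b where b: "?\<sigma> < b" "\<And>s. ?\<sigma> < s \<Longrightarrow> s < b \<Longrightarrow> W s w \<in> pt ` K"
    using eventually_at_right[of ?\<sigma> \<infinity>] fin by auto
  have "b \<le> ?\<sigma>"
    unfolding exit_from_def
  proof (rule Inf_greatest, rule ccontr)
    fix s assume s: "s \<in> {t. W t w \<notin> pt ` K}" "\<not> b \<le> s"
    have "?\<sigma> \<le> s" unfolding exit_from_def using s(1) by (rule Inf_lower)
    then show False using s b(2)[of s] \<open>W ?\<sigma> w \<in> pt ` K\<close> by (cases "?\<sigma> = s") auto
  qed
  then show False using b(1) by simp
qed

lemma W_before_exit_from: "s < exit_from K w \<Longrightarrow> W s w \<in> pt ` K"
proof (rule ccontr)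
  assume s: "s < exit_from K w" and "W s w \<notin> pt ` K"
  then have "exit_from K w \<le> s" unfolding exit_from_def by (intro Inf_lower) simp
  then show False using s by simp
qed

text \<open>Right continuity keeps a path that has left \<open>K\<close> outside for a while, so
  rational times detect it. Negative \<open>q\<close> do no harm, as \<open>ennreal\<close> sends
  them to time 0.\<close>

lemma exit_from_less_iff:
  assumes w: "w \<in> space M" and K: "finite K" "K \<subseteq> carrier G"
  shows "exit_from K w < s \<longleftrightarrow> (\<exists>q::rat. ennreal (real_of_rat q) < s \<and> W (ennreal (real_of_rat q)) w \<notin> pt ` K)"
proof
  assume "exit_from K w < s"
  then obtain r where r: "r < s" "W r w \<notin> pt ` K"
    unfolding exit_from_def Inf_less_iff by auto
  then have fin: "r < \<infinity>" by (metis infinity_ennreal_def less_le_trans top_greatest)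
  have "\<forall>\<^sub>F u in at_right r. W u w \<notin> pt ` K"
    using eventually_right_W_in[OF w fin K] r(2) by simp
  then obtain b where b: "r < b" "\<And>u. r < u \<Longrightarrow> u < b \<Longrightarrow> W u w \<notin> pt ` K"
    using eventually_at_right[of r \<infinity>] fin by auto
  have "r < min b s" using b r by simp
  then obtain q :: rat where q: "r < ennreal (real_of_rat q)" "ennreal (real_of_rat q) < min b s"
    using ennreal_rat_dense by blast
  then show "\<exists>q::rat. ennreal (real_of_rat q) < s \<and> W (ennreal (real_of_rat q)) w \<notin> pt ` K"
    using b(2)[of "ennreal (real_of_rat q)"] by (intro exI[of _ q]) simp
next
  assume "\<exists>q::rat. ennreal (real_of_rat q) < s \<and> W (ennreal (real_of_rat q)) w \<notin> pt ` K"
  then show "exit_from K w < s"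
    unfolding exit_from_def Inf_less_iff by blast
qed

text \<open>Exit strictly before \<open>s\<close> is a countable union over rational times and
  belongs to \<open>F s\<close>. Exit at or before \<open>t\<close> then lies in \<open>F s\<close>
  for every \<open>s > t\<close>, and the right continuity of the filtration brings it down to
  \<open>F t\<close>.\<close>

lemma stopping_time_exit_from:
  assumes K: "finite K" "K \<subseteq> carrier G"
  shows "stopping_time F (exit_from K)"
proof (rule stopping_timeI)
  fix t
  have less: "{w \<in> space M. exit_from K w < s} \<in> sets (F s)" for s
  proof -
    have sets_q: "{w \<in> space M. ennreal (real_of_rat q) < s \<and> W (ennreal (real_of_rat q)) w \<notin> pt ` K} \<in> sets (F s)" for q :: rat
    proof (cases "ennreal (real_of_rat q) < s")
      case True
      let ?q = "ennreal (real_of_rat q)"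
      have "{w \<in> space (F ?q). W ?q w \<notin> pt ` K} = space (F ?q) - (\<Union>y\<in>K. {w \<in> space M. W ?q w = pt y})"
        by (auto simp: H.space_F)
      also have "\<dots> \<in> sets (F ?q)"
        using K sets_W_eq by (intro sets.compl_sets sets.finite_UN) auto
      finally have "{w \<in> space M. W ?q w \<notin> pt ` K} \<in> sets (F s)"
        unfolding H.space_F by (rule subsetD[OF H.sets_F_mono[OF less_imp_le[OF True]]])
      then show ?thesis using True by simp
    qed simp
    have "(\<Union>q::rat. {w \<in> space M. ennreal (real_of_rat q) < s \<and> W (ennreal (real_of_rat q)) w \<notin> pt ` K}) \<in> sets (F s)"
      by (intro sets.countable_UN image_subsetI sets_q)
    also have "(\<Union>q::rat. {w \<in> space M. ennreal (real_of_rat q) < s \<and> W (ennreal (real_of_rat q)) w \<notin> pt ` K}) =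
        {w \<in> space M. exit_from K w < s}"
      using exit_from_less_iff[OF _ K, of _ s] by blast
    finally show ?thesis .
  qed
  have "{w \<in> space M. exit_from K w \<le> t} \<in> sets (F t)"
  proof (cases "t = \<infinity>")
    case True
    then show ?thesis using sets.top[of "F t"] by (simp add: H.space_F)
  next
    case False
    then have t: "t < \<infinity>" by (simp add: top.not_eq_extremum)
    have later: "{w \<in> space M. exit_from K w \<le> t} \<in> sets (F s)" if s: "t < s" for s
    proof -
      \<comment> \<open>Only rationals below \<open>s\<close> are used, so that all intersected
        events lie in \<open>F s\<close>.\<close>
      let ?D = "{q::rat. t < ennreal (real_of_rat q) \<and> ennreal (real_of_rat q) < s}"
      have "{w \<in> space M. exit_from K w \<le> t} = (\<Inter>q\<in>?D. {w \<in> space M. exit_from K w < ennreal (real_of_rat q)})"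
      proof (intro equalityI subsetI INT_I)
        fix w q assume "w \<in> {w \<in> space M. exit_from K w \<le> t}" "q \<in> ?D"
        then show "w \<in> {w \<in> space M. exit_from K w < ennreal (real_of_rat q)}" by auto
      next
        fix w assume w: "w \<in> (\<Inter>q\<in>?D. {w \<in> space M. exit_from K w < ennreal (real_of_rat q)})"
        obtain q0 :: rat where "t < ennreal (real_of_rat q0)" "ennreal (real_of_rat q0) < s"
          using ennreal_rat_dense[OF s] by blast
        then have wM: "w \<in> space M" using w by blast
        have "exit_from K w \<le> t"
        proof (rule ccontr)
          assume "\<not> exit_from K w \<le> t"
          then have "t < min s (exit_from K w)" using s by simp
          then obtain q :: rat where q: "t < ennreal (real_of_rat q)" "ennreal (real_of_rat q) < min s (exit_from K w)"
            using ennreal_rat_dense by blast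
          then have "exit_from K w < ennreal (real_of_rat q)" using w by auto
          then show False using q(2) by (meson less_asym min_less_iff_conj)
        qed
        then show "w \<in> {w \<in> space M. exit_from K w \<le> t}" using wM by simp
      qed
      also have "\<dots> \<in> sets (F s)"
      proof (rule sets.countable_INT')
        show "?D \<noteq> {}" using ennreal_rat_dense[OF s] by blast
        show "(\<lambda>q. {w \<in> space M. exit_from K w < ennreal (real_of_rat q)}) ` ?D \<subseteq> sets (F s)"
        proof (rule image_subsetI)
          fix q assume "q \<in> ?D"
          then have "ennreal (real_of_rat q) \<le> s" by (simp add: less_imp_le)
          from subsetD[OF H.sets_F_mono[OF this] less]
          show "{w \<in> space M. exit_from K w < ennreal (real_of_rat q)} \<in> sets (F s)" .
        qed
      qed simp
      finally show ?thesis .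
    qed
    show ?thesis
      unfolding H.filtration_right_continuous[OF t]
    proof (rule INT_I)
      fix s assume "s \<in> {t<..}"
      then show "{w \<in> space M. exit_from K w \<le> t} \<in> sets (F s)" by (intro later) simp
    qed
  qed
  then show "Measurable.pred (F t) (\<lambda>w. exit_from K w \<le> t)"
    by (simp add: pred_def H.space_F)
qed

text \<open>\<open>confined\<close> tests dyadic times only. An exit not after \<open>t\<close>
  would come strictly before it, because the path is in \<open>K\<close> at \<open>t\<close>; the
  path would then stay outside long enough to meet a dyadic time.\<close>

lemma exit_from_confined:
  assumes w: "w \<in> space M" and K: "finite K" "K \<subseteq> carrier G" and t: "0 \<le> t"
    and y: "state t w = Some y" "y \<in> K" and c: "confined state K t w"
  shows "ennreal t < exit_from K w"
proof (rule ccontr)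
  let ?\<sigma> = "exit_from K w"
  assume "\<not> ennreal t < ?\<sigma>"
  then have le: "?\<sigma> \<le> ennreal t" by simp
  then have fin: "?\<sigma> < \<infinity>" by (auto intro: le_less_trans)
  then obtain r where r: "?\<sigma> = ennreal r" "0 \<le> r" by (cases ?\<sigma>) auto
  have notin: "W (ennreal r) w \<notin> pt ` K" using W_exit_from[OF w K fin] r by simp
  have "r \<noteq> t" using notin y by (auto simp: state_eq_Some_iff)
  then have "r < t" using le r t by simp
  have "\<forall>\<^sub>F s in at_right (ennreal r). W s w \<notin> pt ` K"
    using eventually_right_W_in[OF w _ K, of "ennreal r"] notin by simp
  from eventually_compose_filterlim[OF this filterlim_ennreal_at_right[OF r(2)]]
  have "\<forall>\<^sub>F s in at_right r. W (ennreal s) w \<notin> pt ` K" .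
  then obtain b where b: "r < b" "\<And>s. r < s \<Longrightarrow> s < b \<Longrightarrow> W (ennreal s) w \<notin> pt ` K"
    by (auto simp: eventually_at_right_field)
  have "r < min b t" using b \<open>r < t\<close> by simp
  then obtain n where n: "r < dyadic n" "dyadic n < min b t" using dyadic_between[OF r(2)] by blast
  have "state (dyadic n) w \<in> Some ` K"
    using c n unfolding confined_def dyadic_def by auto
  then have "W (ennreal (dyadic n)) w \<in> pt ` K" by (auto simp: state_eq_Some_iff)
  then show False using b(2)[of "dyadic n"] n by simp
qed

text \<open>The exit time from the group is the supremum of those from the sets \<open>K n\<close>.
  It is at least each of them; conversely, quasi-left continuity shows that at a finite supremum the
  process is not in the group.\<close>

lemma AE_path_before_exit:
  assumes x: "x \<in> carrier G"
    and K: "incseq K" "\<And>n. finite (K n)" "(\<Union>n. K n) = carrier G"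
  shows "AE w in Q (pt x). path_before_exit G W w = (\<lambda>t. map_option Inner (killed K state t w))"
proof -
  let ?\<pi> = "return (borel_of A) (pt x)"
  have KS: "K n \<subseteq> carrier G" for n using K(3) by auto
  have xs: "pt x \<in> space (borel_of A)" using x topspace_A_pt[of x] by (simp add: space_borel_of)
  have bind: "Giry_Monad.bind ?\<pi> Q = Q (pt x)"
    by (rule bind_return[OF measurable_prob_algebraD[OF H.kernel] xs])
  have "AE w in Giry_Monad.bind ?\<pi> Q. (SUP n. exit_from (K n) w) < \<infinity> \<longrightarrow>
      limitin A (\<lambda>n. W (exit_from (K n) w) w) (W (SUP n. exit_from (K n) w) w) sequentially"
  proof (rule H.quasi_left_continuous)
    show "prob_space ?\<pi>" using xs by (rule prob_space_return)
    show "stopping_time F (exit_from (K n))" for n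
      using K KS by (intro stopping_time_exit_from)
    show "incseq (\<lambda>n. exit_from (K n) w)" for w
    proof (rule incseq_SucI)
      fix n
      have "K n \<subseteq> K (Suc n)" using K(1) by (simp add: incseq_SucD)
      then show "exit_from (K n) w \<le> exit_from (K (Suc n)) w"
        unfolding exit_from_def by (intro Inf_superset_mono) auto
    qed
  qed simp
  then have qlc: "AE w in Q (pt x). (SUP n. exit_from (K n) w) < \<infinity> \<longrightarrow>
      limitin A (\<lambda>n. W (exit_from (K n) w) w) (W (SUP n. exit_from (K n) w) w) sequentially"
    unfolding bind .
  have start: "AE w in Q (pt x). W 0 w = pt x"
    using H.normal topspace_A_pt[of x] x by blast
  show ?thesis
    using qlc start AE_space
  proof eventually_elim
    case (elim w)
    then have w: "w \<in> space M" using Q_pt(3)[OF x] by simp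
    let ?\<sigma> = "SUP n. exit_from (K n) w"
    \<comment> \<open>The exit positions leave every finite set, so they cannot converge to an isolated point.\<close>
    have not_inner: "W ?\<sigma> w \<noteq> pt z" if fin: "?\<sigma> < \<infinity>" and zG: "z \<in> carrier G" for z
    proof
      assume z: "W ?\<sigma> w = pt z"
      have "\<forall>\<^sub>F n in sequentially. W (exit_from (K n) w) w \<in> {pt z}"
        using elim(1) fin z openin_A_pt[OF zG] by (intro limitinD) auto
      moreover obtain N where "z \<in> K N" using zG K(3) by blast
      then have "\<forall>\<^sub>F n in sequentially. z \<in> K n"
        using incseqD[OF K(1)] by (intro eventually_sequentiallyI[of N]) blast
      ultimately have "\<forall>\<^sub>F n in sequentially. W (exit_from (K n) w) w \<in> pt ` K n"
        by eventually_elim auto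
      then obtain n where n: "W (exit_from (K n) w) w \<in> pt ` K n"
        using eventually_happens'[OF sequentially_bot] by blast
      have "exit_from (K n) w \<le> ?\<sigma>" by (rule SUP_upper) simp
      then have "exit_from (K n) w < \<infinity>" using fin by (rule le_less_trans)
      from W_exit_from[OF w K(2) KS this] n show False by simp
    qed
    have exit_le: "exit_time G W w \<le> ?\<sigma>"
    proof (cases "?\<sigma> < \<infinity>")
      case True
      have "W ?\<sigma> w \<notin> Some ` Inner ` carrier G" using not_inner[OF True] by auto
      \<comment> \<open>\<open>exit_time\<close> ranges over positive times only. The supremum is
        positive because at time 0 the process sits at \<open>x\<close>, inside the group.\<close>
      moreover have "0 < ?\<sigma>"
      proof (rule ccontr)
        assume "\<not> 0 < ?\<sigma>"
        then have "?\<sigma> = 0" by (simp add: not_less)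
        then have "W ?\<sigma> w = pt x" using elim(2) by (simp only:)
        then show False using not_inner[OF True x] by blast
      qed
      ultimately show ?thesis unfolding exit_time_def by (intro Inf_lower) blast
    next
      case False
      then have "?\<sigma> = \<top>" by (metis infinity_ennreal_def less_top)
      then show ?thesis by (metis top_greatest)
    qed
    have le_exit: "exit_from (K n) w \<le> exit_time G W w" for n
    proof -
      have "pt ` K n \<subseteq> Some ` Inner ` carrier G" using KS[of n] by (simp add: image_mono flip: image_image)
      then show ?thesis unfolding exit_time_def exit_from_def by (intro Inf_superset_mono) blast
    qed
    have main: "t < exit_time G W w \<and> W t w = pt y \<longleftrightarrow> killed K state t w = Some y" if y: "y \<in> carrier G" for t y
    proof
      assume t: "t < exit_time G W w \<and> W t w = pt y"
      then have "t < ?\<sigma>" using exit_le by (meson less_le_trans)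
      then obtain n where n: "t < exit_from (K n) w" unfolding less_SUP_iff by blast
      then have fin: "t < \<infinity>" by (metis infinity_ennreal_def less_le_trans top_greatest)
      then obtain r where r: "t = ennreal r" "0 \<le> r" by (cases t) auto
      have "confined state (K n) r w"
        unfolding confined_def
      proof (intro allI impI)
        fix j l assume "real j / 2 ^ l \<le> r"
        then have "ennreal (real j / 2 ^ l) \<le> t" using r by (simp add: ennreal_leI)
        then have "W (ennreal (real j / 2 ^ l)) w \<in> pt ` K n"
          using n by (intro W_before_exit_from) (rule le_less_trans)
        then show "state (real j / 2 ^ l) w \<in> Some ` K n"
          by (auto simp: image_iff state_eq_Some_iff)
      qed
      moreover have "state r w = Some y" using t r by (simp add: state_eq_Some_iff)
      ultimately show "killed K state t w = Some y"
        using r fin by (auto simp: killed_eq_Some_iff)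
    next
      assume "killed K state t w = Some y"
      then obtain n where fin: "t < \<infinity>" and n: "confined state (K n) (enn2real t) w"
        and st: "state (enn2real t) w = Some y"
        unfolding killed_eq_Some_iff by blast
      obtain r where r: "t = ennreal r" "0 \<le> r" using fin by (cases t) auto
      \<comment> \<open>Confinement tests dyadic times, so a state entered exactly at
        \<open>t\<close> need not belong to \<open>K n\<close>; a later set of the sequence contains
        it.\<close>
      obtain N where N: "y \<in> K N" using y K(3) by blast
      have "confined state (K (max n N)) r w"
        using confined_mono[OF n incseqD[OF K(1)] order_refl, of "max n N"] r by simp
      moreover have "y \<in> K (max n N)" using N incseqD[OF K(1), of N "max n N"] by auto
      ultimately have "ennreal r < exit_from (K (max n N)) w"
        using exit_from_confined[OF w K(2) KS r(2)] st r by simp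
      then have "t < exit_time G W w" using le_exit[of "max n N"] r by (metis less_le_trans)
      then show "t < exit_time G W w \<and> W t w = pt y" using st r by (simp add: state_eq_Some_iff)
    qed
    show ?case
    proof
      fix t
      show "path_before_exit G W w t = map_option Inner (killed K state t w)"
      proof (cases "killed K state t w")
        case (Some y)
        then have "state (enn2real t) w = Some y" by (simp add: killed_eq_Some_iff)
        then have "pt y \<in> topspace A"
          using W_in_topspace[OF w, of "ennreal (enn2real t)"] unfolding state_eq_Some_iff by (simp only:)
        then have "y \<in> carrier G" using topspace_A_pt by blast
        from main[OF this, of t] Some show ?thesis by (simp add: path_before_exit_def)
      next
        case None
        have "W t w = None" if t: "t < exit_time G W w"
        proof -
          have in_G: "\<exists>y\<in>carrier G. W t w = pt y"
          proof (cases "t = 0")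
            case True
            then show ?thesis using elim(2) x by auto
          next
            case False
            then have t0: "0 < t" by (simp add: zero_less_iff_neq_zero)
            have "W t w \<in> Some ` Inner ` carrier G"
            proof (rule ccontr)
              assume "W t w \<notin> Some ` Inner ` carrier G"
              then have "exit_time G W w \<le> t" unfolding exit_time_def using t0 by (intro Inf_lower) blast
              then show False using t by simp
            qed
            then show ?thesis by auto
          qed
          then obtain y where "y \<in> carrier G" "W t w = pt y" by blast
          then have "killed K state t w = Some y" using main t by blast
          then show ?thesis using None by simp
        qed
        then show ?thesis using None by (simp add: path_before_exit_def)
      qed
    qed
  qed
qed

end

section \<open>Equality in law\<close>

text \<open>The exit time involves uncountably many times, so \<open>f\<close> itself may fail to be
  measurable; the completion absorbs the null set on which it differs from \<open>g\<close>.\<close>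

lemma measurable_completion_AE:
  assumes g: "g \<in> M \<rightarrow>\<^sub>M N" and eq: "AE w in M. f w = g w" and f: "f \<in> space M \<rightarrow> space N"
  shows "f \<in> completion M \<rightarrow>\<^sub>M N"
proof (rule measurableI)
  show "f w \<in> space N" if "w \<in> space (completion M)" for w
    using that f by auto
  fix B assume B: "B \<in> sets N"
  show "f -` B \<inter> space (completion M) \<in> sets (completion M)"
  proof (rule completion.in_sets_AE[where A="g -` B \<inter> space M"])
    show "AE w in completion M. (w \<in> g -` B \<inter> space M) = (w \<in> f -` B \<inter> space (completion M))"
      by (rule AE_completion) (use eq in \<open>eventually_elim, auto\<close>)
    show "g -` B \<inter> space M \<in> sets (completion M)"
      using measurable_sets[OF g B] by (rule sets_completionI_sets)
  qed simp
qed

lemma equal_in_law_of_AE: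
  assumes f1: "g1 \<in> M1 \<rightarrow>\<^sub>M N" "AE w in M1. f1 w = g1 w" "f1 \<in> space M1 \<rightarrow> space N"
    and f2: "g2 \<in> M2 \<rightarrow>\<^sub>M N" "AE w in M2. f2 w = g2 w" "f2 \<in> space M2 \<rightarrow> space N"
    and eq: "distr M1 N g1 = distr M2 N g2"
  shows "equal_in_law N M1 f1 M2 f2"
proof -
  have d: "distr (completion M) N f = distr M N g"
    if "g \<in> M \<rightarrow>\<^sub>M N" "AE w in M. f w = g w" "f \<in> space M \<rightarrow> space N" for M :: "'z measure" and f g
  proof -
    have "distr (completion M) N f = distr (completion M) N g"
      using that by (intro distr_cong_AE measurable_completion_AE[OF that] measurable_completion) (auto intro: AE_completion)
    then show ?thesis using distr_completion[OF that(1)] by simp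
  qed
  show ?thesis
    unfolding equal_in_law_def d[OF f1] d[OF f2]
    using measurable_completion_AE[OF f1] measurable_completion_AE[OF f2] eq by simp
qed

theorem proposition8p2:
  fixes G :: "('a, 'b) monoid_scheme"
    and S :: "'a set"
    and \<rho> :: "(nat \<Rightarrow> 'a) set \<Rightarrow> (nat \<Rightarrow> 'a) set \<Rightarrow> real"
    and \<mu> :: "'a pmf"
    and \<omega> :: "'a measure"
    and x :: 'a
    and P :: "'p measure"
    and R :: "nat \<Rightarrow> 'p \<Rightarrow> 'a"
    and N :: "real \<Rightarrow> 'p \<Rightarrow> nat"
    and M :: "'w measure"
    and F :: "ennreal \<Rightarrow> 'w measure"
    and W :: "ennreal \<Rightarrow> 'w \<Rightarrow> 'a point option"
    and Q :: "'a point option \<Rightarrow> 'w measure"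
  assumes "group G" and "finite_symmetric_generators G S"
    and "word_hyperbolic G S" and "non_elementary G"
    and "visual_metric G S \<rho>"
    and "ahlfors_regular_conformal_dim (gromov_boundary G S) \<rho> < 2"
    and "\<mu> \<in> step_distributions G S 2"
    and "finite_measure \<omega>" and "full_support_measure G \<omega>"
    and "x \<in> carrier G"
    and "prob_space P" and "random_walk G \<mu> x P R" and "poisson_process P N"
    and "independent_processes G P R N"
    and "reflecting_random_walk G S \<mu> \<omega> M F W Q"
  shows "equal_in_law (path_space G S)
    P (path_before_exit G (time_changed_walk \<omega> (constant_speed_walk R N)))
    (Q (Some (Inner x))) (path_before_exit G W)"
proof -
  interpret group G by fact
  interpret Z: reflecting_setup G S \<mu> \<omega> M F W Q
    using assms by (intro reflecting_setup.intro marked_group.intro marked_group_axioms.intro reflecting_setup_axioms.intro)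
  interpret \<omega>: finite_measure \<omega> by fact
  let ?C = "carrier G"
  let ?Y = "time_changed_walk \<omega> (constant_speed_walk R N)"
  \<comment> \<open>The value 1 off the carrier only serves positivity, which the jump process asks
    on the whole type.\<close>
  define c where "c y = (if y \<in> ?C then measure \<omega> {y} else 1)" for y
  have c_pos: "0 < c y" for y
    using Z.\<omega>_pos by (simp add: c_def)
  interpret Y: walk_setup G \<mu> x P R N c
  proof (intro walk_setup.intro walk_setup_axioms.intro)
    show "countable ?C" by (rule Z.countable_carrier)
    show "set_pmf \<mu> \<subseteq> ?C" by (rule Z.\<mu>_facts)
  qed (use assms c_pos in auto)
  define K where "K n = from_nat_into ?C ` {..n}" for n :: nat
  have K: "incseq K" "\<And>n. finite (K n)" "(\<Union>n. K n) = ?C"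
  proof -
    show "incseq K" by (auto simp: incseq_def K_def)
    show "finite (K n)" for n by (simp add: K_def)
    have "(\<Union>n. K n) = range (from_nat_into ?C)" by (auto simp: K_def)
    also have "\<dots> = ?C" using Z.countable_carrier by (intro range_from_nat_into) auto
    finally show "(\<Union>n. K n) = ?C" .
  qed
  have KS: "\<And>n. K n \<subseteq> ?C" using K(3) by auto
  let ?P = "\<Pi>\<^sub>M t\<in>(UNIV :: ennreal set). count_space (insert None (Some ` ?C))"
  let ?kY = "\<lambda>w t. killed K Y.killed_walk t w" and ?kW = "\<lambda>w t. killed K Z.state t w"
  let ?Q = "Q (Some (Inner x))"
  \<comment> \<open>The laws are compared on paths with values in a countable set; this map carries
    such paths to the compactification with its cemetery.\<close>
  let ?\<Phi> = "\<lambda>v (t :: ennreal). map_option Inner (v t) :: 'a point option"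
  note spY = Y.skeleton_process_killed_walk and spW = Z.skeleton_process_state[OF \<open>x \<in> ?C\<close>]
  note kY = skeleton_process.measurable_killed_path[OF spY Y.G(2), of K, OF K(2) KS]
    and kW = skeleton_process.measurable_killed_path[OF spW Y.G(2), of K, OF K(2) KS]
  have \<Phi>: "?\<Phi> \<in> ?P \<rightarrow>\<^sub>M path_space G S"
    unfolding path_space_def
  proof (rule measurable_PiM_single')
    show "?\<Phi> \<in> space ?P \<rightarrow> (\<Pi>\<^sub>E t\<in>UNIV. space (borel_of Z.A))"
      by (auto simp: space_PiM space_borel_of Z.Inner_in_compact_points PiE_iff)
    fix t :: ennreal
    have "map_option Inner \<in> count_space (insert None (Some ` ?C)) \<rightarrow>\<^sub>M borel_of Z.A"
      by (auto simp: space_borel_of Z.Inner_in_compact_points)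
    from measurable_compose[OF measurable_component_singleton[of t] this]
    show "(\<lambda>v. map_option Inner (v t)) \<in> ?P \<rightarrow>\<^sub>M borel_of Z.A" by simp
  qed
  have law: "distr P ?P ?kY = distr ?Q ?P ?kW"
  proof (rule killed_law_eq[OF spY spW _ Y.G(2) K])
    fix y z assume y: "y \<in> ?C" and z: "z \<in> ?C"
    have "((\<lambda>h. (Y.J.transition h y z - of_bool (z = y)) / h - (Z.transition h y z - of_bool (z = y)) / h) \<longlongrightarrow>
        (pmf \<mu> (inv\<^bsub>G\<^esub> y \<otimes>\<^bsub>G\<^esub> z) - of_bool (z = y)) / c y - (pmf \<mu> (inv\<^bsub>G\<^esub> y \<otimes>\<^bsub>G\<^esub> z) - of_bool (z = y)) / measure \<omega> {y}) (at_right 0)"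
      by (intro tendsto_diff Y.transition_derivative Z.transition_derivative y z)
    then show "((\<lambda>h. (Y.J.transition h y z - Z.transition h y z) / h) \<longlongrightarrow> 0) (at_right 0)"
      using y by (simp add: c_def flip: diff_divide_distrib)
  qed
  show ?thesis
  proof (rule equal_in_law_of_AE)
    show "(\<lambda>w. ?\<Phi> (?kY w)) \<in> P \<rightarrow>\<^sub>M path_space G S" using kY \<Phi> by (rule measurable_compose)
    show "(\<lambda>w. ?\<Phi> (?kW w)) \<in> ?Q \<rightarrow>\<^sub>M path_space G S" using kW \<Phi> by (rule measurable_compose)
    show "distr P (path_space G S) (\<lambda>w. ?\<Phi> (?kY w)) = distr ?Q (path_space G S) (\<lambda>w. ?\<Phi> (?kW w))"
      using arg_cong[OF law, of "\<lambda>D. distr D (path_space G S) ?\<Phi>"]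
      by (simp add: distr_distr[OF \<Phi> kY] distr_distr[OF \<Phi> kW] comp_def)
    show "AE w in P. path_before_exit G ?Y w = ?\<Phi> (?kY w)"
      using \<omega>.emeasure_eq_measure by (intro Y.AE_path_before_exit[OF _ K(1,3)]) (simp add: c_def)
    show "AE w in ?Q. path_before_exit G W w = ?\<Phi> (?kW w)"
      by (rule Z.AE_path_before_exit[OF \<open>x \<in> ?C\<close> K])
    show "path_before_exit G ?Y \<in> space P \<rightarrow> space (path_space G S)"
      using Y.R_carrier
      by (auto simp: path_before_exit_def path_space_def space_PiM space_borel_of time_changed_walk_def
          constant_speed_walk_def Z.Inner_in_compact_points)
    show "path_before_exit G W \<in> space ?Q \<rightarrow> space (path_space G S)"
    proof
      fix w assume "w \<in> space ?Q"
      then have "path_before_exit G W w t \<in> topspace Z.A" for t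
        using Z.W_in_topspace[of w t] Z.Q_pt(3)[OF \<open>x \<in> ?C\<close>] by (simp add: path_before_exit_def)
      then show "path_before_exit G W w \<in> space (path_space G S)"
        by (simp add: path_space_def space_PiM space_borel_of PiE_iff)
    qed
  qed
qed

end
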